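(* Let $n\ge3$. Let $U\subset\mathcal S^{n\times n}$ be an open set and $F\in C^1(U)\cap C^0(\overline U)$ satisfy: (1) $O^{-1}UO=U$ for all $O\in O(n)$; (2) $M\in U$ and $N\in\mathcal S^{n\times n}_+$ imply $M+N\in U$; (3) $M\in U$ implies $aM\in U$ for all constants $a>0$; (4) $\{aI : a>0\}\cap\partial U=\emptyset$; (5) $F(O^{-1}MO)=F(M)$ for all $M\in U$, $O\in O(n)$; (6) the matrix $(F_{ij}(M))$ is positive definite for all $M\in U$, where $F_{ij}(M)=\frac{\partial F}{\partial M_{ij}}(M)$; (7) $F>0$ in $U$ and $F=0$ on $\partial U$. Assume that a positive function $u\in C^1(\mathbb R^n)$ is a weak solution of $F(A^u)=0$ in $\mathbb R^n$ and satisfies $\Delta u\le0$ in $\mathbb R^n$ in the distribution sense. Then $u\equiv u(0)$ in $\mathbb R^n$.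
   Context: $\mathcal S^{n\times n}$ is the set of $n\times n$ real symmetric matrices, $\mathcal S^{n\times n}_+$ the subset of positive definite matrices, $O(n)$ the set of $n\times n$ real orthogonal matrices, $I$ the identity matrix. For a positive $C^2$ function $u$, $$A^u=-\frac{2}{n-2}u^{-\frac{n+2}{n-2}}\nabla^2u+\frac{2n}{(n-2)^2}u^{-\frac{2n}{n-2}}\nabla u\otimes\nabla u-\frac{2}{(n-2)^2}u^{-\frac{2n}{n-2}}|\nabla u|^2I .$$ Weak solution: a positive continuous function $u$ on an open set $\Omega\subset\mathbb R^n$ is a weak solution of $F(A^u)=0$ in $\Omega$ if there exist sequences $\{u_i\}$ in $C^2(\Omega)$ and $\{\beta_i\}$ in $C^0(\Omega,\mathcal S^{n\times n})$ such that $u_i>0$ and $A^{u_i}+\beta_i\in U$ in $\Omega$, and, for any compact subset $K$ of $\Omega$, $u_i\to u$, $\beta_i\to0$ and $F(A^{u_i}+\beta_i)\to0$ in $C^0(K)$. *)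

theory Defs
  imports "HOL-Analysis.Analysis"
begin

section \<open>Differential operators and classes $C^k$\<close>

definition partial_deriv :: "'n::finite \<Rightarrow> (real^'n \<Rightarrow> real) \<Rightarrow> real^'n \<Rightarrow> real" where
  "partial_deriv i u x = frechet_derivative u (at x) (axis i 1)"

definition gradient :: "(real^'n::finite \<Rightarrow> real) \<Rightarrow> real^'n \<Rightarrow> real^'n" where
  "gradient u x = (\<chi> i. partial_deriv i u x)"

definition hessian :: "(real^'n::finite \<Rightarrow> real) \<Rightarrow> real^'n \<Rightarrow> real^'n^'n" where
  "hessian u x = (\<chi> i j. partial_deriv i (partial_deriv j u) x)"

definition laplacian :: "(real^'n::finite \<Rightarrow> real) \<Rightarrow> real^'n \<Rightarrow> real" where
  "laplacian u x = (\<Sum>i\<in>UNIV. partial_deriv i (partial_deriv i u) x)"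

text \<open>The class $C^k(\Omega)$; this is meant for open \<open>\<Omega>\<close> only.\<close>

primrec Ck_on :: "nat \<Rightarrow> (real^'n::finite) set \<Rightarrow> (real^'n \<Rightarrow> real) \<Rightarrow> bool" where
  "Ck_on 0 \<Omega> u \<longleftrightarrow> continuous_on \<Omega> u"
| "Ck_on (Suc k) \<Omega> u \<longleftrightarrow> u differentiable_on \<Omega> \<and> (\<forall>i. Ck_on k \<Omega> (partial_deriv i u))"

definition test_function :: "(real^'n::finite \<Rightarrow> real) \<Rightarrow> bool" where
  "test_function \<phi> \<longleftrightarrow> (\<forall>k. Ck_on k UNIV \<phi>) \<and> compact (closure {x. \<phi> x \<noteq> 0})"

text \<open>$\Delta u \le 0$ on the whole space in the sense of distributions. Meant for locally
  integrable \<open>u\<close> (here: continuous \<open>u\<close>), so that all the integrals below exist.\<close>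

definition distr_laplacian_nonpos :: "(real^'n::finite \<Rightarrow> real) \<Rightarrow> bool" where
  "distr_laplacian_nonpos u \<longleftrightarrow>
     (\<forall>\<phi>. test_function \<phi> \<and> (\<forall>x. \<phi> x \<ge> 0) \<longrightarrow> (LINT x|lborel. u x * laplacian \<phi> x) \<le> 0)"


section \<open>Symmetric matrices\<close>

definition sym_matrices :: "(real^'n::finite^'n) set" where
  "sym_matrices = {M. transpose M = M}"

definition pos_def_matrices :: "(real^'n::finite^'n) set" where
  "pos_def_matrices = {M \<in> sym_matrices. \<forall>x. x \<noteq> 0 \<longrightarrow> x \<bullet> (M *v x) > 0}"

text \<open>The matrix $(F_{ij}(M))$ of a function on symmetric matrices, with the usual convention that
  the increment \<open>E\<^sub>i\<^sub>j\<close> of the entry $M_{ij}$ is symmetrized to $(E_{ij}+E_{ji})/2$. This makes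
  $(F_{ij}(M))$ symmetric with $dF(M)[H] = \sum_{i,j} F_{ij}(M) H_{ij}$ for symmetric \<open>H\<close>, see
  \<open>has_derivative_matrix_gradient\<close> below.
  Values of \<open>F\<close> at non-symmetric matrices are irrelevant.\<close>

definition matrix_gradient :: "(real^'n::finite^'n \<Rightarrow> real) \<Rightarrow> real^'n^'n \<Rightarrow> real^'n^'n" where
  "matrix_gradient F M =
     (\<chi> i j. deriv (\<lambda>t. F (M + t *\<^sub>R ((1/2) *\<^sub>R (axis i (axis j 1) + axis j (axis i 1))))) 0)"

text \<open>The class $C^1(U)$ for \<open>U\<close> open relative to the space of symmetric matrices.\<close>

definition C1_on_sym :: "(real^'n::finite^'n) set \<Rightarrow> (real^'n^'n \<Rightarrow> real) \<Rightarrow> bool" where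
  "C1_on_sym U F \<longleftrightarrow> F differentiable_on U \<and> continuous_on U (matrix_gradient F)"

lemma has_derivative_matrix_gradient:
  fixes F :: "real^'n::finite^'n \<Rightarrow> real"
  assumes op: "openin (top_of_set sym_matrices) U" and M: "M \<in> U"
    and diff: "F differentiable_on U"
  shows "(F has_derivative (\<lambda>H. \<Sum>i\<in>UNIV. \<Sum>j\<in>UNIV. matrix_gradient F M $ i $ j * H $ i $ j))
           (at M within U)"
proof -
  let ?E = "\<lambda>i j. (1/2) *\<^sub>R (axis i (axis j 1) + axis j (axis i 1)) :: real^'n^'n"
  obtain D where D: "(F has_derivative D) (at M within U)"
    using diff M unfolding differentiable_on_def differentiable_def by blast
  then have lin: "linear D"
    by (rule has_derivative_linear)
  obtain T where T: "open T" "U = sym_matrices \<inter> T"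
    using op by (auto simp: openin_open)
  have symE: "M + t *\<^sub>R ?E i j \<in> sym_matrices" for i j t
    using M T by (auto simp: sym_matrices_def transpose_def vec_eq_iff axis_def)
  have grad: "matrix_gradient F M $ i $ j = D (?E i j)" for i j
  proof -
    let ?g = "\<lambda>t::real. M + t *\<^sub>R ?E i j"
    have cont: "continuous_on UNIV ?g"
      by (intro continuous_intros)
    define S where "S = ?g -` T"
    have S: "open S" "0 \<in> S"
      using open_vimage[OF T(1) cont] M T by (auto simp: S_def)
    have gS: "?g ` S \<subseteq> U"
      using symE T by (auto simp: S_def)
    have g: "(?g has_derivative (\<lambda>t. t *\<^sub>R ?E i j)) (at 0 within S)"
      by (auto intro!: derivative_eq_intros)
    have D': "(F has_derivative D) (at (?g 0) within ?g ` S)"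
      using has_derivative_subset[OF D gS] by simp
    have "((\<lambda>t. F (?g t)) has_derivative (\<lambda>t. D (t *\<^sub>R ?E i j))) (at 0 within S)"
      using has_derivative_in_compose[OF g D'] by simp
    then have "((\<lambda>t. F (?g t)) has_derivative (\<lambda>t. D (?E i j) * t)) (at 0)"
      using S by (simp only: at_within_open linear_scale[OF lin] real_scaleR_def mult.commute)
    then have "((\<lambda>t. F (?g t)) has_field_derivative D (?E i j)) (at 0)"
      by (simp add: has_field_derivative_def)
    then show ?thesis
      unfolding matrix_gradient_def by (simp add: DERIV_imp_deriv)
  qed
  have DH: "D H = (\<Sum>i\<in>UNIV. \<Sum>j\<in>UNIV. matrix_gradient F M $ i $ j * H $ i $ j)"
    if H: "H \<in> sym_matrices" for H
  proof -
    have sH: "H $ j $ i = H $ i $ j" for i j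
      using H by (auto simp: sym_matrices_def transpose_def vec_eq_iff)
    have "H = (\<Sum>i\<in>UNIV. \<Sum>j\<in>UNIV. H $ i $ j *\<^sub>R ?E i j)"
    proof -
      have "(\<Sum>i\<in>UNIV. \<Sum>j\<in>UNIV. H $ i $ j *\<^sub>R ?E i j) $ k $ l = H $ k $ l" for k l
      proof -
        have "(\<Sum>i\<in>UNIV. \<Sum>j\<in>UNIV. H $ i $ j *\<^sub>R ?E i j) $ k $ l =
            (\<Sum>i\<in>UNIV. \<Sum>j\<in>UNIV. (if i = k then if j = l then H $ i $ j / 2 else 0 else 0)
               + (if i = l then if j = k then H $ i $ j / 2 else 0 else 0))"
          unfolding sum_component by (intro sum.cong refl) (auto simp: axis_def)
        also have "\<dots> = H $ k $ l / 2 + H $ l $ k / 2"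
        proof -
          have "(\<Sum>i\<in>UNIV. \<Sum>j\<in>UNIV. if i = p then if j = q then H $ i $ j / 2 else 0 else 0)
              = H $ p $ q / 2" for p q
          proof -
            have "(\<Sum>i\<in>UNIV. \<Sum>j\<in>UNIV. if i = p then if j = q then H $ i $ j / 2 else 0 else 0)
                = (\<Sum>i\<in>UNIV. if i = p then H $ i $ q / 2 else 0)"
              by (intro sum.cong refl) auto
            then show ?thesis by simp
          qed
          then show ?thesis by (simp only: sum.distrib)
        qed
        finally show ?thesis by (simp add: sH)
      qed
      then show ?thesis by (simp add: vec_eq_iff)
    qed
    then have "D H = D (\<Sum>i\<in>UNIV. \<Sum>j\<in>UNIV. H $ i $ j *\<^sub>R ?E i j)"
      by simp
    also have "\<dots> = (\<Sum>i\<in>UNIV. \<Sum>j\<in>UNIV. H $ i $ j * D (?E i j))"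
      by (simp only: linear_sum[OF lin] linear_scale[OF lin] real_scaleR_def)
    finally show ?thesis
      by (simp add: grad mult.commute)
  qed
  have bl: "bounded_linear (\<lambda>H::real^'n^'n. \<Sum>i\<in>UNIV. \<Sum>j\<in>UNIV. matrix_gradient F M $ i $ j * H $ i $ j)"
    by (intro bounded_linear_sum bounded_linear_compose[OF bounded_linear_mult_right]
          bounded_linear_compose[OF bounded_linear_vec_nth bounded_linear_vec_nth])
  have "y - M \<in> sym_matrices" if "y \<in> U" for y
    using that M T by (auto simp: sym_matrices_def transpose_def vec_eq_iff)
  then have "\<forall>\<^sub>F y in at M within U. norm (F y - F M - D (y - M)) / norm (y - M) =
      norm (F y - F M - (\<Sum>i\<in>UNIV. \<Sum>j\<in>UNIV. matrix_gradient F M $ i $ j * (y - M) $ i $ j)) / norm (y - M)"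
    using DH by (auto simp: eventually_at_filter)
  from tendsto_cong[OF this] show ?thesis
    using D bl unfolding has_derivative_iff_norm by blast
qed


section \<open>The conformal Hessian and weak solutions\<close>

definition conf_hessian :: "(real^'n::finite \<Rightarrow> real) \<Rightarrow> real^'n \<Rightarrow> real^'n^'n" where
  "conf_hessian u x = (let n = real CARD('n); Du = gradient u x in
     (- (2 / (n - 2)) * u x powr (- ((n + 2) / (n - 2)))) *\<^sub>R hessian u x
     + (2 * n / (n - 2)^2 * u x powr (- (2 * n / (n - 2)))) *\<^sub>R (\<chi> i j. Du $ i * Du $ j)
     - (2 / (n - 2)^2 * u x powr (- (2 * n / (n - 2))) * (norm Du)^2) *\<^sub>R mat 1)"

definition weak_solution ::
  "(real^'n::finite^'n) set \<Rightarrow> (real^'n^'n \<Rightarrow> real) \<Rightarrow> (real^'n) set \<Rightarrow> (real^'n \<Rightarrow> real) \<Rightarrow> bool" where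
  "weak_solution U F \<Omega> u \<longleftrightarrow>
     open \<Omega> \<and> continuous_on \<Omega> u \<and> (\<forall>x\<in>\<Omega>. u x > 0) \<and>
     (\<exists>(v :: nat \<Rightarrow> real^'n \<Rightarrow> real) (\<beta> :: nat \<Rightarrow> real^'n \<Rightarrow> real^'n^'n).
        (\<forall>k. Ck_on 2 \<Omega> (v k) \<and> continuous_on \<Omega> (\<beta> k) \<and>
             (\<forall>x\<in>\<Omega>. \<beta> k x \<in> sym_matrices \<and> v k x > 0 \<and> conf_hessian (v k) x + \<beta> k x \<in> U)) \<and>
        (\<forall>K. compact K \<and> K \<subseteq> \<Omega> \<longrightarrow>
             uniform_limit K v u sequentially \<and>
             uniform_limit K \<beta> (\<lambda>_. 0) sequentially \<and>
             uniform_limit K (\<lambda>k x. F (conf_hessian (v k) x + \<beta> k x)) (\<lambda>_. 0) sequentially))"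

end

theory Submission
  imports Defs
begin

text \<open>
  Put \<open>\<omega> = u powr (- 2 / (n - 2))\<close>. Then \<open>A\<^sup>u = \<omega> \<nabla>\<^sup>2\<omega> - |\<nabla>\<omega>|\<^sup>2 / 2 I\<close>, and \<open>A\<^sup>u / \<omega>\<close> is superadditive in
  \<open>\<omega>\<close>, so adding to \<open>\<omega>\<close> a quadratic polynomial \<open>m + b \<bullet> y + d |y|\<^sup>2\<close> with \<open>4 d m > |b|\<^sup>2\<close> turns an approximate
  supersolution into a strict one, without any bound on gradients. The Kelvin transform
  \<open>\<omega>'(y) = |y|\<^sup>2 / l\<^sup>2 \<omega>(l\<^sup>2 y / |y|\<^sup>2)\<close> conjugates \<open>A\<^sup>u\<close> by reflections. The claim is that
  \<open>\<omega>' \<le> \<omega>\<close> in the punctured ball of radius \<open>l\<close>, for every centre and every \<open>l\<close>; sending the centre to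
  infinity along a line then shows that \<open>\<omega>\<close> is constant.

  For the claim let \<open>a\<close> be maximal with \<open>a \<omega>' \<le> \<omega>\<close> and suppose \<open>a < 1\<close>. The functions
  \<open>\<omega> - (1 - \<tau>) a \<omega>' - d |y|\<^sup>2 - b \<bullet> y\<close> with small \<open>\<tau>, d, b\<close> have no interior minimum, since the weak
  solution property of \<open>u\<close> excludes strict supersolutions touching \<open>\<omega>\<close> from below. Varying the direction of
  \<open>b\<close> yields a conical gap at the puncture, which superharmonicity of \<open>u\<close>, compared in the exterior domain with
  Kelvin transforms of affine functions, upgrades to a gap \<open>\<omega> - a \<omega>' \<ge> \<kappa> > 0\<close>. The case \<open>b = 0\<close> spreads this
  gap to the whole ball, contradicting maximality of \<open>a\<close>.
\<close>

section \<open>Positive semidefinite matrices and monotonicity of F\<close>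

text \<open>Dividing the tensor by \<open>\<omega>\<close> is harmless because \<open>U\<close> is a
  cone; superadditivity then holds because |p|^2 / z is jointly convex and homogeneous of degree
  one. A quadratic m + b . y + d |y|^2 has Schouten tensor (4 d m - |b|^2) / 2 times the identity at
  every point, which is why exactly these polynomials serve as perturbations. The approximants
  converge only uniformly, so their derivatives are read off at contact points alone, where the test
  function prescribes the gradient. The obstacle is the puncture. Superharmonicity bounds
  \<open>\<omega>'\<close> above near it, so some positive \<open>a\<close> exists, but for maximal
  \<open>a\<close> the difference \<open>\<omega> - a \<omega>'\<close> could still tend to zero
  exactly there. Linear terms of length e in all directions give a lower bound growing like e |y|.
  Since \<open>\<omega>\<close> is differentiable at the centre, this cone beats the Taylor
  remainder on a small sphere, while the linear Taylor part is matched by an affine function, whose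
  Kelvin transform is harmonic. The slack on the sphere thus becomes a constant gain at the centre;
  this is where differentiability of \<open>u\<close> enters.\<close>

lemma norm_mult_vec_le: "norm (A *v x) \<le> norm A * norm (x::real^'n)" for A :: "real^'n^'m"
proof -
  have "norm (A *v x) = L2_set (\<lambda>i. norm ((A *v x) $ i)) UNIV"
    by (simp add: norm_vec_def)
  also have "\<dots> \<le> L2_set (\<lambda>i. norm (A $ i) * norm x) UNIV"
    by (intro L2_set_mono) (auto simp: matrix_vector_mult_def inner_vec_def
        simp flip: Cauchy_Schwarz_ineq2 intro!: order_trans[OF _ Cauchy_Schwarz_ineq2])
  also have "\<dots> = norm A * norm x"
    by (simp add: norm_vec_def L2_set_left_distrib)
  finally show ?thesis .
qed

lemma abs_quad_le: "\<bar>x \<bullet> (A *v x)\<bar> \<le> norm A * (norm x)\<^sup>2" for x :: "real^'n"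
proof -
  have "\<bar>x \<bullet> (A *v x)\<bar> \<le> norm x * norm (A *v x)" by (rule Cauchy_Schwarz_ineq2)
  also have "\<dots> \<le> norm x * (norm A * norm x)" by (intro mult_left_mono norm_mult_vec_le) auto
  finally show ?thesis by (simp add: power2_eq_square mult_ac)
qed

definition psd :: "real^'n^'n \<Rightarrow> bool" where
  "psd B \<longleftrightarrow> transpose B = B \<and> (\<forall>x. 0 \<le> x \<bullet> (B *v x))"

definition outer :: "real^'n \<Rightarrow> real^'n \<Rightarrow> real^'n^'n" where
  "outer a b = (\<chi> i j. a $ i * b $ j)"

lemma outer_mult_vec: "outer a b *v x = (b \<bullet> x) *\<^sub>R a"
  by (simp add: outer_def vec_eq_iff matrix_vector_mult_def inner_vec_def sum_distrib_left mult_ac)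

lemma transpose_outer: "transpose (outer a b) = outer b a"
  by (simp add: outer_def transpose_def vec_eq_iff)

lemma transpose_add: "transpose (A + B) = transpose A + transpose (B::real^'n^'m)"
  by (simp add: transpose_def vec_eq_iff)

lemma transpose_diff: "transpose (A - B) = transpose A - transpose (B::real^'n^'m)"
  by (simp add: transpose_def vec_eq_iff)

lemma transpose_minus: "transpose (- B) = - transpose (B::real^'n^'m)"
  by (simp add: transpose_def vec_eq_iff)

lemma transpose_zero: "transpose 0 = (0::real^'n^'m)"
  by (simp add: transpose_def vec_eq_iff)

lemmas transpose_simps = transpose_add transpose_diff transpose_minus transpose_zero
  transpose_scalar transpose_mat transpose_outer

lemmas mult_vec_simps = matrix_vector_mult_add_rdistrib matrix_vector_mult_diff_rdistrib
  scaleR_matrix_vector_assoc[symmetric] matrix_vector_mul_lid outer_mult_vec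

lemma sym_inner: "transpose A = A \<Longrightarrow> x \<bullet> (A *v y) = (A *v x) \<bullet> y" for A :: "real^'n^'n"
  by (metis dot_lmul_matrix transpose_matrix_vector)

lemma quad_axis: "axis i 1 \<bullet> (B *v axis i 1) = B $ i $ i" for B :: "real^'n^'n"
  by (simp add: inner_axis' matrix_vector_mul_component inner_axis)

definition matrix_inner :: "real^'n^'n \<Rightarrow> real^'n^'n \<Rightarrow> real" where
  "matrix_inner A B = (\<Sum>i\<in>UNIV. \<Sum>j\<in>UNIV. A $ i $ j * B $ i $ j)"

lemma matrix_inner_add: "matrix_inner A (B + C) = matrix_inner A B + matrix_inner A C"
  by (simp add: matrix_inner_def distrib_left sum.distrib)

lemma matrix_inner_outer: "matrix_inner A (c *\<^sub>R outer v v) = c * (v \<bullet> (A *v v))"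
  by (simp add: matrix_inner_def outer_def inner_vec_def matrix_vector_mult_def sum_distrib_left mult_ac)

text \<open>Completing the square: minimising the quadratic form along the line through x in
  direction e_i gives the form of the Schur complement, which therefore stays nonnegative.\<close>

lemma psd_schur_step:
  assumes "psd B" "B $ i $ i > 0"
  defines "v \<equiv> B *v axis i 1"
  shows "psd (B - (1 / B $ i $ i) *\<^sub>R outer v v)"
  unfolding psd_def
proof (intro conjI allI)
  have sym: "transpose B = B" using assms by (simp add: psd_def)
  then show "transpose (B - (1 / B $ i $ i) *\<^sub>R outer v v) = B - (1 / B $ i $ i) *\<^sub>R outer v v"
    by (simp add: transpose_simps)
  fix x
  let ?d = "B $ i $ i" and ?s = "v \<bullet> x"
  have d: "axis i 1 \<bullet> v = ?d" by (simp add: v_def quad_axis)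
  have vx: "axis i 1 \<bullet> (B *v x) = ?s" using sym_inner[OF sym] by (simp add: v_def)
  have xv: "x \<bullet> (B *v axis i 1) = ?s" by (simp add: v_def inner_commute)
  have "0 \<le> (x - (?s / ?d) *\<^sub>R axis i 1) \<bullet> (B *v (x - (?s / ?d) *\<^sub>R axis i 1))"
    using assms by (simp add: psd_def)
  also have "\<dots> = x \<bullet> (B *v x) - ?s\<^sup>2 / ?d"
    using d assms(2)
    by (simp add: matrix_vector_mult_diff_distrib matrix_vector_mult_scaleR inner_diff_left inner_diff_right
        vx xv quad_axis power2_eq_square field_simps)
  also have "\<dots> = x \<bullet> ((B - (1 / ?d) *\<^sub>R outer v v) *v x)"
    by (simp add: mult_vec_simps inner_diff_right power2_eq_square inner_commute)
  finally show "0 \<le> x \<bullet> ((B - (1 / ?d) *\<^sub>R outer v v) *v x)" .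
qed

text \<open>When e_i is isotropic, the form at \<open>?v - s *\<^sub>R axis i 1\<close> is affine in
  \<open>s\<close> with slope -2 |v|^2, so it can stay nonnegative for all \<open>s\<close> only if
  the i-th column \<open>?v\<close> vanishes.\<close>

lemma psd_diag_zero:
  assumes "psd B" "B $ i $ i = 0" shows "B $ i = 0"
proof -
  have sym: "transpose B = B" using assms by (simp add: psd_def)
  let ?v = "B *v axis i 1"
  have "?v \<bullet> ?v = 0"
  proof (rule ccontr)
    assume n: "?v \<bullet> ?v \<noteq> 0"
    define q where "q = ?v \<bullet> (B *v ?v)"
    \<comment> \<open>Solves q - 2 s |v|^2 = -1.\<close>
    define s where "s = (q + 1) / (2 * (?v \<bullet> ?v))"
    have vB: "axis i 1 \<bullet> (B *v ?v) = ?v \<bullet> ?v" using sym_inner[OF sym] by simp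
    have "0 \<le> (?v - s *\<^sub>R axis i 1) \<bullet> (B *v (?v - s *\<^sub>R axis i 1))"
      using assms by (simp add: psd_def)
    also have "\<dots> = q - 2 * s * (?v \<bullet> ?v)"
      using assms(2) quad_axis[of i B]
      by (simp add: matrix_vector_mult_diff_distrib matrix_vector_mult_scaleR inner_diff_left inner_diff_right
          vB q_def)
    also have "\<dots> = -1" using n by (simp add: s_def field_simps del: inner_eq_zero_iff)
    finally show False by simp
  qed
  then have "?v = 0" by simp
  then have "column i B = 0" by (simp add: matrix_vector_mult_basis)
  then show ?thesis using sym by (metis column_transpose row_def vec_lambda_eta)
qed

text \<open>Symmetric Gaussian elimination: subtracting the Schur term of a positive pivot clears
  row i and creates no new nonzero row, so the number of nonzero rows serves as the induction
  measure.\<close>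

lemma psd_decompose_induct:
  assumes "psd B" "P 0"
    and "\<And>B v c. P B \<Longrightarrow> c \<ge> 0 \<Longrightarrow> P (B + c *\<^sub>R outer v v)"
  shows "P B"
  using assms(1)
proof (induction "card {i. B $ i \<noteq> 0}" arbitrary: B rule: less_induct)
  case less
  show ?case
  proof (cases "B = 0")
    case False
    then obtain i where "B $ i \<noteq> 0" by (metis vec_eq_iff zero_index)
    then have "B $ i $ i \<noteq> 0" using psd_diag_zero less.prems by blast
    moreover have "B $ i $ i \<ge> 0" using less.prems quad_axis[of i B] by (metis psd_def)
    ultimately have pos: "B $ i $ i > 0" by simp
    define v where "v = B *v axis i 1"
    define C where "C = B - (1 / B $ i $ i) *\<^sub>R outer v v"
    have sym: "transpose B = B" using less.prems by (simp add: psd_def)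
    have v: "v $ j = B $ i $ j" for j
    proof -
      have "v $ j = B $ j $ i" by (simp add: v_def matrix_vector_mul_component inner_axis)
      also have "\<dots> = B $ i $ j" using sym by (metis transpose_def vec_lambda_beta)
      finally show ?thesis .
    qed
    have C: "psd C" using psd_schur_step[OF less.prems pos] by (simp add: C_def v_def)
    have "{j. C $ j \<noteq> 0} \<subseteq> {j. B $ j \<noteq> 0} - {i}"
    proof safe
      fix j assume j: "C $ j \<noteq> 0" "B $ j = 0"
      have "B $ i $ j = B $ j $ i" using sym by (metis transpose_def vec_lambda_beta)
      then have "C $ j $ l = 0" for l using j by (simp add: C_def outer_def v)
      with j show False by (simp add: vec_eq_iff)
    next
      assume i: "C $ i \<noteq> 0"
      have "C $ i $ l = 0" for l using pos by (simp add: C_def outer_def v)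
      with i show False by (simp add: vec_eq_iff)
    qed
    then have "card {j. C $ j \<noteq> 0} < card {j. B $ j \<noteq> 0}"
      using \<open>B $ i \<noteq> 0\<close> by (intro psubset_card_mono) auto
    from less.hyps[OF this C] have "P C" .
    from assms(3)[OF this, of "1 / B $ i $ i" v] pos show ?thesis by (simp add: C_def)
  qed (use assms in simp)
qed

lemma matrix_inner_nonneg:
  assumes "A \<in> pos_def_matrices" "psd B" shows "matrix_inner A B \<ge> 0"
proof (rule psd_decompose_induct[OF assms(2)])
  show "matrix_inner A 0 \<ge> 0" by (simp add: matrix_inner_def)
next
  fix B :: "real^'a^'a" and v :: "real^'a" and c :: real
  assume *: "matrix_inner A B \<ge> 0" "c \<ge> 0"
  have "0 \<le> v \<bullet> (A *v v)"
    using assms(1) by (cases "v = 0") (auto simp: pos_def_matrices_def less_imp_le)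
  with * show "matrix_inner A (B + c *\<^sub>R outer v v) \<ge> 0" by (simp add: matrix_inner_add matrix_inner_outer)
qed

lemma pos_def_imp_psd: "A \<in> pos_def_matrices \<Longrightarrow> psd A"
  unfolding psd_def pos_def_matrices_def sym_matrices_def
proof (safe)
  fix x assume "\<forall>x. x \<noteq> 0 \<longrightarrow> 0 < x \<bullet> (A *v x)"
  then show "0 \<le> x \<bullet> (A *v x)" by (cases "x = 0") (auto simp: less_imp_le)
qed

lemma psd_add_mat_pos_def: "psd N \<Longrightarrow> c > 0 \<Longrightarrow> N + c *\<^sub>R mat 1 \<in> pos_def_matrices"
  by (auto simp: pos_def_matrices_def sym_matrices_def psd_def mult_vec_simps transpose_simps inner_add_right
      intro!: add_nonneg_pos)

text \<open>The perturbation is measured by its quadratic form because this bound is preserved when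
  an error matrix is conjugated by a reflection.\<close>

lemma mat_add_bounded_pos_def:
  fixes B :: "real^'n^'n"
  assumes "transpose B = B" "\<And>x. \<bar>x \<bullet> (B *v x)\<bar> \<le> r * (norm x)\<^sup>2" "r < c"
  shows "c *\<^sub>R mat 1 + B \<in> pos_def_matrices"
  unfolding pos_def_matrices_def sym_matrices_def
proof (safe)
  fix x :: "real^'n" assume x: "x \<noteq> 0"
  have "- (x \<bullet> (B *v x)) \<le> r * (norm x)\<^sup>2" using assms(2)[of x] by linarith
  also have "\<dots> < c * (norm x)\<^sup>2" using x assms by simp
  finally show "0 < x \<bullet> ((c *\<^sub>R mat 1 + B) *v x)"
    by (simp add: mult_vec_simps inner_add_right power2_norm_eq_inner)
qed (use assms in \<open>simp add: transpose_simps\<close>)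

lemma mat_add_small_pos_def:
  assumes "transpose B = B" "norm B < c" shows "c *\<^sub>R mat 1 + B \<in> pos_def_matrices"
  by (rule mat_add_bounded_pos_def[OF assms(1) abs_quad_le assms(2)])

section \<open>Room inside the open cone\<close>

lemma openin_sym_nbhd:
  assumes "openin (top_of_set sym_matrices) U" "M \<in> U"
  obtains e where "e > 0" "\<And>N. transpose N = N \<Longrightarrow> norm (N - M) < e \<Longrightarrow> N \<in> U"
proof -
  obtain T where T: "open T" "U = sym_matrices \<inter> T" using assms by (auto simp: openin_open)
  then obtain e where "e > 0" "ball M e \<subseteq> T" using assms(2) openE by blast
  then show ?thesis using T(2) by (intro that[of e]) (auto simp: sym_matrices_def dist_norm norm_minus_commute)
qed

lemma openin_sym_sym: "openin (top_of_set sym_matrices) U \<Longrightarrow> M \<in> U \<Longrightarrow> transpose M = M"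
  using openin_imp_subset by (fastforce simp: sym_matrices_def)

lemma norm_mat_pos: "norm (mat 1 :: real^'n^'n) > 0"
  by (metis matrix_vector_mul_lid norm_mult_vec_le[of "mat 1 :: real^'n^'n" "axis undefined 1"]
      norm_axis_1 less_le_trans zero_less_one mult.right_neutral)

lemma shrink_in_cone:
  fixes U :: "(real^'n::finite^'n) set"
  assumes "openin (top_of_set sym_matrices) U" "M \<in> U"
  obtains e where "e > 0" "M - e *\<^sub>R mat 1 \<in> U"
proof -
  obtain e where e: "e > 0" "\<And>N. transpose N = N \<Longrightarrow> norm (N - M) < e \<Longrightarrow> N \<in> U"
    using openin_sym_nbhd[OF assms] by blast
  define d where "d = e / (2 * norm (mat 1 :: real^'n^'n))"
  have d: "d > 0" using e norm_mat_pos[where 'n='n] by (simp add: d_def del: zero_less_norm_iff)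
  have "norm ((M - d *\<^sub>R mat 1) - M) < e"
    using e norm_mat_pos[where 'n='n] by (simp add: d_def del: zero_less_norm_iff)
  then have "M - d *\<^sub>R mat 1 \<in> U"
    using openin_sym_sym[OF assms] by (intro e) (auto simp: transpose_simps)
  with d that show ?thesis by blast
qed

text \<open>Openness leaves room to lower \<open>M\<close> by a small multiple of the identity;
  adding the same multiple to \<open>N\<close> makes it positive definite.\<close>

lemma add_psd_in_cone:
  fixes U :: "(real^'n::finite^'n) set"
  assumes "openin (top_of_set sym_matrices) U"
    and "\<And>M N. M \<in> U \<Longrightarrow> N \<in> pos_def_matrices \<Longrightarrow> M + N \<in> U"
    and "M \<in> U" "psd N"
  shows "M + N \<in> U"
proof -
  obtain e where e: "e > 0" "M - e *\<^sub>R mat 1 \<in> U" using shrink_in_cone assms by blast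
  have "(M - e *\<^sub>R mat 1) + (N + e *\<^sub>R mat 1) \<in> U"
    using e psd_add_mat_pos_def assms by blast
  then show ?thesis by simp
qed

text \<open>Along the segment from \<open>M\<close> to \<open>M + N\<close>, which stays in
  \<open>U\<close>, the derivative of \<open>F\<close> is the pairing of a positive definite with a
  positive semidefinite matrix.\<close>

lemma F_mono:
  fixes U :: "(real^'n::finite^'n) set" and F :: "real^'n^'n \<Rightarrow> real"
  assumes U_open: "openin (top_of_set sym_matrices) U"
    and U_pos: "\<And>M N. M \<in> U \<Longrightarrow> N \<in> pos_def_matrices \<Longrightarrow> M + N \<in> U"
    and F_diff: "F differentiable_on U"
    and F_ell: "\<And>M. M \<in> U \<Longrightarrow> matrix_gradient F M \<in> pos_def_matrices"
    and M: "M \<in> U" and N: "psd N"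
  shows "F M \<le> F (M + N)"
proof -
  have inU: "M + t *\<^sub>R N \<in> U" if "t \<ge> 0" for t
    using that N by (intro add_psd_in_cone[OF U_open U_pos M])
      (auto simp: psd_def transpose_simps mult_vec_simps)
  let ?g = "\<lambda>t::real. F (M + t *\<^sub>R N)"
  have "(?g has_field_derivative matrix_inner (matrix_gradient F (M + t *\<^sub>R N)) N) (at t within {0..1})"
    if t: "t \<in> {0..1}" for t
  proof -
    have 1: "((\<lambda>t. M + t *\<^sub>R N) has_derivative (\<lambda>t. t *\<^sub>R N)) (at t within {0..1})"
      by (auto intro!: derivative_eq_intros)
    have sub: "(\<lambda>t. M + t *\<^sub>R N) ` {0..1} \<subseteq> U" using inU by auto
    have 2: "(F has_derivative (\<lambda>H. matrix_inner (matrix_gradient F (M + t *\<^sub>R N)) H))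
        (at (M + t *\<^sub>R N) within (\<lambda>t. M + t *\<^sub>R N) ` {0..1})"
      using has_derivative_subset[OF has_derivative_matrix_gradient[OF U_open inU F_diff] sub] t
      by (simp add: matrix_inner_def)
    have "matrix_inner A (c *\<^sub>R B) = matrix_inner A B * c" for A B :: "real^'n^'n" and c
      by (simp add: matrix_inner_def sum_distrib_left mult_ac)
    with has_derivative_in_compose[OF 1 2] show ?thesis
      by (simp add: has_field_derivative_def mult_commute_abs)
  qed
  then have "\<exists>t\<in>{0..1}. ?g 1 - ?g 0 = matrix_inner (matrix_gradient F (M + t *\<^sub>R N)) N * (1 - 0)"
    by (intro mvt_very_simple) (auto simp: has_field_derivative_def)
  then obtain t where "t \<ge> 0" "?g 1 - ?g 0 = matrix_inner (matrix_gradient F (M + t *\<^sub>R N)) N" by auto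
  moreover have "matrix_inner (matrix_gradient F (M + t *\<^sub>R N)) N \<ge> 0"
    using matrix_inner_nonneg[OF F_ell[OF inU] N] \<open>t \<ge> 0\<close> by blast
  ultimately show ?thesis by simp
qed

section \<open>Second-order jets\<close>

text \<open>The gradient exists on a neighbourhood, the Hessian only as the derivative of
  \<open>G\<close> at the point itself. In this form the notion passes through powers, products and
  inversions; symmetry of \<open>H\<close> is kept as a separate condition.\<close>

definition twice_diff :: "(real^'n \<Rightarrow> real) \<Rightarrow> (real^'n \<Rightarrow> real^'n) \<Rightarrow> real^'n^'n \<Rightarrow> real^'n \<Rightarrow> bool" where
  "twice_diff f G H x \<longleftrightarrow> (\<forall>\<^sub>F y in nhds x. (f has_derivative (\<lambda>h. G y \<bullet> h)) (at y))
     \<and> (G has_derivative (\<lambda>h. H *v h)) (at x)"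

text \<open>The second-order subjet of viscosity theory, with the o(|y - x|^2) error spelled out by
  \<open>e\<close>.\<close>

definition subjet :: "(real^'n \<Rightarrow> real) \<Rightarrow> real^'n \<Rightarrow> real^'n \<Rightarrow> real^'n^'n \<Rightarrow> bool" where
  "subjet f x p P \<longleftrightarrow> (\<forall>e>0. \<forall>\<^sub>F y in nhds x.
     f x + p \<bullet> (y - x) + (y - x) \<bullet> (P *v (y - x)) / 2 - e * (norm (y - x))\<^sup>2 \<le> f y)"

lemma twice_diff_minus: "twice_diff f G H x \<Longrightarrow> twice_diff (\<lambda>y. - f y) (\<lambda>y. - G y) (- H) x"
  unfolding twice_diff_def
proof (elim conjE, intro conjI)
  assume "\<forall>\<^sub>F y in nhds x. (f has_derivative (\<lambda>h. G y \<bullet> h)) (at y)"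
  then show "\<forall>\<^sub>F y in nhds x. ((\<lambda>y. - f y) has_derivative (\<lambda>h. - G y \<bullet> h)) (at y)"
    by eventually_elim (auto intro!: derivative_eq_intros)
  assume "(G has_derivative (\<lambda>h. H *v h)) (at x)"
  then show "((\<lambda>y. - G y) has_derivative (\<lambda>h. - H *v h)) (at x)"
    by (auto intro!: derivative_eq_intros simp: matrix_vector_mult_def vec_eq_iff sum_negf)
qed

lemma has_derivative_quad:
  fixes H :: "real^'n^'n"
  assumes "transpose H = H"
  shows "((\<lambda>y. (y - x) \<bullet> (H *v (y - x)) / 2) has_derivative (\<lambda>h. (H *v (y - x)) \<bullet> h)) (at y)"
proof -
  have 1: "((\<lambda>y. y - x) has_derivative (\<lambda>h. h)) (at y)" by (auto intro!: derivative_eq_intros)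
  have 2: "((\<lambda>y. H *v (y - x)) has_derivative (\<lambda>h. H *v h)) (at y)"
    using bounded_linear.has_derivative[OF matrix_vector_mul_bounded_linear[of H] 1] by simp
  have "((\<lambda>y. inverse 2 * ((y - x) \<bullet> (H *v (y - x)))) has_derivative
      (\<lambda>h. inverse 2 * ((y - x) \<bullet> (H *v h) + h \<bullet> (H *v (y - x))))) (at y)"
    by (intro has_derivative_mult_right has_derivative_inner 1 2)
  moreover have "inverse 2 * ((y - x) \<bullet> (H *v h) + h \<bullet> (H *v (y - x))) = (H *v (y - x)) \<bullet> h" for h
    unfolding inner_commute[of h] sym_inner[OF assms, of "y - x" h] by simp
  ultimately show ?thesis by (simp only: divide_inverse mult.commute[of _ "inverse 2"])
qed

text \<open>By the definition of \<open>H\<close> the Taylor remainder has gradient o(|z - x|), so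
  the mean value inequality on the ball of radius |y - x| makes the remainder o(|y - x|^2).\<close>

lemma twice_diff_imp_subjet:
  assumes td: "twice_diff f G H x" and sym: "transpose H = H"
  shows "subjet f x (G x) H"
  unfolding subjet_def
proof (intro allI impI)
  fix e :: real assume e: "e > 0"
  obtain d1 where d1: "d1 > 0" "\<And>y. dist y x < d1 \<Longrightarrow> (f has_derivative (\<lambda>h. G y \<bullet> h)) (at y)"
    using td unfolding twice_diff_def eventually_nhds_metric by blast
  obtain d2 where d2: "d2 > 0"
      "\<And>y. norm (y - x) < d2 \<Longrightarrow> norm (G y - G x - H *v (y - x)) \<le> e * norm (y - x)"
    using td e unfolding twice_diff_def has_derivative_at_alt by blast
  let ?r = "\<lambda>y. f y - (G x \<bullet> (y - x) + (y - x) \<bullet> (H *v (y - x)) / 2)"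
  have der: "(?r has_derivative (\<lambda>h. (G y - G x - H *v (y - x)) \<bullet> h)) (at y)" if "dist y x < d1" for y
  proof -
    have "((\<lambda>y. G x \<bullet> (y - x)) has_derivative (\<lambda>h. G x \<bullet> h)) (at y)"
      by (auto intro!: derivative_eq_intros)
    from has_derivative_diff[OF d1(2)[OF that] has_derivative_add[OF this has_derivative_quad[OF sym, of x]]]
    show ?thesis by (simp only: inner_diff_left diff_diff_eq inner_add_left)
  qed
  show "\<forall>\<^sub>F y in nhds x.
     f x + G x \<bullet> (y - x) + (y - x) \<bullet> (H *v (y - x)) / 2 - e * (norm (y - x))\<^sup>2 \<le> f y"
    unfolding eventually_nhds_metric
  proof (intro exI[of _ "min d1 d2"] conjI allI impI)
    fix y assume y: "dist y x < min d1 d2"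
    let ?S = "cball x (dist y x)"
    have "norm (?r y - ?r x) \<le> (e * norm (y - x)) * norm (y - x)"
    proof (rule differentiable_bound[of ?S])
      fix z assume z: "z \<in> ?S"
      then have zd: "dist z x < d1" "norm (z - x) < d2" "norm (z - x) \<le> norm (y - x)"
        using y by (auto simp: dist_norm norm_minus_commute)
      show "(?r has_derivative (\<lambda>h. (G z - G x - H *v (z - x)) \<bullet> h)) (at z within ?S)"
        using der[OF zd(1)] has_derivative_at_withinI by blast
      have "norm (G z - G x - H *v (z - x)) \<le> e * norm (y - x)"
        using d2(2)[OF zd(2)] zd(3) e by (meson mult_left_mono order_trans less_imp_le)
      then show "onorm (\<lambda>h. (G z - G x - H *v (z - x)) \<bullet> h) \<le> e * norm (y - x)"
        by (intro onorm_le order_trans[OF Cauchy_Schwarz_ineq2[folded real_norm_def]] mult_right_mono norm_ge_zero)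
    qed (auto simp: dist_commute)
    then show "f x + G x \<bullet> (y - x) + (y - x) \<bullet> (H *v (y - x)) / 2 - e * (norm (y - x))\<^sup>2 \<le> f y"
      by (simp add: power2_eq_square mult_ac)
  qed (use d1 d2 in auto)
qed

lemma eventually_nhds_along_line:
  fixes x v :: "'a::real_normed_vector"
  assumes "\<forall>\<^sub>F y in nhds x. P y"
  shows "\<forall>\<^sub>F t in at_right (0::real). P (x + t *\<^sub>R v)"
proof -
  have "((\<lambda>t. x + t *\<^sub>R v) \<longlongrightarrow> x + 0 *\<^sub>R v) (at_right 0)" by (intro tendsto_intros)
  then show ?thesis using assms by (auto dest: eventually_compose_filterlim)
qed

text \<open>Adding the upper expansion of \<open>f\<close>, that is the subjet of its negative, to
  the lower bound leaves an inequality between the two jets alone, which is then tested along rays x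
  + t v.\<close>

lemma local_min_test:
  assumes td: "twice_diff f G H x" and symH: "transpose H = H" and symP: "transpose P = P"
    and min: "\<forall>\<^sub>F y in nhds x. f x + p \<bullet> (y - x) + (y - x) \<bullet> (P *v (y - x)) / 2 \<le> f y"
  shows "G x = p" "psd (H - P)"
proof -
  have "subjet (\<lambda>y. - f y) x (- G x) (- H)"
    using twice_diff_imp_subjet[OF twice_diff_minus[OF td]] symH by (simp add: transpose_simps)
  moreover have neg: "- H *v z = - (H *v z)" for z
    by (simp add: matrix_vector_mult_def vec_eq_iff sum_negf)
  ultimately have near: "\<forall>\<^sub>F y in nhds x. 0 \<le> (G x - p) \<bullet> (y - x) + (y - x) \<bullet> ((H - P) *v (y - x)) / 2
      + e * (norm (y - x))\<^sup>2" if "e > 0" for e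
  proof -
    have "\<forall>\<^sub>F y in nhds x. - f x + - G x \<bullet> (y - x) + (y - x) \<bullet> (- H *v (y - x)) / 2 - e * (norm (y - x))\<^sup>2 \<le> - f y"
      using \<open>subjet (\<lambda>y. - f y) x (- G x) (- H)\<close> that by (simp add: subjet_def)
    then show ?thesis using min
    proof eventually_elim
      case (elim y)
      have "(y - x) \<bullet> ((H - P) *v (y - x)) = (y - x) \<bullet> (H *v (y - x)) - (y - x) \<bullet> (P *v (y - x))"
        by (simp add: matrix_vector_mult_diff_rdistrib inner_diff_right)
      then show ?case using elim by (simp add: neg inner_diff_left diff_divide_distrib)
    qed
  qed
  have line: "\<forall>\<^sub>F t in at_right 0. 0 \<le> (G x - p) \<bullet> v + t * (v \<bullet> ((H - P) *v v) / 2 + e * (norm v)\<^sup>2)"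
    if "e > 0" for e v
    using eventually_nhds_along_line[OF near[OF that], of v] eventually_at_right_less[of 0]
  proof eventually_elim
    case (elim t)
    then have "0 \<le> t * ((G x - p) \<bullet> v + t * (v \<bullet> ((H - P) *v v) / 2 + e * (norm v)\<^sup>2))"
      by (simp add: matrix_vector_mult_scaleR power_mult_distrib power2_eq_square algebra_simps)
    then show ?case using elim by (simp add: zero_le_mult_iff)
  qed
  have "0 \<le> (G x - p) \<bullet> v" for v
  proof -
    have "((\<lambda>t. (G x - p) \<bullet> v + t * (v \<bullet> ((H - P) *v v) / 2 + 1 * (norm v)\<^sup>2))
        \<longlongrightarrow> (G x - p) \<bullet> v + 0 * (v \<bullet> ((H - P) *v v) / 2 + 1 * (norm v)\<^sup>2)) (at_right 0)"
      by (intro tendsto_intros)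
    from tendsto_lowerbound[OF this line] show ?thesis by simp
  qed
  \<comment> \<open>The first-order term is nonnegative in every direction; this direction makes it
    -|G x - p|^2.\<close>
  from this[of "p - G x"] have "(G x - p) \<bullet> (G x - p) \<le> 0"
    by (simp add: inner_diff_left inner_diff_right inner_commute)
  then have "G x - p = 0" by (metis inner_eq_zero_iff inner_ge_zero order_antisym)
  then show Gp: "G x = p" by simp
  show "psd (H - P)" unfolding psd_def
  proof (intro conjI allI)
    fix v
    have "0 \<le> v \<bullet> ((H - P) *v v) / 2 + e" if "e > 0" for e
    proof (cases "v = 0")
      case False
      \<comment> \<open>The free constant of \<open>line\<close> is rescaled by |v|^2; the gradient
        term has gone, so the remaining factor \<open>t\<close> can be cancelled.\<close>
      then have "\<forall>\<^sub>F t in at_right 0. 0 \<le> t * (v \<bullet> ((H - P) *v v) / 2 + e)"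
        using line[of "e / (norm v)\<^sup>2" v] that by (simp add: Gp)
      then have "\<forall>\<^sub>F t in at_right (0::real). 0 \<le> v \<bullet> ((H - P) *v v) / 2 + e"
        using eventually_at_right_less[of 0] by eventually_elim (simp add: zero_le_mult_iff)
      then show ?thesis by (simp add: trivial_limit_at_right_real)
    qed (use that in simp)
    then have "0 \<le> v \<bullet> ((H - P) *v v) / 2" by (rule field_le_epsilon)
    then show "0 \<le> v \<bullet> ((H - P) *v v)" by simp
  qed (use symH symP in \<open>simp add: transpose_simps\<close>)
qed

section \<open>Distributional and viscosity superharmonicity\<close>

text \<open>The flat function exp (-1 / t) times an inverse power of t, extended by zero.
  Differentiation turns a member of the family into a linear combination of members.\<close>

definition bump :: "nat \<Rightarrow> real \<Rightarrow> real" where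
  "bump m t = (if t > 0 then exp (- inverse t) * inverse t ^ m else 0)"

lemma bump_tendsto_0: "(bump m \<longlongrightarrow> 0) (at 0)"
proof -
  have "((\<lambda>t. inverse t ^ m / exp (inverse t)) \<longlongrightarrow> 0) (at_right (0::real))"
    by (rule filterlim_compose[OF tendsto_power_div_exp_0 filterlim_inverse_at_top_right])
  then have "((\<lambda>t. bump m t) \<longlongrightarrow> 0) (at_right 0)"
  proof (rule tendsto_cong[THEN iffD1, rotated])
    show "\<forall>\<^sub>F t in at_right 0. inverse t ^ m / exp (inverse t) = bump m t"
      using eventually_at_right_less[of 0]
      by eventually_elim (simp add: bump_def exp_minus field_simps)
  qed
  moreover have "((\<lambda>t. bump m t) \<longlongrightarrow> 0) (at_left 0)"
    by (rule tendsto_eventually)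
      (auto simp: bump_def eventually_at_left_field intro!: exI[of _ "-1"])
  ultimately show ?thesis by (simp add: filterlim_split_at)
qed

lemma DERIV_bump: "(bump m has_real_derivative (bump (m + 2) t - m * bump (Suc m) t)) (at t)"
proof -
  consider "t > 0" | "t < 0" | "t = 0" by linarith
  then show ?thesis
  proof cases
    case 1
    have "((\<lambda>t. exp (- inverse t) * inverse t ^ m) has_real_derivative
        (bump (m + 2) t - m * bump (Suc m) t)) (at t)"
      using 1 by (auto intro!: derivative_eq_intros simp: bump_def power2_eq_square)
        (cases m; simp add: field_simps)
    then show ?thesis
      by (rule DERIV_cong_ev[THEN iffD1, rotated -1])
        (use 1 eventually_gt_at_top in \<open>auto simp: bump_def eventually_nhds intro!: exI[of _ "{0<..}"]\<close>)
  next
    case 2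
    have "((\<lambda>t. 0) has_real_derivative 0) (at t)" by simp
    then have "(bump m has_real_derivative 0) (at t)"
      by (rule DERIV_cong_ev[THEN iffD1, rotated -1])
        (use 2 in \<open>auto simp: bump_def eventually_nhds intro!: exI[of _ "{..<0}"]\<close>)
    then show ?thesis using 2 by (simp add: bump_def)
  next
    case 3
    \<comment> \<open>At the origin the difference quotient of \<open>bump m\<close> is
      \<open>bump (Suc m)\<close> itself.\<close>
    have "((\<lambda>h. (bump m (0 + h) - bump m 0) / h) \<longlongrightarrow> 0) (at 0)"
    proof (rule tendsto_cong[THEN iffD1, OF _ bump_tendsto_0[of "Suc m"]])
      show "\<forall>\<^sub>F h in at 0. bump (Suc m) h = (bump m (0 + h) - bump m 0) / h"
        by (auto simp: bump_def eventually_at_filter field_simps)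
    qed
    then show ?thesis using 3 by (simp add: DERIV_def bump_def)
  qed
qed

text \<open>Generated so that every partial derivative of a member is again a member: the chain rule
  produces only coordinate factors and bumps of higher index. Membership therefore gives every class
  C^k by induction.\<close>

inductive bump_class :: "real \<Rightarrow> real^'n \<Rightarrow> (real^'n \<Rightarrow> real) \<Rightarrow> bool" for r c where
  base: "bump_class r c (\<lambda>y. bump m (r - (y - c) \<bullet> (y - c)))"
| add: "bump_class r c f \<Longrightarrow> bump_class r c g \<Longrightarrow> bump_class r c (\<lambda>y. f y + g y)"
| coord: "bump_class r c f \<Longrightarrow> bump_class r c (\<lambda>y. (y $ i - c $ i) * f y)"
| scale: "bump_class r c f \<Longrightarrow> bump_class r c (\<lambda>y. k * f y)"

lemma bump_class_deriv:
  "bump_class r c f \<Longrightarrow> \<exists>D. (\<forall>y. (f has_derivative D y) (at y)) \<and> (\<forall>i. bump_class r c (\<lambda>y. D y (axis i 1)))"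
proof (induction rule: bump_class.induct)
  case (base m)
  let ?s = "\<lambda>y. r - (y - c) \<bullet> (y - c)"
  let ?b = "\<lambda>y. bump (m + 2) (?s y) + (- real m) * bump (Suc m) (?s y)"
  let ?D = "\<lambda>y h. ?b y * (- 2 * ((y - c) \<bullet> h))"
  have "((\<lambda>y. bump m (?s y)) has_derivative ?D y) (at y)" for y
  proof -
    have "(?s has_derivative (\<lambda>h. - 2 * ((y - c) \<bullet> h))) (at y)"
      by (auto intro!: derivative_eq_intros simp: inner_commute)
    from has_derivative_compose[OF this DERIV_bump[unfolded has_field_derivative_def]]
    show ?thesis by simp
  qed
  moreover have "bump_class r c (\<lambda>y. ?D y (axis i 1))" for i
  proof -
    have "bump_class r c (\<lambda>y. - 2 * ((y $ i - c $ i) * ?b y))"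
      by (intro bump_class.intros)
    moreover have "(\<lambda>y. - 2 * ((y $ i - c $ i) * ?b y)) = (\<lambda>y. ?D y (axis i 1))"
      by (simp add: inner_axis fun_eq_iff algebra_simps)
    ultimately show ?thesis by simp
  qed
  ultimately show ?case by (intro exI[of _ ?D]) blast
next
  case (add f g)
  then obtain D E where D: "\<forall>y. (f has_derivative D y) (at y)" "\<forall>i. bump_class r c (\<lambda>y. D y (axis i 1))"
    and E: "\<forall>y. (g has_derivative E y) (at y)" "\<forall>i. bump_class r c (\<lambda>y. E y (axis i 1))" by blast
  show ?case
    by (rule exI[of _ "\<lambda>y h. D y h + E y h"]) (use D E in \<open>auto intro!: has_derivative_add bump_class.add\<close>)
next
  case (coord f i)
  then obtain D where D: "\<forall>y. (f has_derivative D y) (at y)" "\<forall>i. bump_class r c (\<lambda>y. D y (axis i 1))"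
    by blast
  have "((\<lambda>y. (y $ i - c $ i) * f y) has_derivative (\<lambda>h. h $ i * f y + (y $ i - c $ i) * D y h)) (at y)" for y
    by (auto intro!: derivative_eq_intros D(1)[rule_format] bounded_linear.has_derivative[OF bounded_linear_vec_nth])
  moreover have "bump_class r c (\<lambda>y. axis j 1 $ i * f y + (y $ i - c $ i) * D y (axis j 1))" for j
    by (intro bump_class.intros coord D(2)[rule_format])
  ultimately show ?case by (intro exI[of _ "\<lambda>y h. h $ i * f y + (y $ i - c $ i) * D y h"]) auto
next
  case (scale f k)
  then obtain D where D: "\<forall>y. (f has_derivative D y) (at y)" "\<forall>i. bump_class r c (\<lambda>y. D y (axis i 1))"
    by blast
  show ?case
    by (rule exI[of _ "\<lambda>y h. k * D y h"]) (use D in \<open>auto intro!: has_derivative_mult_right bump_class.scale\<close>)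
qed

lemma partial_deriv_eq: "(f has_derivative D) (at y) \<Longrightarrow> partial_deriv i f y = D (axis i 1)"
  unfolding partial_deriv_def by (metis frechet_derivative_at)

lemma bump_class_Ck: "bump_class r c f \<Longrightarrow> Ck_on k UNIV f"
proof (induction k arbitrary: f)
  case 0
  obtain D where "\<forall>y. (f has_derivative D y) (at y)" using bump_class_deriv[OF 0] by blast
  then show ?case by (auto intro!: has_derivative_continuous_on)
next
  case (Suc k)
  obtain D where D: "\<forall>y. (f has_derivative D y) (at y)" "\<forall>i. bump_class r c (\<lambda>y. D y (axis i 1))"
    using bump_class_deriv[OF Suc.prems] by blast
  have "partial_deriv i f = (\<lambda>y. D y (axis i 1))" for i
    using D(1) partial_deriv_eq by blast
  then show ?case using D Suc.IH by (auto simp: differentiable_on_def differentiable_def)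
qed

text \<open>The standard mollifier exp (-1 / (e^2 - |z|^2)), left unnormalised; its mass is carried
  along in the estimates.\<close>

definition rho :: "real \<Rightarrow> real^'n \<Rightarrow> real" where
  "rho e z = bump 0 (e\<^sup>2 - z \<bullet> z)"

lemma rho_nonneg: "rho e z \<ge> 0"
  by (simp add: rho_def bump_def)

lemma rho_pos_iff: "e > 0 \<Longrightarrow> rho e z > 0 \<longleftrightarrow> norm z < e"
  using abs_le_square_iff[of e "norm z"] by (simp add: rho_def bump_def power2_norm_eq_inner[symmetric] flip: not_le)

lemma rho_zero: "e > 0 \<Longrightarrow> norm z \<ge> e \<Longrightarrow> rho e z = 0"
  using rho_pos_iff[of e z] rho_nonneg[of e z] by linarith

lemma test_function_rho:
  assumes "e > 0" shows "test_function (\<lambda>y. rho e (y - c))"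
  unfolding test_function_def
proof
  show "\<forall>k. Ck_on k UNIV (\<lambda>y. rho e (y - c))"
    unfolding rho_def using bump_class_Ck[OF bump_class.base] by blast
  have "{y. rho e (y - c) \<noteq> 0} \<subseteq> cball c e"
  proof
    fix y assume "y \<in> {y. rho e (y - c) \<noteq> 0}"
    then have "\<not> e \<le> norm (y - c)" using rho_zero[OF assms] by blast
    then show "y \<in> cball c e" by (simp add: dist_norm norm_minus_commute)
  qed
  then have "closure {y. rho e (y - c) \<noteq> 0} \<subseteq> cball c e"
    by (simp add: closure_minimal)
  then show "compact (closure {y. rho e (y - c) \<noteq> 0})"
    using bounded_subset[OF bounded_cball] by (simp add: compact_eq_bounded_closed)
qed

lemma continuous_rho: "continuous_on UNIV (rho e)"
proof -
  have "Ck_on 0 UNIV (\<lambda>y. bump 0 (e\<^sup>2 - (y - 0) \<bullet> (y - 0)))"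
    by (rule bump_class_Ck[OF bump_class.base])
  then show ?thesis by (simp add: rho_def[abs_def])
qed

lemma integrable_continuous_bounded_support:
  fixes f :: "real^'n \<Rightarrow> real"
  assumes "continuous_on UNIV f" "\<And>y. norm (y - c) \<ge> R \<Longrightarrow> f y = 0"
  shows "integrable lborel f"
proof -
  have "integrable lborel (\<lambda>y. indicator (cball c R) y *\<^sub>R f y)"
    by (rule borel_integrable_compact) (auto intro: continuous_on_subset assms)
  moreover have "(\<lambda>y. indicator (cball c R) y *\<^sub>R f y) = f"
  proof
    show "indicator (cball c R) y *\<^sub>R f y = f y" for y
      using assms(2)[of y] by (auto simp: indicator_def dist_norm norm_minus_commute)
  qed
  ultimately show ?thesis by simp
qed

lemma rho_mass_pos:
  assumes "e > 0" shows "(LINT y|lborel. rho e (y::real^'n)) > 0"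
proof -
  have int: "integrable lborel (rho e :: real^'n \<Rightarrow> real)"
    by (rule integrable_continuous_bounded_support[where c = 0 and R = e]) (auto simp: continuous_rho rho_zero assms)
  have "(LINT y|lborel. rho e (y::real^'n)) \<noteq> 0"
  proof
    assume "(LINT y|lborel. rho e (y::real^'n)) = 0"
    then have "AE y in lborel. rho e (y::real^'n) = 0"
      using integral_nonneg_eq_0_iff_AE[OF int] rho_nonneg by blast
    then have "AE y in lborel. (y::real^'n) \<notin> ball 0 e"
      by eventually_elim (metis rho_pos_iff[OF assms] less_irrefl mem_ball_0)
    then have "ball (0::real^'n) e \<in> null_sets lborel"
      by (subst (asm) AE_iff_null_sets[symmetric]) auto
    then have "negligible (ball (0::real^'n) e)"
      by (simp add: negligible_iff_null_sets null_sets_completionI)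
    then show False using open_not_negligible[of "ball (0::real^'n) e"] assms by auto
  qed
  moreover have "(LINT y|lborel. rho e (y::real^'n)) \<ge> 0"
    by (rule Bochner_Integration.integral_nonneg) (rule rho_nonneg)
  ultimately show ?thesis by simp
qed

section \<open>Second differences and mollification\<close>

lemma DERIV_along_line:
  assumes "f differentiable_on UNIV"
  shows "((\<lambda>s. f (y + s *\<^sub>R axis i 1)) has_real_derivative partial_deriv i f (y + s *\<^sub>R axis i 1)) (at s)"
proof -
  obtain D where D: "(f has_derivative D) (at (y + s *\<^sub>R axis i 1))"
    using assms by (auto simp: differentiable_on_def differentiable_def)
  have "((\<lambda>s. y + s *\<^sub>R axis i 1) has_derivative (\<lambda>s. s *\<^sub>R axis i 1)) (at s)"
    by (auto intro!: derivative_eq_intros)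
  from has_derivative_compose[OF this D] show ?thesis
    by (simp add: has_field_derivative_def partial_deriv_eq[OF D]
        linear_scale[OF has_derivative_linear[OF D]] mult_commute_abs)
qed

text \<open>Maclaurin expansion with remainder in both directions; the first-order terms cancel. The
  intermediate points serve twice, for the pointwise limit of the quotient and for its uniform
  bound.\<close>

lemma second_difference:
  fixes f :: "real^'n \<Rightarrow> real" and i :: 'n
  assumes "Ck_on 2 UNIV f" "t > 0"
  defines "d \<equiv> partial_deriv i (partial_deriv i f)"
  shows "\<exists>a b. \<bar>a\<bar> \<le> t \<and> \<bar>b\<bar> \<le> t \<and> (f (y + t *\<^sub>R axis i 1) + f (y - t *\<^sub>R axis i 1) - 2 * f y) / t\<^sup>2
     = (d (y + a *\<^sub>R axis i 1) + d (y + b *\<^sub>R axis i 1)) / 2"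
proof -
  have df: "f differentiable_on UNIV" "partial_deriv i f differentiable_on UNIV"
    using assms(1) by (auto simp: numeral_2_eq_2)
  define diff where "diff = (\<lambda>k s. if k = 0 then f (y + s *\<^sub>R axis i 1)
     else if k = (1::nat) then partial_deriv i f (y + s *\<^sub>R axis i 1) else d (y + s *\<^sub>R axis i 1))"
  have D: "DERIV (diff m) s :> diff (Suc m) s" if "m < 2" for m s
    using that DERIV_along_line[OF df(1)] DERIV_along_line[OF df(2)]
    by (auto simp: diff_def d_def less_2_cases_iff)
  obtain a where a: "0 < a" "a < t" "f (y + t *\<^sub>R axis i 1) = (\<Sum>m<2. diff m 0 / fact m * t ^ m) + diff 2 a / fact 2 * t ^ 2"
    using Maclaurin[of t 2 diff "\<lambda>s. f (y + s *\<^sub>R axis i 1)"] assms D by (auto simp: diff_def)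
  obtain b where b: "- t < b" "b < 0" "f (y + (- t) *\<^sub>R axis i 1) = (\<Sum>m<2. diff m 0 / fact m * (- t) ^ m) + diff 2 b / fact 2 * (- t) ^ 2"
    using Maclaurin_minus[of "- t" 2 diff "\<lambda>s. f (y + s *\<^sub>R axis i 1)"] assms D by (auto simp: diff_def)
  have "f (y + t *\<^sub>R axis i 1) + f (y - t *\<^sub>R axis i 1) - 2 * f y = t\<^sup>2 * ((diff 2 a + diff 2 b) / 2)"
    using a(3) b(3) by (simp add: numeral_2_eq_2 diff_def field_simps)
  then show ?thesis using a b assms(2)
    by (intro exI[of _ a] exI[of _ b]) (simp add: diff_def)
qed

text \<open>Writes the pairing of a second derivative of \<open>f\<close> with a merely continuous
  \<open>u\<close> as a limit of differences. Translations can then be moved from the test function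
  to \<open>u\<close>, where minimality of a mollification can be exploited.\<close>

lemma second_difference_quotient_LIMSEQ:
  fixes f u :: "real^'n \<Rightarrow> real" and i :: 'n
  assumes C2: "Ck_on 2 UNIV f" and supp: "\<And>y. norm (y - c) \<ge> R \<Longrightarrow> f y = 0" and u: "continuous_on UNIV u"
  defines "t \<equiv> \<lambda>n::nat. 1 / real (Suc n)"
  shows "(\<lambda>n. LINT y|lborel. u y * ((f (y + t n *\<^sub>R axis i 1) + f (y - t n *\<^sub>R axis i 1) - 2 * f y) / (t n)\<^sup>2))
     \<longlonglongrightarrow> (LINT y|lborel. u y * partial_deriv i (partial_deriv i f) y)"
    and "integrable lborel (\<lambda>y. u y * partial_deriv i (partial_deriv i f) y)"
proof -
  define d where "d = partial_deriv i (partial_deriv i f)"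
  have cf: "continuous_on UNIV f" and cd: "continuous_on UNIV d"
    using C2 by (auto simp: numeral_2_eq_2 d_def differentiable_imp_continuous_on)
  let ?q = "\<lambda>n y. (f (y + t n *\<^sub>R axis i 1) + f (y - t n *\<^sub>R axis i 1) - 2 * f y) / (t n)\<^sup>2"
  have t: "0 < t n" "t n \<le> 1" for n by (auto simp: t_def)
  have t0: "t \<longlonglongrightarrow> 0" unfolding t_def using LIMSEQ_inverse_real_of_nat by (simp add: inverse_eq_divide)
  \<comment> \<open>The shifts have length at most 1, so all quotients are supported in the ball of
    radius R + 1.\<close>
  have zero: "?q n y = 0" if "norm (y - c) \<ge> R + 1" for n y
  proof -
    have "f (y + s *\<^sub>R axis i 1) = 0" if "\<bar>s\<bar> \<le> 1" for s
    proof (rule supp)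
      have "norm (y - c) \<le> norm (y + s *\<^sub>R axis i 1 - c) + norm (s *\<^sub>R axis i 1 :: real^'n)"
        using norm_triangle_ineq4[of "y + s *\<^sub>R axis i 1 - c" "s *\<^sub>R axis i 1"] by (simp add: algebra_simps)
      then show "R \<le> norm (y + s *\<^sub>R axis i 1 - c)" using that \<open>norm (y - c) \<ge> R + 1\<close> by simp
    qed
    from this[of "t n"] this[of "- t n"] supp[of y] that t[of n] show ?thesis by simp
  qed
  have lim: "(\<lambda>n. ?q n y) \<longlonglongrightarrow> d y" for y
  proof -
    obtain a b where ab: "\<And>n. \<bar>a n\<bar> \<le> t n" "\<And>n. \<bar>b n\<bar> \<le> t n"
      "\<And>n. ?q n y = (d (y + a n *\<^sub>R axis i 1) + d (y + b n *\<^sub>R axis i 1)) / 2"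
      using second_difference[OF C2 t(1), of _ y i] unfolding d_def by metis
    have "a \<longlonglongrightarrow> 0" "b \<longlonglongrightarrow> 0"
      using ab t0 by (auto intro!: Lim_null_comparison[OF always_eventually t0])
    then have "(\<lambda>n. (d (y + a n *\<^sub>R axis i 1) + d (y + b n *\<^sub>R axis i 1)) / 2)
        \<longlonglongrightarrow> (d (y + 0 *\<^sub>R axis i 1) + d (y + 0 *\<^sub>R axis i 1)) / 2"
      by (intro tendsto_intros continuous_on_tendsto_compose[OF cd]) auto
    then show ?thesis by (simp add: ab(3))
  qed
  have d0: "d y = 0" if "norm (y - c) \<ge> R + 1" for y
    using lim[of y] zero[OF that] by (simp add: LIMSEQ_const_iff)
  obtain B where "\<forall>y \<in> cball c (R + 2). \<bar>d y\<bar> \<le> B"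
    using compact_imp_bounded[OF compact_continuous_image[OF continuous_on_subset[OF cd] compact_cball[of c "R + 2"]]]
    by (auto simp: bounded_iff)
  then have B: "\<And>y. y \<in> cball c (R + 2) \<Longrightarrow> \<bar>d y\<bar> \<le> B" by blast
  have dB: "\<bar>d y\<bar> \<le> max 0 B" for y
    using B[of y] d0[of y] by (cases "norm (y - c) \<ge> R + 1") (auto simp: dist_norm norm_minus_commute)
  have qB: "\<bar>?q n y\<bar> \<le> max 0 B" for n y
  proof -
    obtain a b where ab: "?q n y = (d (y + a *\<^sub>R axis i 1) + d (y + b *\<^sub>R axis i 1)) / 2"
      using second_difference[OF C2 t(1), of n y i] unfolding d_def by metis
    have "\<bar>(v + w) / 2\<bar> \<le> C" if "\<bar>v\<bar> \<le> C" "\<bar>w\<bar> \<le> C" for v w C :: real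
      using that by (simp add: abs_le_iff)
    then show ?thesis unfolding ab using dB by blast
  qed
  have int: "integrable lborel (\<lambda>y. indicator (cball c (R + 1)) y *\<^sub>R (\<bar>u y\<bar> * max 0 B))"
    by (intro borel_integrable_compact continuous_intros continuous_on_subset[OF u]) auto
  have "integrable lborel (\<lambda>y. u y * d y) \<and> (\<forall>n. integrable lborel (\<lambda>y. u y * ?q n y)) \<and>
     (\<lambda>n. LINT y|lborel. u y * ?q n y) \<longlonglongrightarrow> (LINT y|lborel. u y * d y)"
  proof (intro conjI allI)
    show "integrable lborel (\<lambda>y. u y * d y)"
      by (rule integrable_continuous_bounded_support[where c = c and R = "R + 1"])
        (auto intro!: continuous_intros u cd d0)
    show "integrable lborel (\<lambda>y. u y * ?q n y)" for n
      by (rule integrable_continuous_bounded_support[where c = c and R = "R + 1"])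
        (use t(1)[of n] in \<open>auto intro!: continuous_intros u continuous_on_compose2[OF cf] simp del: divide_eq_0_iff simp: zero\<close>)
    show "(\<lambda>n. LINT y|lborel. u y * ?q n y) \<longlonglongrightarrow> (LINT y|lborel. u y * d y)"
    proof (rule integral_dominated_convergence[OF _ _ int])
      have "continuous_on UNIV (\<lambda>y. u y * ?q n y)" for n
        using t(1)[of n] by (auto intro!: continuous_intros u continuous_on_compose2[OF cf])
      then show "(\<lambda>y. u y * ?q n y) \<in> borel_measurable lborel" for n
        by (simp add: borel_measurable_continuous_onI)
      have "continuous_on UNIV (\<lambda>y. u y * d y)" by (intro continuous_intros u cd)
      then show "(\<lambda>y. u y * d y) \<in> borel_measurable lborel"
        by (simp add: borel_measurable_continuous_onI)
      show "AE y in lborel. (\<lambda>n. u y * ?q n y) \<longlonglongrightarrow> u y * d y"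
        by (intro AE_I2 tendsto_intros lim)
      show "AE y in lborel. norm (u y * ?q n y) \<le> indicator (cball c (R + 1)) y *\<^sub>R (\<bar>u y\<bar> * max 0 B)" for n
      proof (intro AE_I2)
        fix y
        show "norm (u y * ?q n y) \<le> indicator (cball c (R + 1)) y *\<^sub>R (\<bar>u y\<bar> * max 0 B)"
        proof (cases "norm (y - c) \<ge> R + 1")
          case True
          then have "norm (u y * ?q n y) = 0" using zero by simp
          then show ?thesis by (simp only: indicator_def) auto
        next
          case False
          have "norm (u y * ?q n y) \<le> \<bar>u y\<bar> * max 0 B"
            unfolding real_norm_def abs_mult by (intro mult_left_mono qB) auto
          then show ?thesis using False by (simp add: indicator_def dist_norm norm_minus_commute)
        qed
      qed
    qed
  qed
  then show "(\<lambda>n. LINT y|lborel. u y * ?q n y) \<longlonglongrightarrow> (LINT y|lborel. u y * partial_deriv i (partial_deriv i f) y)"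
    "integrable lborel (\<lambda>y. u y * partial_deriv i (partial_deriv i f) y)"
    by (simp_all add: d_def)
qed

lemma integral_translate_rho:
  fixes g :: "real^'n \<Rightarrow> real"
  assumes "continuous_on UNIV g"
  shows "(LINT y|lborel. g y * rho e (y - z)) = (LINT y|lborel. g (z + y) * rho e y)"
proof -
  have "(LINT y|lborel. g y * rho e (y - z)) = (LINT y|distr lborel borel ((+) z). g y * rho e (y - z))"
    by (simp add: lborel_distr_plus)
  also have "\<dots> = (LINT y|lborel. g (z + y) * rho e (z + y - z))"
  proof (rule integral_distr)
    have "continuous_on UNIV (\<lambda>y. g y * rho e (y - z))"
      by (auto intro!: continuous_intros assms continuous_on_compose2[OF continuous_rho])
    then show "(\<lambda>y. g y * rho e (y - z)) \<in> borel_measurable borel"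
      by (rule borel_measurable_continuous_onI)
  qed simp
  also have "\<dots> = (LINT y|lborel. g (z + y) * rho e y)" by simp
  finally show ?thesis .
qed

lemma integrable_mult_rho:
  fixes g :: "real^'n \<Rightarrow> real"
  assumes "continuous_on UNIV g" "e > 0"
  shows "integrable lborel (\<lambda>y. g y * rho e (y - z))"
  by (rule integrable_continuous_bounded_support[where c = z and R = e])
    (auto intro!: continuous_intros assms continuous_on_compose2[OF continuous_rho] simp: rho_zero assms)

lemma continuous_mollification:
  fixes g :: "real^'n \<Rightarrow> real"
  assumes g: "continuous_on UNIV g" and e: "e > 0"
  shows "continuous_on UNIV (\<lambda>z. LINT y|lborel. g y * rho e (y - z))"
proof (rule continuous_at_imp_continuous_on, rule ballI)
  fix z :: "real^'n"
  show "isCont (\<lambda>z. LINT y|lborel. g y * rho e (y - z)) z"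
    unfolding integral_translate_rho[OF g]
  proof (rule continuous_within_sequentiallyI)
    fix s :: "nat \<Rightarrow> real^'n" assume s: "s \<longlonglongrightarrow> z"
    then have "bounded (range s)" by (rule convergent_imp_bounded)
    then obtain b where b: "\<And>n. norm (s n) \<le> b" by (auto simp: bounded_iff)
    obtain B where "\<forall>y \<in> cball 0 (b + e). \<bar>g y\<bar> \<le> B"
      using compact_imp_bounded[OF compact_continuous_image[OF continuous_on_subset[OF g] compact_cball[of 0 "b + e"]]]
      by (auto simp: bounded_iff)
    then have B: "\<bar>g (s n + y)\<bar> \<le> B" if "norm y \<le> e" for n y
    proof -
      have "norm (s n + y) \<le> b + e" using norm_triangle_ineq[of "s n" y] b[of n] that by linarith
      then show ?thesis using \<open>\<forall>y \<in> cball 0 (b + e). \<bar>g y\<bar> \<le> B\<close> by simp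
    qed
    show "(\<lambda>n. LINT y|lborel. g (s n + y) * rho e y) \<longlonglongrightarrow> (LINT y|lborel. g (z + y) * rho e y)"
    proof (rule integral_dominated_convergence[where w = "\<lambda>y. B * rho e y"])
      have "continuous_on UNIV (\<lambda>y. g (z + y) * rho e y)" for z
        by (auto intro!: continuous_intros continuous_rho continuous_on_compose2[OF g])
      then show "(\<lambda>y. g (s n + y) * rho e y) \<in> borel_measurable lborel"
        "(\<lambda>y. g (z + y) * rho e y) \<in> borel_measurable lborel" for n
        by (simp_all add: borel_measurable_continuous_onI)
      show "integrable lborel (\<lambda>y. B * rho e (y::real^'n))"
        using integrable_mult_rho[OF continuous_on_const e, of B 0] by simp
      show "AE y in lborel. (\<lambda>n. g (s n + y) * rho e y) \<longlonglongrightarrow> g (z + y) * rho e y"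
        by (intro AE_I2 tendsto_intros continuous_on_tendsto_compose[OF g] s) auto
      show "AE y in lborel. norm (g (s n + y) * rho e y) \<le> B * rho e y" for n
      proof (intro AE_I2)
        fix y :: "real^'n"
        show "norm (g (s n + y) * rho e y) \<le> B * rho e y"
          using B[of y n] rho_nonneg[of e y] rho_zero[OF e, of y]
          by (cases "norm y \<le> e") (auto simp: abs_mult intro!: mult_right_mono)
      qed
    qed
  qed
qed

lemma mollification_mono:
  fixes g :: "real^'n \<Rightarrow> real"
  assumes "continuous_on UNIV g" "continuous_on UNIV h" "e > 0" "\<And>y. norm (y - z) < e \<Longrightarrow> g y \<le> h y"
  shows "(LINT y|lborel. g y * rho e (y - z)) \<le> (LINT y|lborel. h y * rho e (y - z))"
proof (rule integral_mono)
  fix y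
  show "g y * rho e (y - z) \<le> h y * rho e (y - z)"
    using assms(4)[of y] rho_nonneg[of e "y - z"] rho_zero[OF assms(3), of "y - z"]
    by (cases "norm (y - z) < e") (auto intro: mult_right_mono)
qed (intro integrable_mult_rho assms)+

lemma mollification_const:
  "(LINT y|lborel. k * rho e (y - (z::real^'n))) = k * (LINT y|lborel. rho e (y::real^'n))"
  using integral_translate_rho[OF continuous_on_const, of k e z] by simp

lemma continuous_on_quad: "continuous_on UNIV (\<lambda>y. z + p \<bullet> (y - x) + (y - x) \<bullet> (P *v (y - x)) / 2)"
  for P :: "real^'n^'n"
  by (intro continuous_intros linear_continuous_on_compose[OF _ matrix_vector_mul_linear]) auto

lemma quad_second_difference:
  fixes P :: "real^'n^'n"
  assumes "transpose P = P"
  shows "(z + p \<bullet> (w + a) + (w + a) \<bullet> (P *v (w + a)) / 2) + (z + p \<bullet> (w - a) + (w - a) \<bullet> (P *v (w - a)) / 2)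
    - 2 * (z + p \<bullet> w + w \<bullet> (P *v w) / 2) = a \<bullet> (P *v a)"
proof -
  have "a \<bullet> (P *v w) = w \<bullet> (P *v a)"
    using sym_inner[OF assms, of a w] by (simp add: inner_commute)
  then show ?thesis
    by (simp only: matrix_vector_right_distrib matrix_vector_mult_diff_distrib inner_add_left inner_add_right
        inner_diff_left inner_diff_right) argo
qed

text \<open>If the trace were positive, a quadratic \<open>Q\<close> with positive Laplacian would
  touch \<open>u\<close> strictly from below at \<open>x\<close>. The mollification of u - Q then
  has an interior minimum \<open>\<zeta>\<close>, where its second differences are nonnegative. With
  the mollifier centred at \<open>\<zeta>\<close> as test function, this becomes a positive lower
  bound for the distributional Laplacian.\<close>

lemma trace_subjet_nonpos:
  fixes u :: "real^'n \<Rightarrow> real"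
  assumes u: "continuous_on UNIV u" and distr: "distr_laplacian_nonpos u"
    and jet: "subjet u x p P" and sym: "transpose P = P"
  shows "(\<Sum>i\<in>UNIV. P $ i $ i) \<le> 0"
proof (rule ccontr)
  assume "\<not> (\<Sum>i\<in>UNIV. P $ i $ i) \<le> 0"
  then have pos: "(\<Sum>i\<in>UNIV. P $ i $ i) > 0" by simp
  \<comment> \<open>Passing to \<open>P'\<close> costs 4 e per diagonal entry, half of the trace in
    total. It gains 2 e |y - x|^2, of which the subjet error consumes half.\<close>
  define e where "e = (\<Sum>i\<in>UNIV. P $ i $ i) / (8 * CARD('n))"
  have e: "e > 0" using pos by (simp add: e_def)
  define P' where "P' = P - (4 * e) *\<^sub>R mat 1"
  define Q where "Q = (\<lambda>y. u x + p \<bullet> (y - x) + (y - x) \<bullet> (P' *v (y - x)) / 2)"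
  define g where "g = (\<lambda>y. u y - Q y)"
  have sym': "transpose P' = P'" by (simp add: P'_def transpose_simps sym)
  have tr: "(\<Sum>i\<in>UNIV. P' $ i $ i) > 0"
    using pos by (simp add: P'_def sum_subtractf mat_def e_def)
  have Qc: "continuous_on UNIV Q" unfolding Q_def by (rule continuous_on_quad)
  have gc: "continuous_on UNIV g" unfolding g_def by (intro continuous_intros u Qc)
  have "\<forall>\<^sub>F y in nhds x. e * (norm (y - x))\<^sup>2 \<le> g y"
    using jet[unfolded subjet_def, rule_format, OF e]
    by eventually_elim (simp add: g_def Q_def P'_def mult_vec_simps inner_diff_right power2_norm_eq_inner diff_divide_distrib)
  then obtain d where d: "d > 0" "\<And>y. norm (y - x) < d \<Longrightarrow> e * (norm (y - x))\<^sup>2 \<le> g y"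
    by (auto simp: eventually_nhds_metric dist_norm)
  define r where "r = d / 2"
  have "isCont g x" using gc by (simp add: continuous_on_eq_continuous_at)
  then have "\<forall>\<^sub>F y in nhds x. g y < g x + e * r\<^sup>2 / 8"
    using e d(1) by (intro order_tendstoD) (auto simp: continuous_within tendsto_at_iff_tendsto_nhds r_def)
  then obtain s where s: "s > 0" "\<And>y. norm (y - x) < s \<Longrightarrow> g y < g x + e * r\<^sup>2 / 8"
    by (auto simp: eventually_nhds_metric dist_norm)
  have gx: "g x = 0" by (simp add: g_def Q_def)
  \<comment> \<open>The bound \<open>s\<close> keeps the average at the centre below e r^2 / 8; the
    bound r / 2 keeps the averaging balls around points of the sphere of radius \<open>r\<close> at
    distance r / 2 from \<open>x\<close>, where \<open>g\<close> is at least e r^2 / 4.\<close>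
  define \<epsilon> where "\<epsilon> = min s (r / 2)"
  have \<epsilon>: "\<epsilon> > 0" "\<epsilon> \<le> s" "\<epsilon> \<le> r / 2" and r: "r > 0" using s d by (auto simp: \<epsilon>_def r_def)
  define mass where "mass = (LINT y|lborel. rho \<epsilon> (y::real^'n))"
  have mass: "mass > 0" using rho_mass_pos[OF \<epsilon>(1)] by (simp add: mass_def)
  let ?J = "\<lambda>\<phi> z. LINT y|lborel. \<phi> y * rho \<epsilon> (y - z)"
  have Jx: "?J g x \<le> e * r\<^sup>2 / 8 * mass"
    unfolding mass_def mollification_const[symmetric, of _ \<epsilon> x]
    using s(2) gx \<epsilon>(2) by (intro mollification_mono gc continuous_intros \<epsilon>) (auto intro!: less_imp_le)
  have Jr: "e * r\<^sup>2 / 4 * mass \<le> ?J g z" if z: "norm (z - x) = r" for z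
    unfolding mass_def mollification_const[symmetric, of _ \<epsilon> z]
  proof (intro mollification_mono gc continuous_intros \<epsilon>)
    fix y assume y: "norm (y - z) < \<epsilon>"
    have "norm (z - x) \<le> norm (y - x) + norm (y - z)" "norm (y - x) \<le> norm (y - z) + norm (z - x)"
      using norm_triangle_ineq4[of "y - x" "y - z"] norm_triangle_ineq[of "y - z" "z - x"] by simp_all
    then have yx: "r / 2 \<le> norm (y - x)" "norm (y - x) < d" using z y \<epsilon>(3) r by (auto simp: r_def)
    have "e * r\<^sup>2 / 4 = e * (r / 2)\<^sup>2" by (simp add: power2_eq_square)
    also have "\<dots> \<le> e * (norm (y - x))\<^sup>2" using yx r e by (intro mult_left_mono power_mono) auto
    also have "\<dots> \<le> g y" using d(2) yx by simp
    finally show "e * r\<^sup>2 / 4 \<le> g y" .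
  qed
  obtain \<zeta> where \<zeta>: "\<zeta> \<in> cball x r" "\<And>z. z \<in> cball x r \<Longrightarrow> ?J g \<zeta> \<le> ?J g z"
    using continuous_attains_inf[OF compact_cball _ continuous_on_subset[OF continuous_mollification[OF gc \<epsilon>(1)]], of x r] r
    by force
  have "norm (\<zeta> - x) < r"
  proof (rule ccontr)
    assume "\<not> norm (\<zeta> - x) < r"
    then have "norm (\<zeta> - x) = r" using \<zeta>(1) by (simp add: dist_norm norm_minus_commute)
    moreover have "?J g \<zeta> \<le> ?J g x" using \<zeta>(2)[of x] r by simp
    ultimately have "e * r\<^sup>2 / 4 * mass \<le> e * r\<^sup>2 / 8 * mass" using Jr[of \<zeta>] Jx by linarith
    moreover have "e * r\<^sup>2 / 4 * mass = 2 * (e * r\<^sup>2 / 8 * mass)" "0 < e * r\<^sup>2 / 8 * mass"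
      using e mass r by simp_all
    ultimately show False by linarith
  qed
  define \<psi> where "\<psi> = (\<lambda>y. rho \<epsilon> (y - \<zeta>))"
  have test: "test_function \<psi>" unfolding \<psi>_def by (rule test_function_rho[OF \<epsilon>(1)])
  then have C2: "Ck_on 2 UNIV \<psi>" by (auto simp: test_function_def)
  have supp: "\<psi> y = 0" if "norm (y - \<zeta>) \<ge> \<epsilon>" for y using that rho_zero[OF \<epsilon>(1)] by (simp add: \<psi>_def)
  define t where "t = (\<lambda>n::nat. 1 / real (Suc n))"
  have t: "t n > 0" for n by (simp add: t_def)
  have t0: "t \<longlonglongrightarrow> 0" unfolding t_def using LIMSEQ_inverse_real_of_nat by (simp add: inverse_eq_divide)
  have t_fold: "1 / real (Suc n) = t n" for n by (simp add: t_def)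
  note lim = second_difference_quotient_LIMSEQ[where c = \<zeta> and R = \<epsilon>, OF C2 supp u, unfolded t_fold]
  have key: "P' $ i $ i * mass \<le> (LINT y|lborel. u y * partial_deriv i (partial_deriv i \<psi>) y)" for i
  proof (rule tendsto_lowerbound[OF lim(1)[where i = i]])
    have "\<forall>\<^sub>F n in sequentially. t n < r - norm (\<zeta> - x)"
      using \<open>norm (\<zeta> - x) < r\<close> by (intro order_tendstoD[OF t0]) auto
    then show "\<forall>\<^sub>F n in sequentially. P' $ i $ i * mass \<le> (LINT y|lborel. u y *
        ((\<psi> (y + t n *\<^sub>R axis i 1) + \<psi> (y - t n *\<^sub>R axis i 1) - 2 * \<psi> y) / (t n)\<^sup>2))"
    proof eventually_elim
      case (elim n)
      let ?a = "t n *\<^sub>R axis i 1 :: real^'n"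
      have na: "norm ?a = t n" using t[of n] by simp
      have eq: "\<zeta> - ?a - x = \<zeta> - x - ?a" by simp
      have "norm (\<zeta> + ?a - x) \<le> r" "norm (\<zeta> - ?a - x) \<le> r"
        using norm_triangle_ineq[of "\<zeta> - x" ?a] norm_triangle_ineq4[of "\<zeta> - x" ?a] elim
        unfolding na by (simp_all only: diff_add_eq eq)
      then have "\<zeta> + ?a \<in> cball x r" "\<zeta> - ?a \<in> cball x r"
        by (simp_all only: mem_cball dist_commute[of x]) (simp_all only: dist_norm)
      then have D0: "0 \<le> ?J g (\<zeta> + ?a) + ?J g (\<zeta> - ?a) - 2 * ?J g \<zeta>"
        using \<zeta>(2)[of "\<zeta> + ?a"] \<zeta>(2)[of "\<zeta> - ?a"] by simp
      have split: "?J g z = ?J u z - ?J Q z" for z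
        unfolding g_def left_diff_distrib by (intro Bochner_Integration.integral_diff integrable_mult_rho u Qc \<epsilon>)
      have "?J Q (\<zeta> + ?a) + ?J Q (\<zeta> - ?a) - 2 * ?J Q \<zeta> =
         (LINT y|lborel. (Q (\<zeta> + ?a + y) * rho \<epsilon> y + Q (\<zeta> - ?a + y) * rho \<epsilon> y - 2 * (Q (\<zeta> + y) * rho \<epsilon> y)))"
      proof -
        have int: "integrable lborel (\<lambda>y. Q (z + y) * rho \<epsilon> y)" for z
        proof -
          have "continuous_on UNIV (\<lambda>y. Q (z + y))"
            by (rule continuous_on_compose2[OF Qc]) (auto intro!: continuous_intros)
          from integrable_mult_rho[OF this \<epsilon>(1), of 0] show ?thesis by simp
        qed
        show ?thesis unfolding integral_translate_rho[OF Qc]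
          by (simp add: int Bochner_Integration.integral_add Bochner_Integration.integral_diff)
      qed
      \<comment> \<open>The second difference of a quadratic is the same at every point, so
        mollifying it only multiplies it by \<open>mass\<close>.\<close>
      also have "\<dots> = (LINT y|lborel. (t n)\<^sup>2 * P' $ i $ i * rho \<epsilon> (y - (0::real^'n)))"
      proof (rule arg_cong[where f = "integral\<^sup>L lborel"], rule ext)
        fix y
        have "Q (\<zeta> + ?a + y) + Q (\<zeta> - ?a + y) - 2 * Q (\<zeta> + y) = ?a \<bullet> (P' *v ?a)"
        proof -
          define w where "w = \<zeta> + y - x"
          have "\<zeta> + ?a + y - x = w + ?a" "\<zeta> - ?a + y - x = w - ?a" "\<zeta> + y - x = w"
            by (auto simp: w_def)
          then show ?thesis unfolding Q_def by (simp only: quad_second_difference[OF sym'])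
        qed
        also have "\<dots> = (t n)\<^sup>2 * P' $ i $ i"
          by (simp add: matrix_vector_mult_scaleR quad_axis power2_eq_square)
        finally have "Q (\<zeta> + ?a + y) + Q (\<zeta> - ?a + y) - 2 * Q (\<zeta> + y) = (t n)\<^sup>2 * P' $ i $ i" .
        then have "(Q (\<zeta> + ?a + y) + Q (\<zeta> - ?a + y) - 2 * Q (\<zeta> + y)) * rho \<epsilon> y = (t n)\<^sup>2 * P' $ i $ i * rho \<epsilon> y"
          by simp
        then show "Q (\<zeta> + ?a + y) * rho \<epsilon> y + Q (\<zeta> - ?a + y) * rho \<epsilon> y - 2 * (Q (\<zeta> + y) * rho \<epsilon> y)
           = (t n)\<^sup>2 * P' $ i $ i * rho \<epsilon> (y - 0)" by (simp only: left_diff_distrib distrib_right mult.assoc diff_zero)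
      qed
      finally have JQ: "?J Q (\<zeta> + ?a) + ?J Q (\<zeta> - ?a) - 2 * ?J Q \<zeta> = (t n)\<^sup>2 * P' $ i $ i * mass"
        by (simp add: mollification_const mass_def)
      \<comment> \<open>Translating the test function by plus or minus \<open>?a\<close> recentres
        the mollification at the opposite shift of \<open>\<zeta>\<close>; the symmetric second
        difference is unaffected by the exchange.\<close>
      have "(LINT y|lborel. u y * ((\<psi> (y + ?a) + \<psi> (y - ?a) - 2 * \<psi> y) / (t n)\<^sup>2))
        = (LINT y|lborel. (u y * rho \<epsilon> (y - (\<zeta> - ?a)) + u y * rho \<epsilon> (y - (\<zeta> + ?a)) - 2 * (u y * rho \<epsilon> (y - \<zeta>))) / (t n)\<^sup>2)"
        by (intro arg_cong[where f = "integral\<^sup>L lborel"] ext) (auto simp: \<psi>_def algebra_simps diff_divide_distrib add_divide_distrib)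
      also have "\<dots> = (?J u (\<zeta> - ?a) + ?J u (\<zeta> + ?a) - 2 * ?J u \<zeta>) / (t n)\<^sup>2"
        by (simp add: integrable_mult_rho[OF u \<epsilon>(1)])
      also have "\<dots> \<ge> (t n)\<^sup>2 * P' $ i $ i * mass / (t n)\<^sup>2"
        using D0 JQ unfolding split by (intro divide_right_mono) auto
      finally show ?case using t[of n] by simp
    qed
  qed simp_all
  have "0 < (\<Sum>i\<in>UNIV. P' $ i $ i) * mass" using tr mass by simp
  also have "\<dots> \<le> (\<Sum>i\<in>UNIV. LINT y|lborel. u y * partial_deriv i (partial_deriv i \<psi>) y)"
    unfolding sum_distrib_right by (intro sum_mono key)
  also have "\<dots> = (LINT y|lborel. u y * laplacian \<psi> y)"
    unfolding laplacian_def sum_distrib_left by (intro Bochner_Integration.integral_sum[symmetric] lim(2))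
  also have "\<dots> \<le> 0"
    using distr test rho_nonneg by (auto simp: distr_laplacian_nonpos_def \<psi>_def)
  finally show False by simp
qed

section \<open>Weak solutions in the viscosity sense\<close>

text \<open>For a positive function \<open>\<omega>\<close> with 2-jet (z, p, P) this is the
  Schouten tensor of the metric |dx|^2 / \<open>\<omega>\<close>^2 with one index raised.\<close>

definition schouten :: "real \<Rightarrow> real^'n \<Rightarrow> real^'n^'n \<Rightarrow> real^'n^'n" where
  "schouten z p P = z *\<^sub>R P - ((norm p)\<^sup>2 / 2) *\<^sub>R mat 1"

text \<open>\<open>\<omega>\<close> is a negative power of \<open>u\<close>, so touching it from
  below means touching \<open>u\<close> from above: this is the subsolution half of the equation for
  \<open>u\<close>.\<close>

definition visc_sub :: "(real^'n^'n) set \<Rightarrow> (real^'n \<Rightarrow> real) \<Rightarrow> bool" where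
  "visc_sub U \<omega> \<longleftrightarrow> (\<forall>x p P. transpose P = P \<longrightarrow> subjet \<omega> x p P \<longrightarrow> schouten (\<omega> x) p P \<notin> U)"

text \<open>The supersolution half keeps the approximants themselves. In the comparison they supply
  twice differentiable test functions for \<open>visc_sub\<close>, so two merely continuous
  functions are never compared directly.\<close>

definition approx_super :: "(real^'n^'n) set \<Rightarrow> (real^'n \<Rightarrow> real) \<Rightarrow> bool" where
  "approx_super U \<omega> \<longleftrightarrow> (\<exists>w G H \<beta>.
     (\<forall>(k::nat) x. w k x > 0 \<and> twice_diff (w k) (G k) (H k x) x \<and> transpose (H k x) = H k x \<and>
        transpose (\<beta> k x) = \<beta> k x \<and> schouten (w k x) (G k x) (H k x) + \<beta> k x \<in> U) \<and>
     (\<forall>K. compact K \<longrightarrow> uniform_limit K w \<omega> sequentially \<and> uniform_limit K \<beta> (\<lambda>_. 0) sequentially))"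

lemma twice_diff_continuous_on:
  assumes "\<And>x. twice_diff f G (H x) x" shows "continuous_on UNIV f"
proof (rule continuous_at_imp_continuous_on, rule ballI)
  show "isCont f x" for x
    using assms[of x] unfolding twice_diff_def by (blast dest: eventually_nhds_x_imp_x has_derivative_continuous)
qed

lemma quad_recenter:
  fixes P :: "real^'n^'n"
  assumes "transpose P = P"
  shows "z + p \<bullet> (y - x) + (y - x) \<bullet> (P *v (y - x)) / 2 = (z + p \<bullet> (c - x) + (c - x) \<bullet> (P *v (c - x)) / 2)
     + (p + P *v (c - x)) \<bullet> (y - c) + (y - c) \<bullet> (P *v (y - c)) / 2"
proof -
  define a b where "a = c - x" and "b = y - c"
  have "y - x = a + b" by (simp add: a_def b_def)
  moreover have "(a + b) \<bullet> (P *v (a + b)) = a \<bullet> (P *v a) + 2 * ((P *v a) \<bullet> b) + b \<bullet> (P *v b)"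
    using sym_inner[OF assms, of a b] inner_commute[of b "P *v a"]
    by (simp add: matrix_vector_right_distrib inner_add_left inner_add_right)
  ultimately show ?thesis unfolding a_def[symmetric] b_def[symmetric]
    by (simp only: inner_add_left inner_add_right) argo
qed

text \<open>Suppose a jet with tensor in \<open>U\<close> touches \<open>\<omega>\<close> from
  below. Made strict and shifted by a constant, it also touches a nearby approximant, at a point
  \<open>c\<close> where the gradients agree and the Hessian of \<open>w k\<close> dominates
  \<open>P'\<close>. The perturbed tensor there lies above a fixed \<open>N\<close> in
  \<open>U\<close>, so \<open>F\<close> is at least F N > 0, contradicting its convergence to
  zero.\<close>

lemma visc_sub_of_approx:
  fixes U :: "(real^'n::finite^'n) set" and F :: "real^'n^'n \<Rightarrow> real"
  assumes U_open: "openin (top_of_set sym_matrices) U"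
    and U_pos: "\<And>M N. M \<in> U \<Longrightarrow> N \<in> pos_def_matrices \<Longrightarrow> M + N \<in> U"
    and F_diff: "F differentiable_on U"
    and F_ell: "\<And>M. M \<in> U \<Longrightarrow> matrix_gradient F M \<in> pos_def_matrices"
    and F_pos: "\<And>M. M \<in> U \<Longrightarrow> F M > 0"
    and w: "\<And>k x. w k x > 0" "\<And>k x. twice_diff (w k) (G k) (H k x) x"
      "\<And>k x. transpose (H k x) = H k x" "\<And>k x. transpose (\<beta> k x) = \<beta> k x"
      "\<And>k x. schouten (w k x) (G k x) (H k x) + \<beta> k x \<in> U"
    and lim: "\<And>K. compact K \<Longrightarrow> uniform_limit K w \<omega> sequentially"
      "\<And>K. compact K \<Longrightarrow> uniform_limit K \<beta> (\<lambda>_. 0) sequentially"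
      "\<And>K. compact K \<Longrightarrow> uniform_limit K (\<lambda>k x. F (schouten (w k x) (G k x) (H k x) + \<beta> k x)) (\<lambda>_. 0) sequentially"
    and \<omega>: "continuous_on UNIV \<omega>" "\<And>x. \<omega> x > 0"
  shows "visc_sub U \<omega>"
  unfolding visc_sub_def
proof (intro allI impI notI)
  fix x p P assume sym: "transpose P = P" and jet: "subjet \<omega> x p P" and inU: "schouten (\<omega> x) p P \<in> U"
  define z where "z = \<omega> x"
  have z: "z > 0" using \<omega> by (simp add: z_def)
  obtain \<eta> where \<eta>: "\<eta> > 0" "schouten z p P - \<eta> *\<^sub>R mat 1 \<in> U"
    using shrink_in_cone[OF U_open inU] by (auto simp: z_def)
  define N where "N = schouten z p P - \<eta> *\<^sub>R mat 1"
  \<comment> \<open>The tensor drops by 4 e z = \<open>\<eta>\<close> / 2 when \<open>P\<close> is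
    replaced by \<open>P'\<close>; the other half of the room \<open>\<eta>\<close> absorbs the
    error \<open>B\<close>.\<close>
  define e where "e = \<eta> / (8 * z)"
  have e: "e > 0" using \<eta> z by (simp add: e_def)
  define P' where "P' = P - (4 * e) *\<^sub>R mat 1"
  have sym': "transpose P' = P'" by (simp add: P'_def transpose_simps sym)
  define Q where "Q = (\<lambda>y. z + p \<bullet> (y - x) + (y - x) \<bullet> (P' *v (y - x)) / 2)"
  have near: "\<forall>\<^sub>F y in nhds x. Q y + e * (norm (y - x))\<^sup>2 \<le> \<omega> y"
    using jet[unfolded subjet_def, rule_format, OF e]
    by eventually_elim (simp add: z_def Q_def P'_def mult_vec_simps inner_diff_right power2_norm_eq_inner diff_divide_distrib)
  let ?\<Phi> = "\<lambda>y. schouten (\<omega> y) (p + P' *v (y - x)) P'"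
  have "continuous_on UNIV ?\<Phi>"
    unfolding schouten_def
    by (intro continuous_intros \<omega>(1) linear_continuous_on_compose[OF _ matrix_vector_mul_linear]) auto
  then have "isCont ?\<Phi> x" by (simp add: continuous_on_eq_continuous_at)
  then have "(?\<Phi> \<longlongrightarrow> ?\<Phi> x) (nhds x)"
    unfolding isCont_def using tendsto_at_iff_tendsto_nhds[of ?\<Phi> x] by blast
  then have near\<Phi>: "\<forall>\<^sub>F y in nhds x. norm (?\<Phi> y - ?\<Phi> x) < \<eta> / 8"
    using \<eta> tendstoD[of ?\<Phi> "?\<Phi> x" "nhds x" "\<eta> / 8"] by (simp add: dist_norm)
  obtain \<rho> where \<rho>: "\<rho> > 0" "\<And>y. norm (y - x) \<le> \<rho> \<Longrightarrow> Q y + e * (norm (y - x))\<^sup>2 \<le> \<omega> y"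
      "\<And>y. norm (y - x) \<le> \<rho> \<Longrightarrow> norm (?\<Phi> y - ?\<Phi> x) < \<eta> / 8"
  proof -
    obtain d where d: "d > 0" "\<And>y. dist y x < d \<Longrightarrow> Q y + e * (norm (y - x))\<^sup>2 \<le> \<omega> y \<and> norm (?\<Phi> y - ?\<Phi> x) < \<eta> / 8"
      using eventually_conj[OF near near\<Phi>] unfolding eventually_nhds_metric by blast
    show ?thesis by (rule that[of "d / 2"]) (use d in \<open>auto simp: dist_norm\<close>)
  qed
  let ?B = "cball x \<rho>"
  \<comment> \<open>The first bound keeps the minimum off the boundary sphere, where w k - Q exceeds
    e \<rho>^2 - \<kappa> while it is below \<kappa> at \<open>x\<close>; the second controls the
    Hessian term when \<open>\<omega>\<close> is replaced by \<open>w k\<close>.\<close>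
  define \<kappa> where "\<kappa> = min (e * \<rho>\<^sup>2 / 2) (\<eta> / (8 * (norm P' + 1)))"
  have nP: "norm P' + 1 > 0" using norm_ge_zero[of P'] by linarith
  have \<kappa>: "\<kappa> > 0" "\<kappa> \<le> e * \<rho>\<^sup>2 / 2" "\<kappa> * norm P' \<le> \<eta> / 8"
  proof -
    show "\<kappa> > 0" using e \<rho>(1) \<eta> nP by (simp add: \<kappa>_def)
    have "\<kappa> * norm P' \<le> \<eta> / (8 * (norm P' + 1)) * (norm P' + 1)"
      using \<open>\<kappa> > 0\<close> \<eta> nP by (intro mult_mono) (auto simp: \<kappa>_def)
    also have "\<dots> = \<eta> / 8" using nP by (simp add: divide_simps)
    finally show "\<kappa> * norm P' \<le> \<eta> / 8" .
  qed (unfold \<kappa>_def, rule min.cobounded1)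
  have "F N > 0" using F_pos \<eta> by (simp add: N_def)
  have "\<forall>\<^sub>F k in sequentially. \<forall>y\<in>?B. dist (w k y) (\<omega> y) < \<kappa>"
    "\<forall>\<^sub>F k in sequentially. \<forall>y\<in>?B. dist (\<beta> k y) 0 < \<eta> / 8"
    "\<forall>\<^sub>F k in sequentially. \<forall>y\<in>?B. dist (F (schouten (w k y) (G k y) (H k y) + \<beta> k y)) 0 < F N"
    by (rule uniform_limitD[OF lim(1)[OF compact_cball] \<kappa>(1)],
        rule uniform_limitD[OF lim(2)[OF compact_cball]], use \<eta> in simp,
        rule uniform_limitD[OF lim(3)[OF compact_cball] \<open>F N > 0\<close>])
  then have "\<forall>\<^sub>F k in sequentially. (\<forall>y\<in>?B. dist (w k y) (\<omega> y) < \<kappa>) \<and> (\<forall>y\<in>?B. dist (\<beta> k y) 0 < \<eta> / 8) \<and>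
    (\<forall>y\<in>?B. dist (F (schouten (w k y) (G k y) (H k y) + \<beta> k y)) 0 < F N)"
    by (intro eventually_conj)
  then obtain k where "(\<forall>y\<in>?B. dist (w k y) (\<omega> y) < \<kappa>) \<and> (\<forall>y\<in>?B. dist (\<beta> k y) 0 < \<eta> / 8) \<and>
    (\<forall>y\<in>?B. dist (F (schouten (w k y) (G k y) (H k y) + \<beta> k y)) 0 < F N)"
    using eventually_happens'[OF sequentially_bot] by blast
  then have k: "\<And>y. y \<in> ?B \<Longrightarrow> \<bar>w k y - \<omega> y\<bar> < \<kappa>" "\<And>y. y \<in> ?B \<Longrightarrow> norm (\<beta> k y) < \<eta> / 8"
    "\<And>y. y \<in> ?B \<Longrightarrow> F (schouten (w k y) (G k y) (H k y) + \<beta> k y) < F N"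
    unfolding dist_real_def dist_0_norm[symmetric] dist_commute[of 0] by force+
  have Qc: "continuous_on UNIV Q" unfolding Q_def
    by (intro continuous_intros linear_continuous_on_compose[OF _ matrix_vector_mul_linear]) auto
  have "continuous_on ?B (\<lambda>y. w k y - Q y)"
    by (intro continuous_intros continuous_on_subset[OF twice_diff_continuous_on[OF w(2)]] continuous_on_subset[OF Qc]) auto
  then obtain c where c: "c \<in> ?B" "\<And>y. y \<in> ?B \<Longrightarrow> w k c - Q c \<le> w k y - Q y"
    using continuous_attains_inf[OF compact_cball, of x \<rho>] \<rho>(1) by force
  have "norm (c - x) < \<rho>"
  proof (rule ccontr)
    assume "\<not> norm (c - x) < \<rho>"
    then have cx: "norm (c - x) = \<rho>" using c(1) by (simp add: dist_norm norm_minus_commute)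
    have "e * \<rho>\<^sup>2 - \<kappa> < w k c - Q c" using \<rho>(2)[of c] k(1)[OF c(1)] cx by simp
    also have "\<dots> \<le> w k x - Q x" using c(2)[of x] \<rho>(1) by simp
    also have "\<dots> < \<kappa>" using k(1)[of x] \<rho>(1) by (simp add: Q_def z_def)
    finally show False using \<kappa>(2) by simp
  qed
  then have "\<forall>\<^sub>F y in nhds c. y \<in> ball x \<rho>"
    by (intro eventually_nhds_in_open) (auto simp: dist_norm norm_minus_commute)
  then have "\<forall>\<^sub>F y in nhds c. w k c + (p + P' *v (c - x)) \<bullet> (y - c) + (y - c) \<bullet> (P' *v (y - c)) / 2 \<le> w k y"
  proof eventually_elim
    case (elim y)
    have "Q y = Q c + (p + P' *v (c - x)) \<bullet> (y - c) + (y - c) \<bullet> (P' *v (y - c)) / 2"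
      unfolding Q_def by (rule quad_recenter[OF sym'])
    then show ?case using c(2)[of y] elim by simp
  qed
  note test = local_min_test[OF w(2,3) sym' this]
  define B where "B = (w k c - \<omega> c) *\<^sub>R P' + (?\<Phi> c - ?\<Phi> x) + \<beta> k c"
  have "norm B \<le> \<bar>w k c - \<omega> c\<bar> * norm P' + norm (?\<Phi> c - ?\<Phi> x) + norm (\<beta> k c)"
    unfolding B_def by (metis (no_types, lifting) norm_scaleR norm_triangle_le norm_triangle_mono order_refl)
  also have "\<dots> < \<eta> / 8 + \<eta> / 8 + \<eta> / 8"
  proof -
    have "\<bar>w k c - \<omega> c\<bar> * norm P' \<le> \<eta> / 8"
      using mult_right_mono[of "\<bar>w k c - \<omega> c\<bar>" \<kappa> "norm P'"] k(1)[OF c(1)] \<kappa>(3) by simp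
    then show ?thesis using \<rho>(3)[of c] k(2)[OF c(1)] \<open>norm (c - x) < \<rho>\<close> by simp
  qed
  finally have nB: "norm B < \<eta> / 2" using \<eta>(1) by simp
  have sB: "transpose B = B"
    by (simp add: B_def transpose_simps schouten_def sym' w)
  define J :: "real^'n^'n" where "J = (\<eta> / 2) *\<^sub>R mat 1"
  have J: "\<eta> *\<^sub>R mat 1 = J + J" by (simp add: J_def flip: scaleR_add_left)
  have \<Phi>x: "?\<Phi> x = schouten z p P - J"
    using z by (simp add: J_def schouten_def P'_def z_def[symmetric] e_def algebra_simps)
  have eq: "schouten (w k c) (G k c) (H k c) + \<beta> k c = N + (w k c *\<^sub>R (H k c - P') + (J + B))"
    unfolding N_def test(1) J B_def \<Phi>x by (simp add: schouten_def algebra_simps)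
  have "psd (w k c *\<^sub>R (H k c - P') + (J + B))"
    using pos_def_imp_psd[OF mat_add_small_pos_def[OF sB nB]] test(2) w(1)[of k c]
    by (auto simp: J_def psd_def transpose_simps mult_vec_simps inner_add_right)
  then have "F N \<le> F (N + (w k c *\<^sub>R (H k c - P') + (J + B)))"
    using \<eta>(2) by (intro F_mono[OF U_open U_pos F_diff F_ell]) (auto simp: N_def)
  then show False using k(3)[OF c(1)] eq by simp
qed

section \<open>From the weak solution \<open>u\<close> to the variable
  \<open>\<omega>\<close>\<close>

lemma has_derivative_gradient:
  fixes v :: "real^'n \<Rightarrow> real"
  assumes "v differentiable (at y)"
  shows "(v has_derivative (\<lambda>h. gradient v y \<bullet> h)) (at y)"
proof -
  obtain D where D: "(v has_derivative D) (at y)" using assms by (auto simp: differentiable_def)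
  then have lin: "linear D" by (rule has_derivative_linear)
  have "D h = gradient v y \<bullet> h" for h
  proof -
    have "D h = D (\<Sum>i\<in>UNIV. h $ i *\<^sub>R axis i 1)"
      using basis_expansion[of h] by (simp add: scalar_mult_eq_scaleR)
    also have "\<dots> = (\<Sum>i\<in>UNIV. h $ i * D (axis i 1))"
      by (simp only: linear_sum[OF lin] linear_scale[OF lin] real_scaleR_def)
    also have "\<dots> = gradient v y \<bullet> h"
      using D by (simp add: gradient_def inner_vec_def partial_deriv_def frechet_derivative_at[symmetric] mult.commute)
    finally show ?thesis .
  qed
  then have "D = (\<lambda>h. gradient v y \<bullet> h)" by auto
  with D show ?thesis by simp
qed

lemma has_derivative_vec_components:
  fixes f :: "'a::real_normed_vector \<Rightarrow> real^'n"
  assumes "\<And>i. ((\<lambda>y. f y $ i) has_derivative (\<lambda>h. D h $ i)) (at x)"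
  shows "(f has_derivative D) (at x)"
proof -
  have "((\<lambda>y. \<Sum>i\<in>UNIV. f y $ i *\<^sub>R axis i 1) has_derivative (\<lambda>h. \<Sum>i\<in>UNIV. D h $ i *\<^sub>R axis i (1::real))) (at x)"
    by (intro has_derivative_sum has_derivative_scaleR_left assms)
  then show ?thesis using basis_expansion[where 'a = real and 'n = 'n] by (simp add: scalar_mult_eq_scaleR)
qed

text \<open>The transpose appears because \<open>hessian\<close> has the entry d_i d_j v where the
  derivative of the gradient has d_j d_i v.\<close>

lemma twice_diff_Ck:
  fixes v :: "real^'n \<Rightarrow> real"
  assumes "Ck_on 2 UNIV v"
  shows "twice_diff v (gradient v) (transpose (hessian v x)) x"
  unfolding twice_diff_def
proof (intro conjI always_eventually allI)
  have df: "v differentiable_on UNIV" "\<And>i. partial_deriv i v differentiable_on UNIV"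
    using assms by (auto simp: numeral_2_eq_2)
  show "(v has_derivative (\<lambda>h. gradient v y \<bullet> h)) (at y)" for y
    using df(1) by (intro has_derivative_gradient) (simp add: differentiable_on_def)
  show "(gradient v has_derivative (*v) (transpose (hessian v x))) (at x)"
  proof (rule has_derivative_vec_components)
    fix i
    have "(partial_deriv i v has_derivative (\<lambda>h. gradient (partial_deriv i v) x \<bullet> h)) (at x)"
      using df(2) by (intro has_derivative_gradient) (simp add: differentiable_on_def)
    then show "((\<lambda>y. gradient v y $ i) has_derivative (\<lambda>h. (transpose (hessian v x) *v h) $ i)) (at x)"
      by (simp add: gradient_def hessian_def transpose_def matrix_vector_mult_def inner_vec_def)
  qed
qed

lemma twice_diff_powr:
  fixes v :: "real^'n \<Rightarrow> real" and s :: real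
  assumes td: "twice_diff v g H x" and pos: "v x > 0"
  shows "twice_diff (\<lambda>y. v y powr s) (\<lambda>y. (s * v y powr (s - 1)) *\<^sub>R g y)
     ((s * v x powr (s - 1)) *\<^sub>R H + (s * (s - 1) * v x powr (s - 2)) *\<^sub>R outer (g x) (g x)) x"
  unfolding twice_diff_def
proof
  have pw: "((\<lambda>y. v y powr r) has_derivative (\<lambda>h. (r * v y powr (r - 1)) * (g y \<bullet> h))) (at y)"
    if "(v has_derivative (\<lambda>h. g y \<bullet> h)) (at y)" "v y > 0" for y r
    using has_derivative_compose[OF that(1) has_real_derivative_powr[OF that(2), unfolded has_field_derivative_def]]
    by simp
  have ev: "\<forall>\<^sub>F y in nhds x. (v has_derivative (\<lambda>h. g y \<bullet> h)) (at y)" using td by (simp add: twice_diff_def)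
  have "isCont v x" using eventually_nhds_x_imp_x[OF ev] by (rule has_derivative_continuous)
  then have "(v \<longlongrightarrow> v x) (nhds x)" unfolding isCont_def using tendsto_at_iff_tendsto_nhds[of v x] by blast
  then have "\<forall>\<^sub>F y in nhds x. v y > 0" using pos by (rule order_tendstoD)
  with ev show "\<forall>\<^sub>F y in nhds x. ((\<lambda>y. v y powr s) has_derivative (\<lambda>h. ((s * v y powr (s - 1)) *\<^sub>R g y) \<bullet> h)) (at y)"
    by eventually_elim (simp add: pw)
  have vx: "(v has_derivative (\<lambda>h. g x \<bullet> h)) (at x)" using ev by (rule eventually_nhds_x_imp_x)
  have gx: "(g has_derivative (\<lambda>h. H *v h)) (at x)" using td by (simp add: twice_diff_def)
  have "((\<lambda>y. (s * v y powr (s - 1)) *\<^sub>R g y) has_derivative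
      (\<lambda>h. (s * v x powr (s - 1)) *\<^sub>R (H *v h) + (s * (((s - 1) * v x powr (s - 1 - 1)) * (g x \<bullet> h))) *\<^sub>R g x)) (at x)"
    by (intro has_derivative_scaleR has_derivative_mult_right pw vx gx pos)
  then show "((\<lambda>y. (s * v y powr (s - 1)) *\<^sub>R g y) has_derivative
      (*v) ((s * v x powr (s - 1)) *\<^sub>R H + (s * (s - 1) * v x powr (s - 2)) *\<^sub>R outer (g x) (g x))) (at x)"
    by (rule has_derivative_eq_rhs) (simp add: fun_eq_iff mult_vec_simps mult_ac)
qed

text \<open>The exponent \<open>s\<close> is the one with 2 s - 1 = -(n + 2) / (n - 2) and 2 s - 2 =
  -2 n / (n - 2); then s, s (s - 1) and s^2 / 2 are the coefficients of the three terms of A^u, the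
  last one entering with a minus sign.\<close>

lemma conf_hessian_eq_schouten:
  fixes v :: "real^'n \<Rightarrow> real"
  assumes dim: "CARD('n) \<ge> 3" and pos: "v x > 0"
  defines "s \<equiv> - (2 / (real CARD('n) - 2))"
  shows "conf_hessian v x = schouten (v x powr s) ((s * v x powr (s - 1)) *\<^sub>R gradient v x)
     ((s * v x powr (s - 1)) *\<^sub>R hessian v x + (s * (s - 1) * v x powr (s - 2)) *\<^sub>R outer (gradient v x) (gradient v x))"
proof -
  define n where "n = real CARD('n)"
  define m where "m = n - 2"
  have m: "m > 0" using dim by (simp add: n_def m_def)
  have nm: "n = m + 2" by (simp add: m_def)
  have sm: "s = - (2 / m)" by (simp add: s_def n_def m_def)
  have p1: "v x powr s * v x powr (s - 1) = v x powr (- ((n + 2) / (n - 2)))"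
  proof -
    have "s + (s - 1) = - ((n + 2) / (n - 2))" using m unfolding sm nm by (simp add: field_simps)
    then show ?thesis by (simp add: power2_eq_square flip: powr_add)
  qed
  have p2: "v x powr s * v x powr (s - 2) = v x powr (- (2 * n / (n - 2)))"
  proof -
    have "s + (s - 2) = - (2 * n / (n - 2))" using m unfolding sm nm by (simp add: field_simps)
    then show ?thesis by (simp add: power2_eq_square flip: powr_add)
  qed
  have p3: "(v x powr (s - 1))\<^sup>2 = v x powr (- (2 * n / (n - 2)))"
  proof -
    have "(s - 1) + (s - 1) = - (2 * n / (n - 2))" using m unfolding sm nm by (simp add: field_simps)
    then show ?thesis by (simp add: power2_eq_square flip: powr_add)
  qed
  have c2: "s * (s - 1) = 2 * n / (n - 2)\<^sup>2"
    using m unfolding sm nm by (simp add: field_simps power2_eq_square)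
  have c3: "s\<^sup>2 / 2 = 2 / (n - 2)\<^sup>2"
    using m unfolding sm nm by (simp add: field_simps power2_eq_square)
  let ?g = "gradient v x"
  have "schouten (v x powr s) ((s * v x powr (s - 1)) *\<^sub>R ?g)
     ((s * v x powr (s - 1)) *\<^sub>R hessian v x + (s * (s - 1) * v x powr (s - 2)) *\<^sub>R outer ?g ?g)
    = (s * (v x powr s * v x powr (s - 1))) *\<^sub>R hessian v x
      + ((s * (s - 1)) * (v x powr s * v x powr (s - 2))) *\<^sub>R outer ?g ?g
      - (s\<^sup>2 / 2 * (v x powr (s - 1))\<^sup>2 * (norm ?g)\<^sup>2) *\<^sub>R mat 1"
    by (simp add: schouten_def scaleR_add_right power_mult_distrib mult_ac)
  also have "\<dots> = conf_hessian v x"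
    unfolding p1 p2 p3 c2 c3 by (simp add: conf_hessian_def Let_def n_def[symmetric] s_def outer_def)
  finally show ?thesis ..
qed

text \<open>All terms but the Hessian are visibly symmetric and its coefficient is nonzero, so its
  symmetry is inherited from the conformal Hessian, and ultimately from the matrices in
  \<open>U\<close>.\<close>

lemma hessian_symmetric:
  fixes v :: "real^'n \<Rightarrow> real"
  assumes dim: "CARD('n) \<ge> 3" and pos: "v x > 0" and sym: "transpose (conf_hessian v x) = conf_hessian v x"
  shows "transpose (hessian v x) = hessian v x"
proof -
  define n where "n = real CARD('n)"
  have n: "n - 2 > 0" using dim by (simp add: n_def)
  define c where "c = - (2 / (n - 2)) * v x powr (- ((n + 2) / (n - 2)))"
  have c: "c \<noteq> 0" using n pos by (simp add: c_def)
  define R where "R = (2 * n / (n - 2)^2 * v x powr (- (2 * n / (n - 2)))) *\<^sub>R outer (gradient v x) (gradient v x)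
     - (2 / (n - 2)^2 * v x powr (- (2 * n / (n - 2))) * (norm (gradient v x))^2) *\<^sub>R mat 1"
  have R: "transpose R = R" by (simp add: R_def transpose_simps)
  have eq: "conf_hessian v x = c *\<^sub>R hessian v x + R"
    by (simp add: conf_hessian_def Let_def n_def[symmetric] c_def R_def outer_def algebra_simps)
  have "c *\<^sub>R transpose (hessian v x) = c *\<^sub>R hessian v x"
    using sym unfolding eq by (simp add: transpose_simps R)
  with c show ?thesis by simp
qed

text \<open>On \<open>K\<close> the values eventually lie in a compact interval of positive numbers,
  where the power is uniformly continuous.\<close>

lemma uniform_limit_powr:
  fixes u :: "real^'n \<Rightarrow> real"
  assumes K: "compact K" and u: "continuous_on UNIV u" "\<And>x. u x > 0"
    and lim: "uniform_limit K v u sequentially"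
  shows "uniform_limit K (\<lambda>k x. v k x powr s) (\<lambda>x. u x powr s) sequentially"
proof (cases "K = {}")
  case False
  have uK: "continuous_on K u" using u(1) continuous_on_subset by blast
  obtain a where a: "a \<in> K" "\<And>y. y \<in> K \<Longrightarrow> u a \<le> u y"
    using continuous_attains_inf[OF K False uK] by blast
  obtain b where b: "b \<in> K" "\<And>y. y \<in> K \<Longrightarrow> u y \<le> u b"
    using continuous_attains_sup[OF K False uK] by blast
  let ?I = "{u a / 2 .. u b + u a / 2}"
  have ua: "u a > 0" by (rule u)
  show ?thesis
  proof (rule uniform_limit_compose_uniformly_continuous_on[where f = "\<lambda>t. t powr s" and B = ?I, OF lim])
    show "uniformly_continuous_on ?I (\<lambda>t. t powr s)"
      using ua by (intro compact_uniformly_continuous continuous_intros) auto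
    have "\<forall>\<^sub>F n in sequentially. \<forall>x\<in>K. dist (v n x) (u x) < u a / 2"
      using uniform_limitD[OF lim, of "u a / 2"] ua by simp
    then show "\<forall>\<^sub>F n in sequentially. \<forall>x\<in>K. v n x \<in> ?I"
    proof eventually_elim
      case (elim n)
      show ?case
      proof
        fix x assume x: "x \<in> K"
        then show "v n x \<in> ?I" using elim[rule_format, OF x] a(2)[OF x] b(2)[OF x]
          unfolding dist_real_def abs_less_iff atLeastAtMost_iff by linarith
      qed
    qed
  qed auto
qed simp

lemma weak_solution_approx:
  fixes U :: "(real^'n::finite^'n) set" and F :: "real^'n^'n \<Rightarrow> real"
  assumes dim: "CARD('n) \<ge> 3"
    and U_open: "openin (top_of_set sym_matrices) U"
    and U_pos: "\<And>M N. M \<in> U \<Longrightarrow> N \<in> pos_def_matrices \<Longrightarrow> M + N \<in> U"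
    and F_diff: "F differentiable_on U"
    and F_ell: "\<And>M. M \<in> U \<Longrightarrow> matrix_gradient F M \<in> pos_def_matrices"
    and F_pos: "\<And>M. M \<in> U \<Longrightarrow> F M > 0"
    and weak: "weak_solution U F UNIV u"
  defines "s \<equiv> - (2 / (real CARD('n) - 2))"
  shows "visc_sub U (\<lambda>x. u x powr s)" "approx_super U (\<lambda>x. u x powr s)"
proof -
  obtain v \<beta> where v: "\<And>k::nat. Ck_on 2 UNIV (v k)"
      "\<And>k x. \<beta> k x \<in> sym_matrices" "\<And>k x. v k x > 0" "\<And>k x. conf_hessian (v k) x + \<beta> k x \<in> U"
    and lim: "\<And>K. compact K \<Longrightarrow> uniform_limit K v u sequentially"
      "\<And>K. compact K \<Longrightarrow> uniform_limit K \<beta> (\<lambda>_. 0) sequentially"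
      "\<And>K. compact K \<Longrightarrow> uniform_limit K (\<lambda>k x. F (conf_hessian (v k) x + \<beta> k x)) (\<lambda>_. 0) sequentially"
    and u: "continuous_on UNIV u" "\<And>x. u x > 0"
    using weak unfolding weak_solution_def by (elim conjE exE) blast
  let ?w = "\<lambda>k x. v k x powr s"
  let ?G = "\<lambda>k x. (s * v k x powr (s - 1)) *\<^sub>R gradient (v k) x"
  let ?H = "\<lambda>k x. (s * v k x powr (s - 1)) *\<^sub>R hessian (v k) x
     + (s * (s - 1) * v k x powr (s - 2)) *\<^sub>R outer (gradient (v k) x) (gradient (v k) x)"
  have ch: "conf_hessian (v k) x = schouten (?w k x) (?G k x) (?H k x)" for k x
    unfolding s_def by (rule conf_hessian_eq_schouten[OF dim v(3)])
  have symb: "transpose (\<beta> k x) = \<beta> k x" for k x using v(2) by (simp add: sym_matrices_def)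
  have symh: "transpose (hessian (v k) x) = hessian (v k) x" for k x
  proof (rule hessian_symmetric[OF dim v(3)])
    have "transpose (conf_hessian (v k) x + \<beta> k x) = conf_hessian (v k) x + \<beta> k x"
      by (rule openin_sym_sym[OF U_open v(4)])
    then show "transpose (conf_hessian (v k) x) = conf_hessian (v k) x" by (simp add: transpose_simps symb)
  qed
  have td: "twice_diff (?w k) (?G k) (?H k x) x" for k x
    using twice_diff_powr[OF twice_diff_Ck[OF v(1)[of k], of x] v(3), of s] by (simp add: symh)
  have symH: "transpose (?H k x) = ?H k x" for k x by (simp add: transpose_simps symh)
  have wpos: "?w k x > 0" for k x using v(3)[of k x] by simp
  have limw: "uniform_limit K ?w (\<lambda>x. u x powr s) sequentially" if "compact K" for K
    by (rule uniform_limit_powr[OF that u lim(1)[OF that]])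
  have \<omega>: "continuous_on UNIV (\<lambda>x. u x powr s)" "u x powr s > 0" for x
    using u(2) by (auto intro!: continuous_intros u simp: less_imp_neq[symmetric])
  show "visc_sub U (\<lambda>x. u x powr s)"
    by (rule visc_sub_of_approx[OF U_open U_pos F_diff F_ell F_pos wpos td symH symb v(4)[unfolded ch] limw lim(2)
        lim(3)[unfolded ch] \<omega>])
  show "approx_super U (\<lambda>x. u x powr s)"
    unfolding approx_super_def
    by (intro exI[of _ ?w] exI[of _ ?G] exI[of _ ?H] exI[of _ \<beta>] conjI allI impI wpos td symH symb limw lim(2)
        v(4)[unfolded ch])
qed

section \<open>Inversion and conformal invariance\<close>

text \<open>At y = 0 both the inversion and \<open>kelvin\<close> take the conventional value 0;
  hence the explicit assumptions y \<noteq> 0 at the puncture.\<close>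

definition inversion :: "real \<Rightarrow> real^'n \<Rightarrow> real^'n" where
  "inversion l y = (l\<^sup>2 / (y \<bullet> y)) *\<^sub>R y"

text \<open>The weight |y|^2 / l^2 is the classical factor (l / |y|)^(n - 2) of the Kelvin transform
  of \<open>u\<close>, raised to the power -2 / (n - 2).\<close>

definition kelvin :: "real \<Rightarrow> (real^'n \<Rightarrow> real) \<Rightarrow> real^'n \<Rightarrow> real" where
  "kelvin l w y = (y \<bullet> y) / l\<^sup>2 * w (inversion l y)"

text \<open>Reflection in the hyperplane orthogonal to \<open>y\<close>; up to the factor l^2 /
  |y|^2 it is the differential of the inversion.\<close>

definition reflection :: "real^'n \<Rightarrow> real^'n^'n" where
  "reflection y = mat 1 - (2 / (y \<bullet> y)) *\<^sub>R outer y y"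

lemma kelvin_pos: "y \<noteq> 0 \<Longrightarrow> l \<noteq> 0 \<Longrightarrow> w (inversion l y) > 0 \<Longrightarrow> kelvin l w y > 0"
  unfolding kelvin_def by (intro mult_pos_pos divide_pos_pos) auto

lemma matrix_add_rdistrib: "(A + B) ** C = A ** C + B ** C" for A :: "real^'n^'m"
  by (vector matrix_matrix_mult_def sum.distrib[symmetric] field_simps)

lemma reflection_mult_vec: "reflection y *v h = h - (2 * (y \<bullet> h) / (y \<bullet> y)) *\<^sub>R y"
  by (simp add: reflection_def mult_vec_simps)

lemma transpose_reflection: "transpose (reflection y) = reflection y"
  by (simp add: reflection_def transpose_simps)

lemma reflection_involution: "y \<noteq> 0 \<Longrightarrow> reflection y *v (reflection y *v h) = h"
proof -
  assume y: "y \<noteq> 0"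
  have "2 * (y \<bullet> (h - (2 * (y \<bullet> h) / (y \<bullet> y)) *\<^sub>R y)) / (y \<bullet> y) = - (2 * (y \<bullet> h) / (y \<bullet> y))"
    using y by (simp add: inner_diff_right)
  then show ?thesis unfolding reflection_mult_vec by (simp only: scaleR_minus_left diff_minus_eq_add diff_add_cancel)
qed

lemma reflection_inner: "y \<noteq> 0 \<Longrightarrow> (reflection y *v a) \<bullet> (reflection y *v b) = a \<bullet> b"
  using sym_inner[OF transpose_reflection, of "reflection y *v a" y b] by (simp add: reflection_involution)

lemma reflection_square: "y \<noteq> 0 \<Longrightarrow> reflection y ** reflection y = mat 1"
  by (simp add: matrix_eq reflection_involution flip: matrix_vector_mul_assoc)

lemma inversion_has_derivative:
  assumes "y \<noteq> 0"
  shows "(inversion l has_derivative (\<lambda>h. (l\<^sup>2 / (y \<bullet> y)) *\<^sub>R (reflection y *v h))) (at y)"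
proof -
  have s: "y \<bullet> y \<noteq> 0" using assms by simp
  have 1: "((\<lambda>y. y \<bullet> y) has_derivative (\<lambda>h. 2 * (y \<bullet> h))) (at y)"
    by (auto intro!: derivative_eq_intros simp: inner_commute)
  have "((\<lambda>y. l\<^sup>2 / (y \<bullet> y)) has_derivative (\<lambda>h. - (l\<^sup>2 * (2 * (y \<bullet> h)) / (y \<bullet> y)\<^sup>2))) (at y)"
    by (rule derivative_eq_intros 1 s refl | simp)+ (simp add: s power2_eq_square field_simps fun_eq_iff)
  from has_derivative_scaleR[OF this has_derivative_ident]
  have "((\<lambda>y. (l\<^sup>2 / (y \<bullet> y)) *\<^sub>R y) has_derivative
     (\<lambda>h. (l\<^sup>2 / (y \<bullet> y)) *\<^sub>R h + (- (l\<^sup>2 * (2 * (y \<bullet> h)) / (y \<bullet> y)\<^sup>2)) *\<^sub>R y)) (at y)" .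
  then show ?thesis unfolding inversion_def[abs_def]
    by (rule has_derivative_eq_rhs)
      (simp add: fun_eq_iff reflection_mult_vec scaleR_diff_right power2_eq_square)
qed

definition kelvin_grad :: "real \<Rightarrow> (real^'n \<Rightarrow> real) \<Rightarrow> (real^'n \<Rightarrow> real^'n) \<Rightarrow> real^'n \<Rightarrow> real^'n" where
  "kelvin_grad l w G y = (2 / l\<^sup>2 * w (inversion l y)) *\<^sub>R y + reflection y *v G (inversion l y)"

definition kelvin_hess :: "real \<Rightarrow> real \<Rightarrow> real^'n \<Rightarrow> real^'n^'n \<Rightarrow> real^'n \<Rightarrow> real^'n^'n" where
  "kelvin_hess l z p H y = (2 * z / l\<^sup>2 - 2 * (y \<bullet> p) / (y \<bullet> y)) *\<^sub>R mat 1
     + (l\<^sup>2 / (y \<bullet> y)) *\<^sub>R (reflection y ** H ** reflection y)"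

lemma kelvin_twice_diff:
  assumes td: "twice_diff w G H (inversion l y)" and y: "y \<noteq> 0" and l: "l \<noteq> 0"
  shows "twice_diff (kelvin l w) (kelvin_grad l w G)
     (kelvin_hess l (w (inversion l y)) (G (inversion l y)) H y) y"
  unfolding twice_diff_def
proof
  have step: "((\<lambda>y. w (inversion l y)) has_derivative
      (\<lambda>h. G (inversion l y) \<bullet> ((l\<^sup>2 / (y \<bullet> y)) *\<^sub>R (reflection y *v h)))) (at y)"
    if "y \<noteq> 0" "(w has_derivative (\<lambda>h. G (inversion l y) \<bullet> h)) (at (inversion l y))" for y
    using has_derivative_compose[OF inversion_has_derivative[OF that(1)] that(2)] .
  have sq: "((\<lambda>y. y \<bullet> y) has_derivative (\<lambda>h. 2 * (y \<bullet> h))) (at y)" for y :: "real^'a"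
    by (auto intro!: derivative_eq_intros simp: inner_commute)
  have "(inversion l \<longlongrightarrow> inversion l y) (nhds y)"
    using has_derivative_continuous[OF inversion_has_derivative[OF y]] tendsto_at_iff_tendsto_nhds[of "inversion l" y]
    by (simp add: isCont_def)
  then have ev: "\<forall>\<^sub>F y in nhds y. (w has_derivative (\<lambda>h. G (inversion l y) \<bullet> h)) (at (inversion l y))"
    using td unfolding twice_diff_def by (auto dest: eventually_compose_filterlim)
  have "\<forall>\<^sub>F y in nhds y. y \<noteq> 0" using y by (rule t1_space_nhds)
  with ev show "\<forall>\<^sub>F y in nhds y. (kelvin l w has_derivative (\<lambda>h. kelvin_grad l w G y \<bullet> h)) (at y)"
  proof eventually_elim
    case (elim y)
    let ?p = "G (inversion l y)"
    have "((\<lambda>y. (y \<bullet> y) / l\<^sup>2 * w (inversion l y)) has_derivative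
       (\<lambda>h. (y \<bullet> y) / l\<^sup>2 * (?p \<bullet> ((l\<^sup>2 / (y \<bullet> y)) *\<^sub>R (reflection y *v h))) + 2 * (y \<bullet> h) / l\<^sup>2 * w (inversion l y))) (at y)"
      using has_derivative_mult[OF has_derivative_mult_right[OF sq, of "inverse (l\<^sup>2)" y] step[OF elim(2,1)]]
      by (simp add: divide_inverse mult_ac)
    then show ?case unfolding kelvin_def[abs_def]
      by (rule has_derivative_eq_rhs)
        (use elim l in \<open>simp add: fun_eq_iff kelvin_grad_def inner_add_left sym_inner[OF transpose_reflection]\<close>)
  qed
  let ?p = "G (inversion l y)" and ?z = "w (inversion l y)" and ?s = "y \<bullet> y" and ?c = "l\<^sup>2 / (y \<bullet> y)"
  have s: "?s \<noteq> 0" using y by simp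
  have dw: "((\<lambda>y. w (inversion l y)) has_derivative (\<lambda>h. ?p \<bullet> (?c *\<^sub>R (reflection y *v h)))) (at y)"
    by (rule step[OF y eventually_nhds_x_imp_x[OF ev]])
  have dG: "((\<lambda>y. G (inversion l y)) has_derivative (\<lambda>h. H *v (?c *\<^sub>R (reflection y *v h)))) (at y)"
    by (rule has_derivative_compose[OF inversion_has_derivative[OF y] conjunct2[OF td[unfolded twice_diff_def]]])
  let ?G' = "\<lambda>h. H *v (?c *\<^sub>R (reflection y *v h))"
  have q: "((\<lambda>y. 2 * (y \<bullet> G (inversion l y)) / (y \<bullet> y)) has_derivative
     (\<lambda>h. 2 * (y \<bullet> ?G' h + h \<bullet> ?p) / ?s - 2 * (y \<bullet> ?p) * (2 * (y \<bullet> h)) / ?s\<^sup>2)) (at y)"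
    by (rule has_derivative_eq_rhs, rule has_derivative_divide[OF has_derivative_mult_right[OF has_derivative_inner[OF has_derivative_ident dG]] sq s])
      (simp add: fun_eq_iff power2_eq_square divide_simps s algebra_simps)
  have "((\<lambda>y. (2 / l\<^sup>2 * w (inversion l y)) *\<^sub>R y + (G (inversion l y) - (2 * (y \<bullet> G (inversion l y)) / (y \<bullet> y)) *\<^sub>R y)) has_derivative
    (\<lambda>h. ((2 / l\<^sup>2 * ?z) *\<^sub>R h + (2 / l\<^sup>2 * (?p \<bullet> (?c *\<^sub>R (reflection y *v h)))) *\<^sub>R y)
      + (?G' h - ((2 * (y \<bullet> ?p) / ?s) *\<^sub>R h + (2 * (y \<bullet> ?G' h + h \<bullet> ?p) / ?s - 2 * (y \<bullet> ?p) * (2 * (y \<bullet> h)) / ?s\<^sup>2) *\<^sub>R y)))) (at y)"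
    by (intro has_derivative_add has_derivative_diff has_derivative_scaleR has_derivative_mult_right has_derivative_ident dw dG q)
  then show "(kelvin_grad l w G has_derivative (*v) (kelvin_hess l ?z ?p H y)) (at y)"
    unfolding kelvin_grad_def[abs_def] reflection_mult_vec[of _ "G _"]
  proof (rule has_derivative_eq_rhs, intro ext)
    fix h
    define v where "v = ?G' h"
    \<comment> \<open>By this identity the multiples of \<open>y\<close> that come from
      differentiating w composed with the inversion and from differentiating the reflection cancel,
      except the one that completes \<open>reflection y *v v\<close>.\<close>
    have "2 / l\<^sup>2 * (?p \<bullet> (?c *\<^sub>R (reflection y *v h))) = 2 * (h \<bullet> ?p) / ?s - 2 * (y \<bullet> ?p) * (2 * (y \<bullet> h)) / ?s\<^sup>2"
      using l s by (simp add: reflection_mult_vec inner_diff_right inner_commute power2_eq_square divide_simps)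
    moreover have "?c *\<^sub>R (reflection y ** H ** reflection y) *v h = reflection y *v v"
      by (simp add: v_def matrix_vector_mult_scaleR flip: matrix_vector_mul_assoc scaleR_matrix_vector_assoc)
    ultimately show "((2 / l\<^sup>2 * ?z) *\<^sub>R h + (2 / l\<^sup>2 * (?p \<bullet> (?c *\<^sub>R (reflection y *v h)))) *\<^sub>R y)
      + (?G' h - ((2 * (y \<bullet> ?p) / ?s) *\<^sub>R h + (2 * (y \<bullet> ?G' h + h \<bullet> ?p) / ?s - 2 * (y \<bullet> ?p) * (2 * (y \<bullet> h)) / ?s\<^sup>2) *\<^sub>R y))
      = kelvin_hess l ?z ?p H y *v h"
      unfolding kelvin_hess_def v_def[symmetric]
      by (simp add: mult_vec_simps reflection_mult_vec[of y v] scaleR_left_diff_distrib scaleR_add_left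
          add_divide_distrib distrib_left)
  qed
qed

lemma schouten_mat_plus:
  "schouten z p (a *\<^sub>R mat 1 + c *\<^sub>R N) = (z * a - (norm p)\<^sup>2 / 2) *\<^sub>R mat 1 + (z * c) *\<^sub>R N"
  by (simp add: schouten_def scaleR_add_right scaleR_left_diff_distrib)

text \<open>The factors |y|^2 / l^2 and l^2 / |y|^2 cancel in front of the conjugated Hessian. In
  the multiple of the identity, the square of \<open>kelvin_grad\<close> removes exactly the terms
  in w^2 and w (y . p) that \<open>kelvin_hess\<close> adds, leaving -|p|^2 / 2, and conjugation by
  a reflection fixes the identity.\<close>

lemma kelvin_schouten:
  assumes y: "y \<noteq> 0" and l: "l \<noteq> 0"
  shows "schouten (kelvin l w y) (kelvin_grad l w G y)
      (kelvin_hess l (w (inversion l y)) (G (inversion l y)) H y)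
    = reflection y ** schouten (w (inversion l y)) (G (inversion l y)) H ** reflection y"
proof -
  let ?p = "G (inversion l y)" and ?z = "w (inversion l y)" and ?s = "y \<bullet> y" and ?R = "reflection y"
  have s: "?s \<noteq> 0" using y by simp
  have "(norm (kelvin_grad l w G y))\<^sup>2 = (2 / l\<^sup>2 * ?z)\<^sup>2 * ?s + 2 * (2 / l\<^sup>2 * ?z) * (y \<bullet> (?R *v ?p)) + ?p \<bullet> ?p"
    unfolding power2_norm_eq_inner kelvin_grad_def
    using reflection_inner[OF y, of ?p ?p]
    by (simp add: inner_add_left inner_add_right inner_commute power2_eq_square algebra_simps)
  moreover have "y \<bullet> (?R *v ?p) = - (y \<bullet> ?p)"
    using s by (simp add: reflection_mult_vec inner_diff_right)
  ultimately have ng: "(norm (kelvin_grad l w G y))\<^sup>2 = (2 / l\<^sup>2 * ?z)\<^sup>2 * ?s - 2 * (2 / l\<^sup>2 * ?z) * (y \<bullet> ?p) + (norm ?p)\<^sup>2"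
    by (simp add: power2_norm_eq_inner)
  have "?R ** schouten ?z ?p H ** ?R = ?z *\<^sub>R (?R ** H ** ?R) - ((norm ?p)\<^sup>2 / 2) *\<^sub>R mat 1"
    unfolding matrix_eq
    by (simp add: schouten_def mult_vec_simps matrix_vector_mult_diff_distrib matrix_vector_mult_scaleR
        reflection_involution[OF y] flip: matrix_vector_mul_assoc)
  moreover have "schouten (kelvin l w y) (kelvin_grad l w G y) (kelvin_hess l ?z ?p H y) =
     (kelvin l w y * (2 * ?z / l\<^sup>2 - 2 * (y \<bullet> ?p) / ?s) - (norm (kelvin_grad l w G y))\<^sup>2 / 2) *\<^sub>R mat 1
     + (kelvin l w y * (l\<^sup>2 / ?s)) *\<^sub>R (?R ** H ** ?R)"
    unfolding kelvin_hess_def by (rule schouten_mat_plus)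
  moreover have "kelvin l w y * (l\<^sup>2 / ?s) = ?z" using s l by (simp add: kelvin_def)
  moreover have "kelvin l w y * (2 * ?z / l\<^sup>2 - 2 * (y \<bullet> ?p) / ?s) - (norm (kelvin_grad l w G y))\<^sup>2 / 2 = - ((norm ?p)\<^sup>2 / 2)"
    unfolding ng kelvin_def using s l by (simp add: power2_eq_square divide_simps) (simp add: algebra_simps)
  ultimately show ?thesis by simp
qed

lemma reflection_conj_in_cone:
  fixes U :: "(real^'n::finite^'n) set"
  assumes U_orth: "\<And>Q. orthogonal_matrix Q \<Longrightarrow> (\<lambda>M. matrix_inv Q ** M ** Q) ` U = U"
    and y: "y \<noteq> 0" and M: "M \<in> U"
  shows "reflection y ** M ** reflection y \<in> U"
proof -
  let ?R = "reflection y"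
  have RR: "?R ** ?R = mat 1" by (rule reflection_square[OF y])
  then have "matrix_inv ?R = ?R"
    unfolding matrix_inv_def by (intro some_equality) (auto, metis matrix_mul_assoc matrix_mul_lid)
  moreover have "orthogonal_matrix ?R" using RR by (simp add: orthogonal_matrix transpose_reflection)
  ultimately show ?thesis using U_orth[of ?R] M by force
qed

section \<open>Perturbing a jet by a quadratic polynomial\<close>

lemma norm_add_square_le:
  fixes p q :: "'a::real_inner"
  assumes "v > 0" "g > 0"
  shows "(norm (p + q))\<^sup>2 \<le> (v + g) / v * (norm p)\<^sup>2 + (v + g) / g * (norm q)\<^sup>2"
proof -
  \<comment> \<open>After division by v + g the claim is subadditivity of |p|^2 / v; the defect of
    the undivided inequality is exactly this term.\<close>
  have "0 \<le> (norm (g *\<^sub>R p - v *\<^sub>R q))\<^sup>2 / (v * g)" using assms by simp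
  also have "\<dots> = g / v * (norm p)\<^sup>2 + v / g * (norm q)\<^sup>2 - 2 * (p \<bullet> q)"
    using assms by (simp add: power2_norm_eq_inner inner_diff_left inner_diff_right inner_commute field_simps)
  finally have "2 * (p \<bullet> q) \<le> g / v * (norm p)\<^sup>2 + v / g * (norm q)\<^sup>2" by simp
  moreover have "(norm (p + q))\<^sup>2 = (norm p)\<^sup>2 + (norm q)\<^sup>2 + 2 * (p \<bullet> q)"
    by (simp add: power2_norm_eq_inner inner_add_left inner_add_right inner_commute)
  moreover have "(v + g) / v = 1 + g / v" "(v + g) / g = 1 + v / g" using assms by (simp_all add: field_simps)
  ultimately show ?thesis by (simp add: distrib_right)
qed

text \<open>The left side is twice the factor in the Schouten tensor of the quadratic; like a
  discriminant it does not change with the point of expansion.\<close>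

lemma bubble_discriminant:
  "4 * d * (m + b \<bullet> y + d * (y \<bullet> y)) - (norm (b + (2 * d) *\<^sub>R y))\<^sup>2 = 4 * d * m - b \<bullet> b"
  by (simp add: power2_norm_eq_inner inner_add_left inner_add_right inner_commute algebra_simps)

text \<open>Superadditivity of \<open>schouten z p P / z\<close> in the 2-jet \<open>(z, p, P)\<close>: adding a quadratic polynomial whose
  Schouten tensor is a positive multiple of the identity moves a 2-jet into the interior of the cone.\<close>

lemma add_bubble_in_cone:
  fixes U :: "(real^'n::finite^'n) set" and y :: "real^'n"
  assumes U_pos: "\<And>M N. M \<in> U \<Longrightarrow> N \<in> pos_def_matrices \<Longrightarrow> M + N \<in> U"
    and U_cone: "\<And>M a. M \<in> U \<Longrightarrow> a > 0 \<Longrightarrow> a *\<^sub>R M \<in> U"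
    and inU: "schouten w p H + B \<in> U" and symB: "transpose B = B"
    and bndB: "\<And>x. \<bar>x \<bullet> (B *v x)\<bar> \<le> r * (norm x)\<^sup>2"
    and pos: "w > 0" "a > 0" "d > 0" and D: "4 * d * m - b \<bullet> b > 0"
  defines "g \<equiv> m + b \<bullet> y + d * (y \<bullet> y)"
  assumes small: "2 * a * g * r < w * (4 * d * m - b \<bullet> b)"
  shows "schouten (a * w + g) (a *\<^sub>R p + (b + (2 * d) *\<^sub>R y)) (a *\<^sub>R H + (2 * d) *\<^sub>R mat 1) \<in> U"
proof -
  define q where "q = b + (2 * d) *\<^sub>R y"
  define D where "D = 4 * d * m - b \<bullet> b"
  have disc: "4 * d * g - (norm q)\<^sup>2 = D" unfolding g_def q_def D_def by (rule bubble_discriminant)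
  have "D > 0" using D by (simp add: D_def)
  then have "4 * d * g > 0" using disc zero_le_power2[of "norm q"] by linarith
  then have g: "g > 0" using pos(3) by (simp add: zero_less_mult_iff)
  define z where "z = a * w + g"
  have z: "z > 0" using pos g by (simp add: z_def add_pos_pos)
  \<comment> \<open>Scaling the tensor of the given jet by \<open>c\<close> makes its Hessian part z
    a H; what is left over is the multiple \<open>\<kappa>\<close> of the identity and the error - c
    B.\<close>
  define c where "c = z * a / w"
  have c: "c > 0" using z pos by (simp add: c_def)
  define \<kappa> where "\<kappa> = 2 * d * z - (norm (a *\<^sub>R p + q))\<^sup>2 / 2 + c * (norm p)\<^sup>2 / 2"
  have "(norm (a *\<^sub>R p + q))\<^sup>2 \<le> (a * w + g) / (a * w) * (norm (a *\<^sub>R p))\<^sup>2 + (a * w + g) / g * (norm q)\<^sup>2"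
    using pos g by (intro norm_add_square_le) auto
  also have "\<dots> = c * (norm p)\<^sup>2 + z / g * (norm q)\<^sup>2"
    using pos by (simp add: z_def[symmetric] c_def power_mult_distrib power2_eq_square)
  finally have "2 * d * z - z / g * (norm q)\<^sup>2 / 2 \<le> \<kappa>" by (simp add: \<kappa>_def)
  moreover have "2 * d * z - z / g * (norm q)\<^sup>2 / 2 = z * D / (2 * g)"
    using g by (simp add: disc[symmetric] field_simps)
  \<comment> \<open>The hypothesis \<open>small\<close> with its denominators restored: the gain z D
    / (2 g) outweighs the error.\<close>
  moreover have "c * r < z * D / (2 * g)"
  proof -
    have "c * r = z * (2 * a * g * r) / (2 * g * w)"
      using pos g by (simp add: c_def)
    also have "\<dots> < z * (w * D) / (2 * g * w)"
      using small z g pos by (intro divide_strict_right_mono mult_strict_left_mono) (auto simp: D_def)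
    finally show ?thesis using pos by simp
  qed
  moreover have "\<bar>x \<bullet> (- (c *\<^sub>R B) *v x)\<bar> \<le> c * r * (norm x)\<^sup>2" for x
  proof -
    have "x \<bullet> (- (c *\<^sub>R B) *v x) = - (c * (x \<bullet> (B *v x)))"
      using matrix_vector_mult_diff_rdistrib[of 0 "c *\<^sub>R B" x] by (simp add: mult_vec_simps)
    then show ?thesis using mult_left_mono[OF bndB[of x], of c] c by (simp add: abs_mult mult.assoc)
  qed
  ultimately have "\<kappa> *\<^sub>R mat 1 + - (c *\<^sub>R B) \<in> pos_def_matrices"
    by (intro mat_add_bounded_pos_def[where r = "c * r"]) (auto simp: transpose_simps symB)
  then have "c *\<^sub>R (schouten w p H + B) + (\<kappa> *\<^sub>R mat 1 + - (c *\<^sub>R B)) \<in> U"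
    using U_pos U_cone inU c by blast
  also have "c *\<^sub>R (schouten w p H + B) + (\<kappa> *\<^sub>R mat 1 + - (c *\<^sub>R B))
    = schouten z (a *\<^sub>R p + q) (a *\<^sub>R H + (2 * d) *\<^sub>R mat 1)"
  proof -
    have "c * w = z * a" using pos by (simp add: c_def)
    then show ?thesis
      by (simp add: schouten_def \<kappa>_def scaleR_add_right scaleR_diff_right scaleR_add_left scaleR_left_diff_distrib mult_ac)
  qed
  finally show ?thesis by (simp add: z_def q_def)
qed

lemma subjet_transfer:
  assumes "subjet f x p P" "f x = g x" "\<forall>\<^sub>F y in nhds x. f y \<le> g y"
  shows "subjet g x p P"
  using assms(1) unfolding subjet_def assms(2)
  by (auto intro: eventually_elim2[OF _ assms(3)])

lemma continuous_on_inversion: "continuous_on (- {0}) (inversion l)"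
  unfolding inversion_def by (intro continuous_intros) auto

lemma continuous_on_kelvin:
  assumes "continuous_on UNIV w" shows "continuous_on (- {0}) (kelvin l w)"
  unfolding kelvin_def inversion_def
  by (cases "l = 0") (auto intro!: continuous_intros continuous_on_compose2[OF assms])

lemma twice_diff_add_bubble:
  assumes "twice_diff f G H x"
  shows "twice_diff (\<lambda>y. a * f y + (m + b \<bullet> y + d * (y \<bullet> y))) (\<lambda>y. a *\<^sub>R G y + (b + (2 * d) *\<^sub>R y))
    (a *\<^sub>R H + (2 * d) *\<^sub>R mat 1) x"
  unfolding twice_diff_def
proof
  have "\<forall>\<^sub>F y in nhds x. (f has_derivative (\<lambda>h. G y \<bullet> h)) (at y)" using assms by (simp add: twice_diff_def)
  then show "\<forall>\<^sub>F y in nhds x. ((\<lambda>y. a * f y + (m + b \<bullet> y + d * (y \<bullet> y))) has_derivative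
     (\<lambda>h. (a *\<^sub>R G y + (b + (2 * d) *\<^sub>R y)) \<bullet> h)) (at y)"
    by eventually_elim (auto intro!: derivative_eq_intros simp: inner_add_left inner_add_right inner_commute algebra_simps)
  have G: "(G has_derivative (\<lambda>h. H *v h)) (at x)" using assms by (simp add: twice_diff_def)
  have "((\<lambda>y. a *\<^sub>R G y + (b + (2 * d) *\<^sub>R y)) has_derivative (\<lambda>h. a *\<^sub>R (H *v h) + (0 + (2 * d) *\<^sub>R h))) (at x)"
    by (intro has_derivative_add has_derivative_scaleR_right has_derivative_const has_derivative_ident G)
  then show "((\<lambda>y. a *\<^sub>R G y + (b + (2 * d) *\<^sub>R y)) has_derivative (*v) (a *\<^sub>R H + (2 * d) *\<^sub>R mat 1)) (at x)"
    by (rule has_derivative_eq_rhs) (simp add: fun_eq_iff mult_vec_simps)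
qed

lemma compact_annulus: "compact {y::real^'n. r0 \<le> norm y \<and> norm y \<le> r1}"
proof -
  have "{y::real^'n. r0 \<le> norm y \<and> norm y \<le> r1} = cball 0 r1 \<inter> {y. r0 \<le> norm y}" by auto
  then show ?thesis by (simp add: compact_Int_closed closed_Collect_le continuous_on_norm_id)
qed

text \<open>Let w' be the Kelvin transform of an approximant. At an interior minimum below the
  boundary values, a w' + m + b . y + d |y|^2 would touch \<open>\<omega>\<close> from below,
  although its tensor lies in \<open>U\<close> by \<open>add_bubble_in_cone\<close>;
  \<open>visc_sub\<close> forbids this. The minimal value m becomes the constant term of the
  quadratic, hence the condition on \<open>\<mu>\<close>.\<close>

lemma annulus_min_principle:
  fixes U :: "(real^'n::finite^'n) set" and b :: "real^'n"
  assumes U_pos: "\<And>M N. M \<in> U \<Longrightarrow> N \<in> pos_def_matrices \<Longrightarrow> M + N \<in> U"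
    and U_cone: "\<And>M a. M \<in> U \<Longrightarrow> a > 0 \<Longrightarrow> a *\<^sub>R M \<in> U"
    and U_orth: "\<And>Q. orthogonal_matrix Q \<Longrightarrow> (\<lambda>M. matrix_inv Q ** M ** Q) ` U = U"
    and sub: "visc_sub U \<omega>" and super: "approx_super U \<omega>"
    and \<omega>: "continuous_on UNIV \<omega>" "\<And>x. \<omega> x > 0"
    and pos: "l > 0" "a > 0" "d > 0" "r0 > 0"
  defines "h \<equiv> \<lambda>y. \<omega> y - a * kelvin l \<omega> y - d * (y \<bullet> y) - b \<bullet> y"
  assumes low: "\<And>y. r0 \<le> norm y \<Longrightarrow> norm y \<le> r1 \<Longrightarrow> \<mu> \<le> h y" and \<mu>: "b \<bullet> b < 4 * d * \<mu>"
    and bdry: "\<And>y. norm y = r0 \<or> norm y = r1 \<Longrightarrow> B \<le> h y"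
    and y: "r0 \<le> norm y" "norm y \<le> r1"
  shows "B \<le> h y"
proof (rule ccontr)
  assume "\<not> B \<le> h y"
  define K where "K = {y::real^'n. r0 \<le> norm y \<and> norm y \<le> r1}"
  have K: "compact K" unfolding K_def by (rule compact_annulus)
  have K0: "K \<subseteq> - {0}" using pos by (auto simp: K_def)
  have yK: "y \<in> K" using y by (simp add: K_def)
  obtain w G H \<beta> where A: "\<forall>(k::nat) x. w k x > 0 \<and> twice_diff (w k) (G k) (H k x) x \<and> transpose (H k x) = H k x \<and>
        transpose (\<beta> k x) = \<beta> k x \<and> schouten (w k x) (G k x) (H k x) + \<beta> k x \<in> U"
    and L: "\<forall>K. compact K \<longrightarrow> uniform_limit K w \<omega> sequentially \<and> uniform_limit K \<beta> (\<lambda>_. 0) sequentially"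
    using super unfolding approx_super_def by (elim exE conjE) (rule that)
  have w: "w k x > 0" "twice_diff (w k) (G k) (H k x) x" "transpose (H k x) = H k x"
    "transpose (\<beta> k x) = \<beta> k x" "schouten (w k x) (G k x) (H k x) + \<beta> k x \<in> U" for k x
    using A by simp_all
  have lim: "uniform_limit K w \<omega> sequentially" "uniform_limit K \<beta> (\<lambda>_. 0) sequentially" if "compact K" for K
    using L that by simp_all
  have kc: "continuous_on K (kelvin l \<omega>)" using continuous_on_kelvin[OF \<omega>(1)] K0 continuous_on_subset by blast
  have \<omega>c: "continuous_on K \<omega>" using \<omega>(1) continuous_on_subset by blast
  have kpos: "kelvin l \<omega> z > 0" if "z \<in> K" for z
    using that K0 pos \<omega>(2) by (intro kelvin_pos) auto
  obtain c0 where c0: "c0 \<in> K" "\<And>z. z \<in> K \<Longrightarrow> kelvin l \<omega> c0 \<le> kelvin l \<omega> z"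
    using continuous_attains_inf[OF K _ kc] yK by blast
  obtain c1 where c1: "c1 \<in> K" "\<And>z. z \<in> K \<Longrightarrow> \<omega> z \<le> \<omega> c1"
    using continuous_attains_sup[OF K _ \<omega>c] yK by blast
  define v0 where "v0 = kelvin l \<omega> c0"
  have v0: "v0 > 0" "\<And>z. z \<in> K \<Longrightarrow> v0 \<le> kelvin l \<omega> z" using c0 kpos by (auto simp: v0_def)
  \<comment> \<open>Three tolerances: the minimum stays off the boundary, the discriminant keeps
    half of its lower bound, and the approximate Kelvin transform stays above v0 / 2.\<close>
  define \<kappa> where "\<kappa> = min ((B - h y) / 3) (min ((4 * d * \<mu> - b \<bullet> b) / (8 * d)) (a * v0 / 2))"
  have \<kappa>: "\<kappa> > 0" "\<kappa> \<le> (B - h y) / 3" "\<kappa> \<le> (4 * d * \<mu> - b \<bullet> b) / (8 * d)" "\<kappa> \<le> a * v0 / 2"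
  proof -
    show "\<kappa> > 0" using \<open>\<not> B \<le> h y\<close> \<mu> pos v0(1) by (simp add: \<kappa>_def)
  qed (unfold \<kappa>_def, rule min.cobounded1, rule min.coboundedI2[OF min.cobounded1],
      rule min.coboundedI2[OF min.cobounded2])
  define D where "D = (4 * d * \<mu> - b \<bullet> b) / 2"
  have D: "D > 0" using \<mu> by (simp add: D_def)
  \<comment> \<open>Makes the error 2 a \<open>\<omega> c1\<close> r equal to v0 D / 4, below the
    available gain v0 D / 2.\<close>
  define r where "r = v0 * D / (8 * a * \<omega> c1)"
  have r: "r > 0" using v0 D pos \<omega>(2) by (simp add: r_def)
  define M where "M = r1\<^sup>2 / l\<^sup>2 + 1"
  have M: "M > 0" by (simp add: M_def add_nonneg_pos)
  \<comment> \<open>The approximants are evaluated at inverted points, so uniform convergence is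
    taken on the image of the annulus.\<close>
  have JK: "compact (inversion l ` K)"
    by (intro compact_continuous_image continuous_on_subset[OF continuous_on_inversion K0] K)
  have "\<forall>\<^sub>F k in sequentially. (\<forall>z\<in>inversion l ` K. dist (w k z) (\<omega> z) < \<kappa> / (a * M)) \<and> (\<forall>z\<in>inversion l ` K. dist (\<beta> k z) 0 < r)"
    using pos \<kappa>(1) M by (intro eventually_conj uniform_limitD[OF lim(1)[OF JK]] uniform_limitD[OF lim(2)[OF JK] r]) simp
  then obtain k where "(\<forall>z\<in>inversion l ` K. dist (w k z) (\<omega> z) < \<kappa> / (a * M)) \<and> (\<forall>z\<in>inversion l ` K. dist (\<beta> k z) 0 < r)"
    using eventually_happens'[OF sequentially_bot] by blast
  then have k: "\<And>z. z \<in> K \<Longrightarrow> \<bar>w k (inversion l z) - \<omega> (inversion l z)\<bar> < \<kappa> / (a * M)"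
    "\<And>z. z \<in> K \<Longrightarrow> norm (\<beta> k (inversion l z)) < r"
    by (auto simp: dist_real_def)
  let ?w = "kelvin l (w k)"
  have close: "\<bar>a * ?w z - a * kelvin l \<omega> z\<bar> < \<kappa>" if z: "z \<in> K" for z
  proof -
    have zz: "(z \<bullet> z) / l\<^sup>2 \<le> M" "(z \<bullet> z) / l\<^sup>2 \<ge> 0"
    proof -
      have "z \<bullet> z \<le> r1\<^sup>2" using z power_mono[of "norm z" r1 2] by (simp add: K_def power2_norm_eq_inner)
      then have "(z \<bullet> z) / l\<^sup>2 \<le> r1\<^sup>2 / l\<^sup>2" by (rule divide_right_mono) simp
      then show "(z \<bullet> z) / l\<^sup>2 \<le> M" by (simp add: M_def)
    qed simp
    have "a * ?w z - a * kelvin l \<omega> z = a * ((z \<bullet> z) / l\<^sup>2) * (w k (inversion l z) - \<omega> (inversion l z))"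
      unfolding kelvin_def by (simp only: right_diff_distrib mult.assoc)
    then have "\<bar>a * ?w z - a * kelvin l \<omega> z\<bar> = a * ((z \<bullet> z) / l\<^sup>2) * \<bar>w k (inversion l z) - \<omega> (inversion l z)\<bar>"
      using zz pos by (simp only: abs_mult abs_of_nonneg abs_of_pos)
    also have "\<dots> \<le> a * M * \<bar>w k (inversion l z) - \<omega> (inversion l z)\<bar>"
      using zz pos by (intro mult_right_mono mult_left_mono) auto
    also have "\<dots> < a * M * (\<kappa> / (a * M))" using k(1)[OF z] pos M by (intro mult_strict_left_mono) auto
    also have "\<dots> = \<kappa>" using pos M by simp
    finally show ?thesis .
  qed
  define hk where "hk = (\<lambda>y. \<omega> y - a * ?w y - d * (y \<bullet> y) - b \<bullet> y)"
  have hk: "\<bar>hk z - h z\<bar> < \<kappa>" if "z \<in> K" for z using close[OF that] by (simp add: hk_def h_def abs_minus_commute)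
  have wkc: "continuous_on UNIV (w k)" by (rule twice_diff_continuous_on[OF w(2)])
  have "continuous_on K ?w" using continuous_on_kelvin[OF wkc] K0 continuous_on_subset by blast
  then have "continuous_on K hk" unfolding hk_def by (intro continuous_intros \<omega>c)
  then obtain c where c: "c \<in> K" "\<And>z. z \<in> K \<Longrightarrow> hk c \<le> hk z"
    using continuous_attains_inf[OF K] yK by blast
  have cB: "hk c < B - \<kappa>"
  proof -
    have "3 * \<kappa> \<le> B - h y" using \<kappa>(2) by simp
    moreover have "hk y < h y + \<kappa>" using hk[OF yK] by (simp add: abs_less_iff)
    ultimately show ?thesis using c(2)[OF yK] \<kappa>(1) by simp
  qed
  have "norm c \<noteq> r0 \<and> norm c \<noteq> r1" using cB hk[OF c(1)] bdry[of c] by linarith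
  then have "c \<in> {y. r0 < norm y \<and> norm y < r1}" using c(1) by (auto simp: K_def)
  moreover have "open {y::real^'n. r0 < norm y \<and> norm y < r1}"
    by (intro open_Collect_conj open_Collect_less continuous_intros)
  ultimately have evK: "\<forall>\<^sub>F z in nhds c. z \<in> {y. r0 < norm y \<and> norm y < r1}" by (rule eventually_nhds_in_open[rotated])
  define m where "m = hk c"
  have m: "\<mu> - \<kappa> \<le> m" using low[of c] hk[OF c(1)] c(1) by (simp add: m_def K_def)
  have Dm: "D \<le> 4 * d * m - b \<bullet> b"
  proof -
    have "4 * d * \<kappa> \<le> (4 * d * \<mu> - b \<bullet> b) / 2" using \<kappa>(3) pos by (simp add: field_simps)
    moreover have "4 * d * (\<mu> - \<kappa>) \<le> 4 * d * m" using m pos by (intro mult_left_mono) auto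
    ultimately show ?thesis by (simp add: D_def right_diff_distrib)
  qed
  have c0': "c \<noteq> 0" using c(1) K0 by auto
  let ?x = "inversion l c"
  let ?p = "kelvin_grad l (w k) (G k) c" and ?P = "kelvin_hess l (w k ?x) (G k ?x) (H k ?x) c"
  let ?\<phi> = "\<lambda>y. a * ?w y + (m + b \<bullet> y + d * (y \<bullet> y))"
  have td: "twice_diff ?w (kelvin_grad l (w k) (G k)) ?P c"
    using kelvin_twice_diff[OF w(2) c0'] pos(1) by simp
  have symP: "transpose ?P = ?P"
    by (simp add: kelvin_hess_def transpose_simps matrix_transpose_mul transpose_reflection w(3) matrix_mul_assoc)
  have symP': "transpose (a *\<^sub>R ?P + (2 * d) *\<^sub>R mat 1) = a *\<^sub>R ?P + (2 * d) *\<^sub>R mat 1"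
    by (simp add: transpose_simps symP)
  have eqc: "?\<phi> c = \<omega> c" by (simp add: m_def hk_def)
  have "subjet ?\<phi> c (a *\<^sub>R ?p + (b + (2 * d) *\<^sub>R c)) (a *\<^sub>R ?P + (2 * d) *\<^sub>R mat 1)"
    by (rule twice_diff_imp_subjet[OF twice_diff_add_bubble[OF td] symP'])
  then have "subjet \<omega> c (a *\<^sub>R ?p + (b + (2 * d) *\<^sub>R c)) (a *\<^sub>R ?P + (2 * d) *\<^sub>R mat 1)"
  proof (rule subjet_transfer)
    show "?\<phi> c = \<omega> c" by (rule eqc)
    show "\<forall>\<^sub>F z in nhds c. ?\<phi> z \<le> \<omega> z"
      using evK
    proof eventually_elim
      case (elim z)
      then have "hk c \<le> hk z" using c(2)[of z] by (simp add: K_def)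
      then show ?case by (simp add: m_def hk_def)
    qed
  qed
  then have notU: "schouten (\<omega> c) (a *\<^sub>R ?p + (b + (2 * d) *\<^sub>R c)) (a *\<^sub>R ?P + (2 * d) *\<^sub>R mat 1) \<notin> U"
    using sub symP' unfolding visc_sub_def by blast
  let ?R = "reflection c" and ?B = "reflection c ** \<beta> k (inversion l c) ** reflection c"
  have "schouten (?w c) ?p ?P + ?B = ?R ** (schouten (w k ?x) (G k ?x) (H k ?x) + \<beta> k ?x) ** ?R"
    using kelvin_schouten[OF c0', of l "w k" "G k" "H k ?x"] pos(1)
    by (simp add: matrix_add_ldistrib matrix_add_rdistrib)
  then have inU: "schouten (?w c) ?p ?P + ?B \<in> U"
    using reflection_conj_in_cone[OF U_orth c0' w(5)] by simp
  have symB: "transpose ?B = ?B"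
    by (simp add: matrix_transpose_mul transpose_reflection w(4) matrix_mul_assoc)
  have bndB: "\<bar>x \<bullet> (?B *v x)\<bar> \<le> r * (norm x)\<^sup>2" for x
  proof -
    have "x \<bullet> (?B *v x) = (?R *v x) \<bullet> (\<beta> k ?x *v (?R *v x))"
      by (simp add: sym_inner[OF transpose_reflection] flip: matrix_vector_mul_assoc)
    then have "\<bar>x \<bullet> (?B *v x)\<bar> \<le> norm (\<beta> k ?x) * (norm (?R *v x))\<^sup>2" by (simp add: abs_quad_le)
    also have "\<dots> \<le> r * (norm (?R *v x))\<^sup>2" using k(2)[OF c(1)] by (intro mult_right_mono) auto
    finally show ?thesis by (simp add: power2_norm_eq_inner reflection_inner[OF c0'])
  qed
  have wpos: "?w c > 0" using c0' pos w(1) by (intro kelvin_pos) auto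
  have wlow: "?w c \<ge> v0 / 2"
  proof -
    have "a * kelvin l \<omega> c - a * ?w c < \<kappa>" using close[OF c(1)] unfolding abs_less_iff by linarith
    moreover have "a * v0 \<le> a * kelvin l \<omega> c" using v0(2)[OF c(1)] pos by simp
    ultimately have "a * (v0 / 2) \<le> a * ?w c" using \<kappa>(4) by simp
    then show ?thesis using pos by simp
  qed
  have "2 * a * (m + b \<bullet> c + d * (c \<bullet> c)) * r \<le> 2 * a * \<omega> c1 * r"
  proof -
    have "m + b \<bullet> c + d * (c \<bullet> c) \<le> \<omega> c1" using eqc c1(2)[OF c(1)] mult_pos_pos[OF pos(2) wpos] by linarith
    then show ?thesis using pos r by (intro mult_right_mono mult_left_mono) auto
  qed
  also have "\<dots> = v0 / 4 * D" using \<omega>(2)[of c1] pos by (simp add: r_def)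
  also have "\<dots> < v0 / 2 * D" using v0 D by simp
  also have "\<dots> \<le> ?w c * (4 * d * m - b \<bullet> b)"
    using wlow Dm D v0 wpos by (intro mult_mono) auto
  finally have small: "2 * a * (m + b \<bullet> c + d * (c \<bullet> c)) * r < ?w c * (4 * d * m - b \<bullet> b)" .
  have "4 * d * m - b \<bullet> b > 0" using Dm D by linarith
  from add_bubble_in_cone[OF U_pos U_cone inU symB bndB wpos pos(2,3) this small]
  show False using notU eqc by simp
qed

section \<open>Comparison with harmonic functions in exterior domains\<close>

lemma twice_diff_add:
  assumes "twice_diff f1 G1 H1 x" "twice_diff f2 G2 H2 x"
  shows "twice_diff (\<lambda>y. f1 y + f2 y) (\<lambda>y. G1 y + G2 y) (H1 + H2) x"
  unfolding twice_diff_def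
proof
  have "\<forall>\<^sub>F y in nhds x. (f1 has_derivative (\<lambda>h. G1 y \<bullet> h)) (at y)" "\<forall>\<^sub>F y in nhds x. (f2 has_derivative (\<lambda>h. G2 y \<bullet> h)) (at y)"
    using assms by (simp_all add: twice_diff_def)
  then show "\<forall>\<^sub>F y in nhds x. ((\<lambda>y. f1 y + f2 y) has_derivative (\<lambda>h. (G1 y + G2 y) \<bullet> h)) (at y)"
    by eventually_elim (simp add: inner_add_left has_derivative_add)
  show "((\<lambda>y. G1 y + G2 y) has_derivative (*v) (H1 + H2)) (at x)"
    using assms unfolding twice_diff_def matrix_vector_mult_add_rdistrib by (intro has_derivative_add) auto
qed

lemma twice_diff_mult:
  assumes "twice_diff f1 G1 H1 x" "twice_diff f2 G2 H2 x"
  shows "twice_diff (\<lambda>y. f1 y * f2 y) (\<lambda>y. f1 y *\<^sub>R G2 y + f2 y *\<^sub>R G1 y)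
    (f1 x *\<^sub>R H2 + f2 x *\<^sub>R H1 + outer (G1 x) (G2 x) + outer (G2 x) (G1 x)) x"
  unfolding twice_diff_def
proof
  have ev: "\<forall>\<^sub>F y in nhds x. (f1 has_derivative (\<lambda>h. G1 y \<bullet> h)) (at y)" "\<forall>\<^sub>F y in nhds x. (f2 has_derivative (\<lambda>h. G2 y \<bullet> h)) (at y)"
    using assms by (simp_all add: twice_diff_def)
  then show "\<forall>\<^sub>F y in nhds x. ((\<lambda>y. f1 y * f2 y) has_derivative (\<lambda>h. (f1 y *\<^sub>R G2 y + f2 y *\<^sub>R G1 y) \<bullet> h)) (at y)"
  proof eventually_elim
    case (elim y)
    from has_derivative_mult[OF elim] show ?case by (simp add: inner_add_left mult.commute)
  qed
  have "(f1 has_derivative (\<lambda>h. G1 x \<bullet> h)) (at x)" "(f2 has_derivative (\<lambda>h. G2 x \<bullet> h)) (at x)"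
    using ev by (auto dest: eventually_nhds_x_imp_x)
  moreover have "(G1 has_derivative (*v) H1) (at x)" "(G2 has_derivative (*v) H2) (at x)"
    using assms by (simp_all add: twice_diff_def)
  ultimately have "((\<lambda>y. f1 y *\<^sub>R G2 y + f2 y *\<^sub>R G1 y) has_derivative
    (\<lambda>h. (f1 x *\<^sub>R (H2 *v h) + (G1 x \<bullet> h) *\<^sub>R G2 x) + (f2 x *\<^sub>R (H1 *v h) + (G2 x \<bullet> h) *\<^sub>R G1 x))) (at x)"
    by (intro has_derivative_add has_derivative_scaleR)
  then show "((\<lambda>y. f1 y *\<^sub>R G2 y + f2 y *\<^sub>R G1 y) has_derivative
    (*v) (f1 x *\<^sub>R H2 + f2 x *\<^sub>R H1 + outer (G1 x) (G2 x) + outer (G2 x) (G1 x))) (at x)"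
    by (rule has_derivative_eq_rhs) (simp add: fun_eq_iff mult_vec_simps)
qed

lemma twice_diff_affine: "twice_diff (\<lambda>y. c + q \<bullet> y) (\<lambda>_. q) 0 x"
  unfolding twice_diff_def by (auto intro!: derivative_eq_intros always_eventually)

lemma twice_diff_square: "twice_diff (\<lambda>y. y \<bullet> y) (\<lambda>y. 2 *\<^sub>R y) (2 *\<^sub>R mat 1) x"
  unfolding twice_diff_def
  by (auto intro!: derivative_eq_intros always_eventually simp: inner_commute mult_vec_simps)

lemma trace_scaleR: "trace (c *\<^sub>R A) = c * trace (A :: real^'n^'n)"
  by (simp add: trace_def sum_distrib_left)

lemma trace_outer: "trace (outer a b) = a \<bullet> b"
  by (simp add: trace_def outer_def inner_vec_def)

lemma outer_zero: "outer 0 b = 0" "outer b 0 = 0"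
  by (simp_all add: outer_def vec_eq_iff)

lemma trace_mat_1: "trace (mat 1 :: real^'n^'n) = CARD('n)"
  by (simp add: trace_def mat_def)

lemmas trace_simps = trace_add trace_scaleR trace_outer trace_mat_1

text \<open>The trace is the Laplacian of |y|^(2 k). The exponents used below are 1 - n / 2, where
  it vanishes, and - n / 2.\<close>

lemma powr_square_twice_diff:
  fixes z :: "real^'n" and k :: real
  assumes "z \<noteq> 0"
  obtains H where "twice_diff (\<lambda>y. (y \<bullet> y) powr k) (\<lambda>y. (2 * k * (y \<bullet> y) powr (k - 1)) *\<^sub>R y) H z"
    "transpose H = H" "trace H = 2 * k * (z \<bullet> z) powr (k - 1) * (CARD('n) + 2 * k - 2)"
proof -
  have s: "z \<bullet> z > 0" using assms by simp
  have "(z \<bullet> z) powr (k - 2) * (z \<bullet> z) = (z \<bullet> z) powr (k - 2) * (z \<bullet> z) powr 1" using s by simp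
  also have "\<dots> = (z \<bullet> z) powr (k - 1)" unfolding powr_add[symmetric] by simp
  finally have e: "(z \<bullet> z) powr (k - 2) * (z \<bullet> z) = (z \<bullet> z) powr (k - 1)" .
  let ?H = "(k * (z \<bullet> z) powr (k - 1)) *\<^sub>R (2 *\<^sub>R mat 1) + (k * (k - 1) * (z \<bullet> z) powr (k - 2)) *\<^sub>R outer (2 *\<^sub>R z) (2 *\<^sub>R z)"
  show ?thesis
  proof (rule that[of ?H])
    show "twice_diff (\<lambda>y. (y \<bullet> y) powr k) (\<lambda>y. (2 * k * (y \<bullet> y) powr (k - 1)) *\<^sub>R y) ?H z"
      using twice_diff_powr[OF twice_diff_square s, of k] by (simp add: mult_ac)
    show "transpose ?H = ?H" by (simp add: transpose_simps)
    have "trace ?H = 2 * k * (z \<bullet> z) powr (k - 1) * CARD('n) + 4 * k * (k - 1) * ((z \<bullet> z) powr (k - 2) * (z \<bullet> z))"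
      by (simp add: trace_simps)
    then show "trace ?H = 2 * k * (z \<bullet> z) powr (k - 1) * (CARD('n) + 2 * k - 2)"
      unfolding e by (simp add: algebra_simps)
  qed
qed

text \<open>The classical Kelvin transform |z|^(2 - n) (c + q . z / |z|^2) of an affine
  function.\<close>

definition kelvin_affine :: "real \<Rightarrow> real^'n \<Rightarrow> real^'n \<Rightarrow> real" where
  "kelvin_affine c q z = c * (z \<bullet> z) powr (1 - real CARD('n) / 2) + (q \<bullet> z) * (z \<bullet> z) powr (- (real CARD('n) / 2))"

lemma kelvin_affine_harmonic:
  fixes z :: "real^'n"
  assumes "z \<noteq> 0"
  obtains G H where "twice_diff (kelvin_affine c q) G H z" "transpose H = H" "trace H = 0"
proof -
  let ?N = "real CARD('n)"
  obtain H1 where H1: "twice_diff (\<lambda>y. (y \<bullet> y) powr (1 - ?N / 2)) (\<lambda>y. (2 * (1 - ?N / 2) * (y \<bullet> y) powr (1 - ?N / 2 - 1)) *\<^sub>R y) H1 z"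
    "transpose H1 = H1" "trace H1 = 2 * (1 - ?N / 2) * (z \<bullet> z) powr (1 - ?N / 2 - 1) * (?N + 2 * (1 - ?N / 2) - 2)"
    using powr_square_twice_diff[OF assms] by blast
  let ?g = "\<lambda>y::real^'n. (2 * (- (?N / 2)) * (y \<bullet> y) powr (- (?N / 2) - 1)) *\<^sub>R y"
  obtain H2 where H2: "twice_diff (\<lambda>y. (y \<bullet> y) powr (- (?N / 2))) ?g H2 z"
    "transpose H2 = H2" "trace H2 = 2 * (- (?N / 2)) * (z \<bullet> z) powr (- (?N / 2) - 1) * (?N + 2 * (- (?N / 2)) - 2)"
    using powr_square_twice_diff[OF assms] by blast
  have td: "twice_diff (kelvin_affine c q)
     (\<lambda>y. ((c + 0 \<bullet> y) *\<^sub>R ((2 * (1 - ?N / 2) * (y \<bullet> y) powr (1 - ?N / 2 - 1)) *\<^sub>R y) + (y \<bullet> y) powr (1 - ?N / 2) *\<^sub>R 0)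
        + ((0 + q \<bullet> y) *\<^sub>R ?g y + (y \<bullet> y) powr (- (?N / 2)) *\<^sub>R q))
     (c *\<^sub>R H1 + ((q \<bullet> z) *\<^sub>R H2 + outer q (?g z) + outer (?g z) q)) z"
    using twice_diff_add[OF twice_diff_mult[OF twice_diff_affine[of c 0] H1(1)] twice_diff_mult[OF twice_diff_affine[of 0 q] H2(1)]]
    unfolding kelvin_affine_def[abs_def] by (simp add: outer_zero)
  have "trace H1 = 0" unfolding H1(3) by simp
  \<comment> \<open>For k = - n / 2 the Laplacian contributes 2 n (q . z) |z|^(- n - 2), which the
    cross term 2 q . \<open>?g z\<close> cancels.\<close>
  then have "trace (c *\<^sub>R H1 + ((q \<bullet> z) *\<^sub>R H2 + outer q (?g z) + outer (?g z) q)) = 0"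
    by (simp add: trace_simps H2(3) inner_commute)
  moreover have "transpose (c *\<^sub>R H1 + ((q \<bullet> z) *\<^sub>R H2 + outer q (?g z) + outer (?g z) q))
      = c *\<^sub>R H1 + ((q \<bullet> z) *\<^sub>R H2 + outer q (?g z) + outer (?g z) q)"
    by (simp add: transpose_simps H1 H2)
  ultimately show ?thesis using that td by blast
qed

definition visc_superharmonic :: "(real^'n \<Rightarrow> real) \<Rightarrow> bool" where
  "visc_superharmonic u \<longleftrightarrow> (\<forall>x p P. transpose P = P \<longrightarrow> subjet u x p P \<longrightarrow> trace P \<le> 0)"

text \<open>For n \<ge> 3 both powers decay at least like 1 / |z|.\<close>

lemma abs_kelvin_affine_le:
  fixes z :: "real^'n"
  assumes dim: "CARD('n) \<ge> 3" and z: "norm z \<ge> 1"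
  shows "\<bar>kelvin_affine c q z\<bar> \<le> (\<bar>c\<bar> + norm q) / norm z"
proof -
  have zz: "z \<bullet> z = (norm z)\<^sup>2" by (simp add: power2_norm_eq_inner)
  have s: "z \<bullet> z \<ge> 1" using z by (simp add: zz)
  have "(z \<bullet> z) powr (1 - real CARD('n) / 2) \<le> (z \<bullet> z) powr (- (1 / 2))"
    using dim s by (intro powr_mono) auto
  also have "\<dots> = 1 / norm z" using s by (simp add: powr_minus_divide powr_half_sqrt norm_eq_sqrt_inner)
  finally have 1: "(z \<bullet> z) powr (1 - real CARD('n) / 2) \<le> 1 / norm z" .
  have "(z \<bullet> z) powr (- (real CARD('n) / 2)) \<le> (z \<bullet> z) powr (- 1)"
    using dim s by (intro powr_mono) auto
  also have "\<dots> = 1 / (norm z)\<^sup>2" using s by (simp add: powr_minus_divide zz)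
  finally have 2: "(z \<bullet> z) powr (- (real CARD('n) / 2)) \<le> 1 / (norm z)\<^sup>2" .
  have "\<bar>kelvin_affine c q z\<bar> \<le> \<bar>c\<bar> * (z \<bullet> z) powr (1 - real CARD('n) / 2) + \<bar>q \<bullet> z\<bar> * (z \<bullet> z) powr (- (real CARD('n) / 2))"
    unfolding kelvin_affine_def by (rule order_trans[OF abs_triangle_ineq]) (simp add: abs_mult)
  also have "\<dots> \<le> \<bar>c\<bar> * (1 / norm z) + (norm q * norm z) * (1 / (norm z)\<^sup>2)"
    by (intro add_mono mult_mono 1 2 Cauchy_Schwarz_ineq2) auto
  also have "\<dots> = (\<bar>c\<bar> + norm q) / norm z" using z by (simp add: field_simps power2_eq_square)
  finally show ?thesis .
qed

text \<open>Positivity of \<open>u\<close> acts as the boundary condition at infinity, where the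
  harmonic function decays. Lowered by \<open>\<eta>\<close> and increased by
  \<open>\<theta>\<close> |z|^2 it is strictly subharmonic, so no vertical translate of it can touch
  \<open>u\<close> from below inside an annulus.\<close>

lemma exterior_comparison:
  fixes u :: "real^'n \<Rightarrow> real"
  assumes dim: "CARD('n) \<ge> 3" and super: "visc_superharmonic u"
    and u: "continuous_on UNIV u" "\<And>z. u z > 0" and R: "R > 0"
    and bdry: "\<And>z. norm z = R \<Longrightarrow> kelvin_affine c q z \<le> u z" and z1: "norm z1 \<ge> R"
  shows "kelvin_affine c q z1 \<le> u z1"
proof (rule ccontr)
  let ?h = "kelvin_affine c q"
  assume "\<not> ?h z1 \<le> u z1"
  define \<eta> where "\<eta> = (?h z1 - u z1) / 2"
  have \<eta>: "\<eta> > 0" using \<open>\<not> ?h z1 \<le> u z1\<close> by (simp add: \<eta>_def)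
  \<comment> \<open>Large enough that the harmonic function is at most \<eta> / 2 in absolute value
    on the outer sphere.\<close>
  define R' where "R' = norm z1 + 1 + (\<bar>c\<bar> + norm q) * (2 / \<eta>)"
  have cq: "(\<bar>c\<bar> + norm q) * (2 / \<eta>) \<ge> 0" using \<eta> by simp
  have R': "R' \<ge> 1" "norm z1 < R'" "R < R'" using cq z1 by (simp_all add: R'_def add_nonneg_pos)
  \<comment> \<open>The quadratic adds at most \<eta> / 4 up to the outer sphere, so
    \<open>g\<close> is positive on both boundary spheres while g z1 < 0.\<close>
  define \<theta> where "\<theta> = \<eta> / (4 * R'\<^sup>2)"
  have R'2: "R'\<^sup>2 > 0" using R'(1) by simp
  have \<theta>: "\<theta> > 0" using \<eta> R'2 by (simp add: \<theta>_def)
  have \<theta>z: "\<theta> * (z \<bullet> z) \<le> \<eta> / 4" if "norm z \<le> R'" for z :: "real^'n"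
  proof -
    have "\<theta> * (z \<bullet> z) \<le> \<theta> * R'\<^sup>2"
      using \<theta> power_mono[OF that norm_ge_zero, of 2] by (intro mult_left_mono) (auto simp: power2_norm_eq_inner)
    then show ?thesis using R'2 by (simp add: \<theta>_def)
  qed
  have hR': "\<bar>?h z\<bar> \<le> \<eta> / 2" if "norm z = R'" for z
  proof -
    have "\<bar>?h z\<bar> \<le> (\<bar>c\<bar> + norm q) / R'" using abs_kelvin_affine_le[OF dim, of z c q] that R'(1) by simp
    also have "\<dots> \<le> \<eta> / 2"
    proof -
      have "(\<bar>c\<bar> + norm q) * (2 / \<eta>) \<le> R'" by (simp add: R'_def)
      then show ?thesis using \<eta> R'(1) by (simp add: field_simps)
    qed
    finally show ?thesis .
  qed
  let ?\<phi> = "\<lambda>z. ?h z + (- \<eta> + 0 \<bullet> z + \<theta> * (z \<bullet> z))"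
  define g where "g = (\<lambda>z. u z - ?\<phi> z)"
  define K where "K = {z::real^'n. R \<le> norm z \<and> norm z \<le> R'}"
  have K: "compact K" unfolding K_def by (rule compact_annulus)
  have hc: "continuous_on K ?h"
  proof (rule continuous_at_imp_continuous_on, rule ballI)
    fix z assume "z \<in> K"
    then have "z \<noteq> 0" using R by (auto simp: K_def)
    then obtain G H where "twice_diff ?h G H z" using kelvin_affine_harmonic by blast
    then show "isCont ?h z" unfolding twice_diff_def by (blast dest: eventually_nhds_x_imp_x has_derivative_continuous)
  qed
  have "continuous_on K g" unfolding g_def
    by (intro continuous_intros hc continuous_on_subset[OF u(1)]) auto
  moreover have z1K: "z1 \<in> K" using z1 R' by (simp add: K_def)
  ultimately obtain x where x: "x \<in> K" "\<And>z. z \<in> K \<Longrightarrow> g x \<le> g z"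
    using continuous_attains_inf[OF K] by blast
  have "g z1 = - \<eta> - \<theta> * (z1 \<bullet> z1)" by (simp add: g_def \<eta>_def field_simps)
  then have "g z1 < 0" using \<eta> mult_nonneg_nonneg[OF less_imp_le[OF \<theta>] inner_ge_zero[of z1]] by linarith
  then have gx: "g x < 0" using x(2)[OF z1K] by simp
  have "norm x \<noteq> R"
  proof
    assume "norm x = R"
    then have "g x \<ge> \<eta> - \<eta> / 4" using bdry[of x] \<theta>z[of x] R' by (simp add: g_def)
    then show False using gx \<eta> by simp
  qed
  moreover have "norm x \<noteq> R'"
  proof
    assume "norm x = R'"
    then have "g x > - \<eta> / 2 + \<eta> - \<eta> / 4" using hR'[of x] \<theta>z[of x] u(2)[of x] by (simp add: g_def)
    then show False using gx \<eta> by simp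
  qed
  ultimately have "x \<in> {z. R < norm z \<and> norm z < R'}" using x(1) by (auto simp: K_def)
  moreover have "open {z::real^'n. R < norm z \<and> norm z < R'}"
    by (intro open_Collect_conj open_Collect_less continuous_intros)
  ultimately have ev: "\<forall>\<^sub>F z in nhds x. z \<in> {z. R < norm z \<and> norm z < R'}" by (rule eventually_nhds_in_open[rotated])
  have "x \<noteq> 0" using x(1) R by (auto simp: K_def)
  then obtain G H where H: "twice_diff ?h G H x" "transpose H = H" "trace H = 0"
    using kelvin_affine_harmonic by blast
  let ?P = "1 *\<^sub>R H + (2 * \<theta>) *\<^sub>R mat 1"
  have symP: "transpose ?P = ?P" by (simp add: transpose_simps H)
  have "twice_diff (\<lambda>z. 1 * ?h z + ((- \<eta> + g x) + 0 \<bullet> z + \<theta> * (z \<bullet> z)))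
      (\<lambda>z. 1 *\<^sub>R G z + (0 + (2 * \<theta>) *\<^sub>R z)) ?P x"
    by (rule twice_diff_add_bubble[OF H(1)])
  from twice_diff_imp_subjet[OF this symP]
  have "subjet u x (1 *\<^sub>R G x + (0 + (2 * \<theta>) *\<^sub>R x)) ?P"
  proof (rule subjet_transfer)
    show "1 * ?h x + ((- \<eta> + g x) + 0 \<bullet> x + \<theta> * (x \<bullet> x)) = u x" by (simp add: g_def)
    show "\<forall>\<^sub>F z in nhds x. 1 * ?h z + ((- \<eta> + g x) + 0 \<bullet> z + \<theta> * (z \<bullet> z)) \<le> u z"
      using ev
    proof eventually_elim
      case (elim z)
      then have "g x \<le> g z" using x(2)[of z] by (simp add: K_def)
      then show ?case by (simp add: g_def)
    qed
  qed
  then have "trace ?P \<le> 0" using super symP unfolding visc_superharmonic_def by blast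
  then show False using \<theta> dim by (simp add: trace_simps H(3) mult_le_0_iff)
qed

lemma inversion_nonzero: "y \<noteq> 0 \<Longrightarrow> l \<noteq> 0 \<Longrightarrow> inversion l y \<noteq> 0"
  by (simp add: inversion_def)

lemma inversion_inner: "y \<noteq> 0 \<Longrightarrow> inversion l y \<bullet> inversion l y = (l\<^sup>2)\<^sup>2 / (y \<bullet> y)"
  by (simp add: inversion_def power2_eq_square)

lemma inversion_inversion: "y \<noteq> 0 \<Longrightarrow> l \<noteq> 0 \<Longrightarrow> inversion l (inversion l y) = y"
  unfolding inversion_def[of l "inversion l y"]
  by (simp add: inversion_inner) (simp add: inversion_def power2_eq_square power4_eq_xxxx)

lemma norm_inversion: "norm (inversion l y) = l\<^sup>2 / norm y"
  by (cases "y = 0") (simp_all add: inversion_def power2_norm_eq_inner[symmetric] power2_eq_square)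

text \<open>Used with L = l^(n - 2) alongside \<open>kelvin_powr\<close>: both sides of a comparison
  at the inverted point then carry the same positive factor, and dividing by it leaves a + p . y
  against a power of the Kelvin transform.\<close>

lemma kelvin_affine_inversion:
  fixes y :: "real^'n"
  assumes y: "y \<noteq> 0" and l: "l \<noteq> 0"
  shows "kelvin_affine (L * a) ((L * l\<^sup>2) *\<^sub>R p) (inversion l y)
     = L * (a + p \<bullet> y) * (inversion l y \<bullet> inversion l y) powr (- ((real CARD('n) - 2) / 2))"
proof -
  let ?z = "inversion l y" and ?\<kappa> = "(real CARD('n) - 2) / 2"
  have s: "?z \<bullet> ?z > 0" using inversion_nonzero[OF y l] by simp
  have "(?z \<bullet> ?z) powr (- (real CARD('n) / 2)) = (?z \<bullet> ?z) powr (- ?\<kappa> + - 1)"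
    by (simp add: field_simps)
  also have "\<dots> = (?z \<bullet> ?z) powr (- ?\<kappa>) / (?z \<bullet> ?z)"
    unfolding powr_add using s by (simp add: powr_minus_divide)
  finally have e: "(?z \<bullet> ?z) powr (- (real CARD('n) / 2)) = (?z \<bullet> ?z) powr (- ?\<kappa>) / (?z \<bullet> ?z)" .
  have e': "1 - real CARD('n) / 2 = - ?\<kappa>" by (simp add: field_simps)
  have "(p \<bullet> ?z) / (?z \<bullet> ?z) = (p \<bullet> y) / l\<^sup>2"
    using y l by (simp add: inversion_inner) (simp add: inversion_def power2_eq_square power4_eq_xxxx)
  then have pz: "l\<^sup>2 * ((p \<bullet> ?z) / (?z \<bullet> ?z)) = p \<bullet> y" using l by simp
  have "kelvin_affine (L * a) ((L * l\<^sup>2) *\<^sub>R p) ?z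
    = L * (a + l\<^sup>2 * ((p \<bullet> ?z) / (?z \<bullet> ?z))) * (?z \<bullet> ?z) powr (- ?\<kappa>)"
    unfolding kelvin_affine_def e e' by (simp add: algebra_simps)
  then show ?thesis unfolding pz .
qed

lemma kelvin_powr:
  fixes y :: "real^'n"
  assumes y: "y \<noteq> 0" and l: "l \<noteq> 0" and \<omega>: "\<omega> (inversion l y) > 0"
  shows "\<omega> (inversion l y) powr (- k) = (l\<^sup>2) powr k * kelvin l \<omega> y powr (- k) * (inversion l y \<bullet> inversion l y) powr (- k)"
proof -
  let ?z = "inversion l y"
  have s: "?z \<bullet> ?z > 0" using inversion_nonzero[OF y l] by simp
  have k: "kelvin l \<omega> y > 0" using kelvin_pos[of y l \<omega>] y l \<omega> by simp
  have "\<omega> ?z = kelvin l \<omega> y * (?z \<bullet> ?z) / l\<^sup>2"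
    using y l by (simp add: inversion_inner kelvin_def power2_eq_square)
  then have "\<omega> ?z powr (- k) = (kelvin l \<omega> y * (?z \<bullet> ?z) / l\<^sup>2) powr (- k)" by simp
  also have "\<dots> = kelvin l \<omega> y powr (- k) * (?z \<bullet> ?z) powr (- k) / (l\<^sup>2) powr (- k)"
    using k s l by (simp add: powr_mult powr_divide)
  also have "\<dots> = (l\<^sup>2) powr k * kelvin l \<omega> y powr (- k) * (?z \<bullet> ?z) powr (- k)"
    using l by (simp add: powr_minus divide_inverse)
  finally show ?thesis .
qed

text \<open>Inversion maps the punctured ball of radius r to the exterior of the ball of radius l^2
  / r and sends the puncture to infinity, where \<open>exterior_comparison\<close> asks only for
  positivity.\<close>

lemma kelvin_affine_comparison:
  fixes \<omega> :: "real^'n \<Rightarrow> real"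
  assumes dim: "CARD('n) \<ge> 3"
    and super: "visc_superharmonic (\<lambda>x. \<omega> x powr (- ((real CARD('n) - 2) / 2)))"
    and \<omega>: "continuous_on UNIV \<omega>" "\<And>x. \<omega> x > 0" and l: "l > 0" and r: "r > 0"
    and bdry: "\<And>y. norm y = r \<Longrightarrow> a + p \<bullet> y \<le> kelvin l \<omega> y powr (- ((real CARD('n) - 2) / 2))"
    and y: "y \<noteq> 0" "norm y \<le> r"
  shows "a + p \<bullet> y \<le> kelvin l \<omega> y powr (- ((real CARD('n) - 2) / 2))"
proof -
  define k where "k = (real CARD('n) - 2) / 2"
  define L where "L = (l\<^sup>2) powr k"
  have L: "L > 0" using l by (simp add: L_def)
  have l0: "l \<noteq> 0" using l by simp
  let ?h = "kelvin_affine (L * a) ((L * l\<^sup>2) *\<^sub>R p)"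
  have iff: "?h (inversion l y) \<le> \<omega> (inversion l y) powr (- k) \<longleftrightarrow> a + p \<bullet> y \<le> kelvin l \<omega> y powr (- k)"
    if "y \<noteq> 0" for y
  proof -
    have "(inversion l y \<bullet> inversion l y) powr (- k) > 0" using inversion_nonzero[OF that l0] by simp
    then show ?thesis
      unfolding kelvin_powr[where \<omega> = \<omega> and k = k, OF that l0 \<omega>(2)] kelvin_affine_inversion[OF that l0, folded k_def] L_def[symmetric]
      using L by simp
  qed
  have "?h (inversion l y) \<le> \<omega> (inversion l y) powr (- k)"
  proof (rule exterior_comparison[OF dim super[folded k_def]])
    have "\<omega> x \<noteq> 0" for x using \<omega>(2)[of x] by simp
    then show "continuous_on UNIV (\<lambda>x. \<omega> x powr (- k))" by (intro continuous_intros \<omega>(1)) simp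
    show "l\<^sup>2 / r > 0" using l r by simp
    show "l\<^sup>2 / r \<le> norm (inversion l y)" using y l r by (simp add: norm_inversion frac_le)
    fix z :: "real^'n" assume z: "norm z = l\<^sup>2 / r"
    then have z0: "z \<noteq> 0" using l r by auto
    have "norm (inversion l z) = r" using z l r by (simp add: norm_inversion)
    from iff[OF inversion_nonzero[OF z0 l0]] bdry[OF this] inversion_inversion[OF z0 l0]
    show "?h z \<le> \<omega> z powr (- k)" by (simp add: k_def)
  qed (simp_all add: less_imp_neq[OF \<omega>(2), symmetric])
  then show ?thesis using iff[OF y(1)] by (simp add: k_def)
qed

section \<open>Comparison of a solution with its inverted copies\<close>

text \<open>A negative power is convex, so it lies above its tangents. This supplies the affine
  minorant for boundary values in the gap argument.\<close>

lemma powr_tangent: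
  fixes c x k :: real
  assumes c: "c > 0" and x: "c + x > 0" and k: "k > 0"
  shows "c powr (- k) - k * c powr (- k - 1) * x \<le> (c + x) powr (- k)"
proof -
  have "convex_on {0<..} (\<lambda>t::real. t powr (- k))"
  proof (rule f''_ge0_imp_convex)
    fix t :: real assume t: "t \<in> {0<..}"
    show "((\<lambda>t. t powr (- k)) has_real_derivative - k * t powr (- k - 1)) (at t)"
      using t by (auto intro!: derivative_eq_intros)
    show "((\<lambda>t. - k * t powr (- k - 1)) has_real_derivative - k * ((- k - 1) * t powr (- k - 1 - 1))) (at t)"
      using t by (auto intro!: derivative_eq_intros)
    show "0 \<le> - k * ((- k - 1) * t powr (- k - 1 - 1))"
    proof -
      have "- k * ((- k - 1) * t powr (- k - 1 - 1)) = (k * (k + 1)) * t powr (- k - 1 - 1)" by (simp add: algebra_simps)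
      then show ?thesis using k by simp
    qed
  qed simp
  moreover have "((\<lambda>t. t powr (- k)) has_real_derivative - k * c powr (- k - 1)) (at c within {0<..})"
    using c by (auto intro!: derivative_eq_intros)
  ultimately have "(- k * c powr (- k - 1)) * (c + x - c) \<le> (c + x) powr (- k) - c powr (- k)"
    using c x by (intro convex_on_imp_above_tangent[where A = "{0<..}"]) (auto simp: interior_open)
  then show ?thesis by (simp add: algebra_simps)
qed

lemma powr_neg_le_iff:
  fixes x A k :: real
  assumes "x > 0" "A > 0" "k > 0"
  shows "A \<le> x powr (- k) \<longleftrightarrow> x \<le> A powr (- (1 / k))"
proof -
  have x: "x = (x powr (- k)) powr (- (1 / k))" using assms by (simp add: powr_powr)
  have A: "A = (A powr (- (1 / k))) powr (- k)" using assms by (simp add: powr_powr)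
  show ?thesis
  proof
    assume "A \<le> x powr (- k)"
    then have "(x powr (- k)) powr (- (1 / k)) \<le> A powr (- (1 / k))"
      using assms by (intro powr_mono2') auto
    then show "x \<le> A powr (- (1 / k))" using x by simp
  next
    assume "x \<le> A powr (- (1 / k))"
    then have "(A powr (- (1 / k))) powr (- k) \<le> x powr (- k)"
      using assms by (intro powr_mono2') auto
    then show "A \<le> x powr (- k)" using A by simp
  qed
qed

lemma kelvin_sphere: "l > 0 \<Longrightarrow> norm y = l \<Longrightarrow> kelvin l w y = w y"
proof -
  assume "l > 0" "norm y = l"
  then have "y \<bullet> y = l\<^sup>2" by (metis power2_norm_eq_inner)
  then show ?thesis using \<open>l > 0\<close> by (simp add: kelvin_def inversion_def)
qed

text \<open>On a small sphere of radius \<open>\<rho>\<close> the hypothesis and the Taylor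
  expansion bound (1 - \<tau>) a \<omega>' by C + p . y - e \<rho> / 2. The tangent of t^(-k) at C
  turns this into an affine lower bound for the power -k on the sphere, which
  \<open>kelvin_affine_comparison\<close> carries to the puncture. There it exceeds C^(-k) by a
  fixed amount, and undoing the power keeps a \<omega>' below a constant smaller than
  \<open>\<omega> 0\<close>.\<close>

lemma kelvin_strict_gap_near_0:
  fixes \<omega> :: "real^'n \<Rightarrow> real"
  assumes dim: "CARD('n) \<ge> 3"
    and super: "visc_superharmonic (\<lambda>x. \<omega> x powr (- ((real CARD('n) - 2) / 2)))"
    and \<omega>: "continuous_on UNIV \<omega>" "\<And>x. \<omega> x > 0" and diff: "\<omega> differentiable (at 0)"
    and l: "l > 0" and a: "a > 0" and \<tau>: "0 < \<tau>" "\<tau> < 1" and e: "e > 0"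
    and below: "\<And>y. y \<noteq> 0 \<Longrightarrow> norm y \<le> l \<Longrightarrow> (1 - \<tau>) * a * kelvin l \<omega> y \<le> \<omega> y - \<tau> * \<omega> 0 - e * norm y"
  obtains \<kappa> r where "\<kappa> > 0" "r > 0" "r \<le> l" "\<And>y. y \<noteq> 0 \<Longrightarrow> norm y \<le> r \<Longrightarrow> \<kappa> \<le> \<omega> y - a * kelvin l \<omega> y"
proof -
  define k where "k = (real CARD('n) - 2) / 2"
  have k: "k > 0" using dim by (simp add: k_def)
  define m where "m = (1 - \<tau>) * a"
  have m: "m > 0" using a \<tau> by (simp add: m_def)
  define C where "C = (1 - \<tau>) * \<omega> 0"
  have C: "C > 0" using \<omega>(2) \<tau> by (simp add: C_def)
  obtain p where "(\<omega> has_derivative (\<lambda>h. p \<bullet> h)) (at 0)"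
    using has_derivative_gradient[OF diff] by blast
  then obtain d where "d > 0" "\<forall>y. norm (y - 0) < d \<longrightarrow> norm (\<omega> y - \<omega> 0 - p \<bullet> (y - 0)) \<le> e / 2 * norm (y - 0)"
    using half_gt_zero[OF e] unfolding has_derivative_at_alt by blast
  then have d: "d > 0" "\<And>y. norm y < d \<Longrightarrow> \<bar>\<omega> y - \<omega> 0 - p \<bullet> y\<bar> \<le> e / 2 * norm y"
    by simp_all
  define \<rho> where "\<rho> = min (d / 2) l"
  have \<rho>: "\<rho> > 0" "\<rho> < d" "\<rho> \<le> l" using d l by (auto simp: \<rho>_def)
  have kpos: "kelvin l \<omega> y > 0" if "y \<noteq> 0" for y using kelvin_pos[of y l \<omega>] that l \<omega>(2) by simp
  define D where "D = k * C powr (- k - 1)"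
  have D: "D > 0" using k C by (simp add: D_def)
  have scale: "kelvin l \<omega> y powr (- k) = m powr k * (m * kelvin l \<omega> y) powr (- k)" if "y \<noteq> 0" for y
    using m kpos[OF that] by (simp add: powr_mult powr_minus)
  have cmp: "m powr k * (C powr (- k) + D * (e / 2 * \<rho>)) + (- (m powr k * D) *\<^sub>R p) \<bullet> y \<le> kelvin l \<omega> y powr (- k)"
    if y: "y \<noteq> 0" "norm y \<le> \<rho>" for y
    unfolding k_def
  proof (rule kelvin_affine_comparison[OF dim super \<omega> l \<rho>(1) _ y], fold k_def)
    fix y :: "real^'n" assume y: "norm y = \<rho>"
    then have y0: "y \<noteq> 0" using \<rho> by auto
    let ?x = "p \<bullet> y - e / 2 * \<rho>"
    have "m * kelvin l \<omega> y \<le> \<omega> y - \<tau> * \<omega> 0 - e * \<rho>" using below[OF y0] y \<rho> by (simp add: m_def)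
    also have "\<dots> \<le> \<omega> 0 + p \<bullet> y + e / 2 * \<rho> - \<tau> * \<omega> 0 - e * \<rho>" using d(2)[of y] y \<rho>(2) unfolding abs_le_iff by (simp add: field_simps)
    also have "\<dots> = C + ?x" by (simp add: C_def algebra_simps)
    finally have le: "m * kelvin l \<omega> y \<le> C + ?x" .
    have mk: "m * kelvin l \<omega> y > 0" using m kpos[OF y0] by simp
    have "C powr (- k) - D * ?x \<le> (C + ?x) powr (- k)"
      unfolding D_def using le mk by (intro powr_tangent C k) linarith
    also have "\<dots> \<le> (m * kelvin l \<omega> y) powr (- k)" using le mk k by (intro powr_mono2') auto
    finally have "m powr k * (C powr (- k) - D * ?x) \<le> kelvin l \<omega> y powr (- k)"
      unfolding scale[OF y0] using m by (intro mult_left_mono) auto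
    then show "m powr k * (C powr (- k) + D * (e / 2 * \<rho>)) + (- (m powr k * D) *\<^sub>R p) \<bullet> y \<le> kelvin l \<omega> y powr (- k)"
      by (simp add: algebra_simps)
  qed
  \<comment> \<open>Half of the gain D e \<rho> / 2 is kept; the other half absorbs the linear term
    for |y| \<le> t.\<close>
  define E where "E = C powr (- k) + D * (e / 4 * \<rho>)"
  have E: "E > C powr (- k)" "E > 0" using D e \<rho> C by (simp_all add: E_def add_pos_pos)
  define C' where "C' = E powr (- (1 / k))"
  have C': "C' < C"
  proof -
    have "C' < (C powr (- k)) powr (- (1 / k))"
      unfolding C'_def using E C k by (intro powr_less_mono2_neg) auto
    also have "\<dots> = C" using C k by (simp add: powr_powr)
    finally show ?thesis .
  qed
  \<comment> \<open>Half of the gap between \<open>\<omega> 0\<close> and the bound C' / (1 -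
    \<tau>); the other half is left for the variation of \<open>\<omega>\<close> near the
    centre.\<close>
  define \<kappa> where "\<kappa> = (\<omega> 0 - C' / (1 - \<tau>)) / 2"
  have \<kappa>: "\<kappa> > 0" using C' \<tau> by (simp add: \<kappa>_def C_def field_simps)
  have "isCont \<omega> 0" using \<omega>(1) by (simp add: continuous_on_eq_continuous_at)
  then have "\<forall>\<^sub>F y in nhds 0. dist (\<omega> y) (\<omega> 0) < \<kappa>"
    using \<kappa> tendsto_at_iff_tendsto_nhds[of \<omega> 0] unfolding isCont_def by (blast intro: tendstoD)
  then obtain s where s: "s > 0" "\<And>y. norm y < s \<Longrightarrow> \<bar>\<omega> y - \<omega> 0\<bar> < \<kappa>"
    by (auto simp: eventually_nhds_metric dist_real_def)
  define t where "t = e / 4 * \<rho> / (norm p + 1)"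
  have np: "norm p + 1 > 0" by (simp add: add_nonneg_pos)
  have t: "t > 0" using e \<rho> np by (simp add: t_def)
  define r where "r = min \<rho> (min (s / 2) t)"
  have r: "r > 0" "r \<le> \<rho>" "r < s" "r \<le> t" using \<rho> s t by (auto simp: r_def)
  show ?thesis
  proof (rule that[OF \<kappa> r(1)])
    show "r \<le> l" using r \<rho> by simp
    fix y :: "real^'n" assume y: "y \<noteq> 0" "norm y \<le> r"
    have "p \<bullet> y \<le> norm p * norm y" by (rule norm_cauchy_schwarz)
    also have "\<dots> \<le> (norm p + 1) * t" using y r by (intro mult_mono) auto
    also have "\<dots> = e / 4 * \<rho>"
      using iffD1[OF nonzero_eq_divide_eq t_def] np by (simp only: mult.commute[of _ t])
    finally have "D * (p \<bullet> y) \<le> D * (e / 4 * \<rho>)" using D by (intro mult_left_mono) auto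
    moreover have "D * (e / 2 * \<rho>) = D * (e / 4 * \<rho>) + D * (e / 4 * \<rho>)" by (simp add: algebra_simps)
    ultimately have "E \<le> C powr (- k) + D * (e / 2 * \<rho>) - D * (p \<bullet> y)" unfolding E_def by linarith
    then have "m powr k * E \<le> m powr k * (C powr (- k) + D * (e / 2 * \<rho>) - D * (p \<bullet> y))"
      using m by (intro mult_left_mono) auto
    also have "\<dots> \<le> kelvin l \<omega> y powr (- k)" using cmp[OF y(1)] y r by (simp add: algebra_simps)
    finally have "E \<le> (m * kelvin l \<omega> y) powr (- k)" unfolding scale[OF y(1)] using m by simp
    then have "m * kelvin l \<omega> y \<le> C'"
      using powr_neg_le_iff[of "m * kelvin l \<omega> y" E k] m kpos[OF y(1)] E(2) k by (simp add: C'_def)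
    then have "a * kelvin l \<omega> y \<le> C' / (1 - \<tau>)" using \<tau> by (simp add: m_def field_simps)
    moreover have "\<omega> y > \<omega> 0 - \<kappa>" using s(2)[of y] y r unfolding abs_less_iff by linarith
    ultimately show "\<kappa> \<le> \<omega> y - a * kelvin l \<omega> y" by (simp add: \<kappa>_def field_simps)
  qed
qed

lemma kelvin_le:
  fixes U :: "(real^'n::finite^'n) set" and \<omega> :: "real^'n \<Rightarrow> real"
  assumes dim: "CARD('n) \<ge> 3"
    and U_pos: "\<And>M N. M \<in> U \<Longrightarrow> N \<in> pos_def_matrices \<Longrightarrow> M + N \<in> U"
    and U_cone: "\<And>M a. M \<in> U \<Longrightarrow> a > 0 \<Longrightarrow> a *\<^sub>R M \<in> U"
    and U_orth: "\<And>Q. orthogonal_matrix Q \<Longrightarrow> (\<lambda>M. matrix_inv Q ** M ** Q) ` U = U"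
    and sub: "visc_sub U \<omega>" and approx: "approx_super U \<omega>"
    and super: "visc_superharmonic (\<lambda>x. \<omega> x powr (- ((real CARD('n) - 2) / 2)))"
    and \<omega>: "continuous_on UNIV \<omega>" "\<And>x. \<omega> x > 0" and diff: "\<omega> differentiable (at 0)"
    and l: "l > 0" and y: "y \<noteq> 0" "norm y \<le> l"
  shows "kelvin l \<omega> y \<le> \<omega> y"
proof (rule ccontr)
  assume not_le: "\<not> kelvin l \<omega> y \<le> \<omega> y"
  define k where "k = (real CARD('n) - 2) / 2"
  have k: "k > 0" using dim by (simp add: k_def)
  have kpos: "kelvin l \<omega> y > 0" if "y \<noteq> 0" for y using kelvin_pos[of y l \<omega>] that l \<omega>(2) by simp
  have \<omega>c: "continuous_on (cball 0 l) \<omega>" using \<omega>(1) continuous_on_subset by blast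
  have ne: "cball (0::real^'n) l \<noteq> {}" using l by simp
  obtain c0 where "\<forall>z\<in>cball 0 l. \<omega> c0 \<le> \<omega> z" using continuous_attains_inf[OF compact_cball ne \<omega>c] by blast
  then obtain \<omega>0 where \<omega>0: "\<omega>0 > 0" "\<And>z. norm z \<le> l \<Longrightarrow> \<omega>0 \<le> \<omega> z" using \<omega>(2)[of c0] by auto
  obtain c1 where "\<forall>z\<in>cball 0 l. \<omega> z \<le> \<omega> c1" using continuous_attains_sup[OF compact_cball ne \<omega>c] by blast
  then obtain \<omega>1 where \<omega>1: "\<omega>1 > 0" "\<And>z. norm z \<le> l \<Longrightarrow> \<omega> z \<le> \<omega>1" using \<omega>(2)[of c1] by auto
  \<comment> \<open>Comparison with a constant bounds the inverted copy all the way to the puncture;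
    this puts a positive number into \<open>S\<close> below.\<close>
  obtain \<Omega> where \<Omega>: "\<Omega> > 0" "\<And>z. z \<noteq> 0 \<Longrightarrow> norm z \<le> l \<Longrightarrow> kelvin l \<omega> z \<le> \<Omega>"
  proof -
    have A: "\<omega>1 powr (- k) > 0" using \<omega>1 by simp
    have "kelvin l \<omega> z \<le> (\<omega>1 powr (- k)) powr (- (1 / k))" if z: "z \<noteq> 0" "norm z \<le> l" for z
    proof -
      have "\<omega>1 powr (- k) + 0 \<bullet> z \<le> kelvin l \<omega> z powr (- k)"
        unfolding k_def
      proof (rule kelvin_affine_comparison[OF dim super \<omega> l l _ z], fold k_def)
        fix z :: "real^'n" assume z: "norm z = l"
        then have "\<omega>1 powr (- k) \<le> \<omega> z powr (- k)" using \<omega>1 \<omega>(2)[of z] k by (intro powr_mono2') auto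
        then show "\<omega>1 powr (- k) + 0 \<bullet> z \<le> kelvin l \<omega> z powr (- k)" using kelvin_sphere[OF l z] by simp
      qed
      then show ?thesis using powr_neg_le_iff[OF kpos[OF z(1)] A k] by simp
    qed
    then show ?thesis using that[of "(\<omega>1 powr (- k)) powr (- (1 / k))"] A by simp
  qed
  define S where "S = {a. \<forall>z. z \<noteq> 0 \<longrightarrow> norm z \<le> l \<longrightarrow> a * kelvin l \<omega> z \<le> \<omega> z}"
  have S1: "a < 1" if "a \<in> S" for a
  proof (rule ccontr)
    assume "\<not> a < 1"
    then have "kelvin l \<omega> y \<le> a * kelvin l \<omega> y" using kpos[OF y(1)] by simp
    also have "\<dots> \<le> \<omega> y" using that y by (simp add: S_def)
    finally show False using not_le by simp
  qed
  then have bdd: "bdd_above S" by (meson bdd_aboveI less_imp_le)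
  have S0: "\<omega>0 / \<Omega> \<in> S"
  proof -
    have "\<omega>0 / \<Omega> * kelvin l \<omega> z \<le> \<omega> z" if "z \<noteq> 0" "norm z \<le> l" for z
    proof -
      have "\<omega>0 / \<Omega> * kelvin l \<omega> z \<le> \<omega>0 / \<Omega> * \<Omega>" using \<Omega> \<omega>0 that by (intro mult_left_mono) auto
      also have "\<dots> \<le> \<omega> z" using \<Omega> \<omega>0 that by simp
      finally show ?thesis .
    qed
    then show ?thesis by (simp add: S_def)
  qed
  define a where "a = Sup S"
  have "\<omega>0 / \<Omega> > 0" using \<omega>0 \<Omega> by simp
  then have a0: "a > 0" using cSup_upper[OF S0 bdd] unfolding a_def by linarith
  have aS: "a * kelvin l \<omega> z \<le> \<omega> z" if z: "z \<noteq> 0" "norm z \<le> l" for z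
  proof -
    have "a \<le> \<omega> z / kelvin l \<omega> z" unfolding a_def
    proof (rule cSup_least)
      show "S \<noteq> {}" using S0 by auto
      show "b \<le> \<omega> z / kelvin l \<omega> z" if "b \<in> S" for b
        using that kpos[OF z(1)] z by (simp add: S_def pos_le_divide_eq)
    qed
    then show ?thesis using kpos[OF z(1)] by (simp add: field_simps)
  qed
  then have "a \<in> S" by (simp add: S_def)
  then have a1: "a < 1" by (rule S1)
  define h where "h = (\<lambda>z. \<omega> z - a * kelvin l \<omega> z)"
  have h: "h z \<ge> 0" if "z \<noteq> 0" "norm z \<le> l" for z using aS[OF that] by (simp add: h_def)
  \<comment> \<open>On the sphere of radius \<open>l\<close> the function and its inverted copy
    agree, so there \<open>h\<close> is (1 - a) times \<open>\<omega>\<close>, at least 2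
    \<beta>.\<close>
  define \<beta> where "\<beta> = (1 - a) * \<omega>0 / 2"
  have \<beta>: "\<beta> > 0" using a1 \<omega>0 by (simp add: \<beta>_def)
  have h_outer: "2 * \<beta> \<le> h z" if "norm z = l" for z
  proof -
    have "h z = (1 - a) * \<omega> z" using kelvin_sphere[OF l that] by (simp add: h_def algebra_simps)
    then show ?thesis using mult_left_mono[of \<omega>0 "\<omega> z" "1 - a"] \<omega>0(2)[of z] that a1 by (simp add: \<beta>_def)
  qed
  \<comment> \<open>The share \<tau> of \<open>\<omega>\<close> pays for the perturbations: d |x|^2
    and b . x take at most \<tau> \<omega>0 / 4 each, which leaves \<mu> = \<tau> \<omega>0 / 2, and
    b . b < 4 d \<mu> follows. As \<tau> \<le> 1 / 2, the values on the outer sphere stay above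
    \<beta>.\<close>
  have min_principle: "B \<le> (1 - \<tau>) * h z + \<tau> * \<omega> z - d * (z \<bullet> z) - b \<bullet> z"
    if \<tau>: "0 < \<tau>" "\<tau> \<le> 1 / 2" and d: "d = \<tau> * \<omega>0 / (4 * l\<^sup>2)" and b: "norm b \<le> \<tau> * \<omega>0 / (4 * l)"
      and r: "r > 0" "r \<le> norm z" and z: "norm z \<le> l" and B: "B \<le> \<beta>"
      and inner: "\<And>x. norm x = r \<Longrightarrow> B \<le> (1 - \<tau>) * h x + \<tau> * \<omega> x - d * (x \<bullet> x) - b \<bullet> x"
    for B \<tau> d b r z
  proof -
    have d0: "d > 0" using \<tau> \<omega>0 l by (simp add: d)
    have rest: "\<tau> * \<omega>0 / 2 \<le> \<tau> * \<omega> x - d * (x \<bullet> x) - b \<bullet> x" if x: "norm x \<le> l" for x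
    proof -
      have "x \<bullet> x \<le> l\<^sup>2" using power_mono[OF x norm_ge_zero, of 2] by (simp add: power2_norm_eq_inner)
      then have "d * (x \<bullet> x) \<le> d * l\<^sup>2" using d0 by (intro mult_left_mono) auto
      also have "\<dots> = \<tau> * \<omega>0 / 4" using l by (simp add: d)
      finally have 1: "d * (x \<bullet> x) \<le> \<tau> * \<omega>0 / 4" .
      have "b \<bullet> x \<le> norm b * norm x" by (rule norm_cauchy_schwarz)
      also have "\<dots> \<le> \<tau> * \<omega>0 / (4 * l) * l" using b x \<tau> \<omega>0 l by (intro mult_mono) auto
      also have "\<dots> = \<tau> * \<omega>0 / 4" using l by simp
      finally have 2: "b \<bullet> x \<le> \<tau> * \<omega>0 / 4" .
      have "\<tau> * \<omega>0 \<le> \<tau> * \<omega> x" using \<omega>0(2)[OF x] \<tau> by simp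
      then show ?thesis using 1 2 by linarith
    qed
    have eq: "\<omega> x - ((1 - \<tau>) * a) * kelvin l \<omega> x - d * (x \<bullet> x) - b \<bullet> x
      = (1 - \<tau>) * h x + \<tau> * \<omega> x - d * (x \<bullet> x) - b \<bullet> x" for x
      by (simp add: h_def algebra_simps)
    have "B \<le> \<omega> z - ((1 - \<tau>) * a) * kelvin l \<omega> z - d * (z \<bullet> z) - b \<bullet> z"
    proof (rule annulus_min_principle[OF U_pos U_cone U_orth sub approx \<omega> l _ d0 r(1), where \<mu> = "\<tau> * \<omega>0 / 2" and ?r1.0 = l])
      show "(1 - \<tau>) * a > 0" using \<tau> a0 by simp
      have "b \<bullet> b \<le> (\<tau> * \<omega>0 / (4 * l))\<^sup>2" using power_mono[OF b norm_ge_zero, of 2] by (simp add: power2_norm_eq_inner)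
      also have "\<dots> < 4 * d * (\<tau> * \<omega>0 / 2)" using \<tau> \<omega>0 l by (simp add: d power2_eq_square field_simps)
      finally show "b \<bullet> b < 4 * d * (\<tau> * \<omega>0 / 2)" .
      show "\<tau> * \<omega>0 / 2 \<le> \<omega> x - ((1 - \<tau>) * a) * kelvin l \<omega> x - d * (x \<bullet> x) - b \<bullet> x"
        if "r \<le> norm x" "norm x \<le> l" for x
      proof -
        have "x \<noteq> 0" using that r by auto
        then have "(1 - \<tau>) * h x \<ge> 0" using h[of x] that \<tau> by simp
        then show ?thesis unfolding eq using rest[OF that(2)] by linarith
      qed
      show "B \<le> \<omega> x - ((1 - \<tau>) * a) * kelvin l \<omega> x - d * (x \<bullet> x) - b \<bullet> x" if "norm x = r \<or> norm x = l" for x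
        using that
      proof
        assume x: "norm x = l"
        have "1 / 2 * (2 * \<beta>) \<le> (1 - \<tau>) * h x" using h_outer[OF x] \<tau> \<beta> by (intro mult_mono) auto
        moreover have "\<tau> * \<omega>0 / 2 \<ge> 0" using \<tau> \<omega>0 by simp
        ultimately show ?thesis unfolding eq using rest[of x] x B by linarith
      qed (unfold eq, rule inner)
    qed (use r z in auto)
    then show ?thesis unfolding eq .
  qed
  obtain \<kappa> r where gap: "\<kappa> > 0" "r > 0" "r \<le> l" "\<And>z. z \<noteq> 0 \<Longrightarrow> norm z \<le> r \<Longrightarrow> \<kappa> \<le> h z"
  proof -
    \<comment> \<open>Chosen so that \<tau> times \<open>\<omega> 0\<close> is below \<beta>: the
      bound coming from the puncture, and not the one from the outer sphere, is then
      decisive.\<close>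
    define \<tau> where "\<tau> = min (1 / 2) (\<beta> / (2 * \<omega> 0))"
    have \<tau>: "0 < \<tau>" "\<tau> \<le> 1 / 2" using \<beta> \<omega>(2)[of 0] by (auto simp: \<tau>_def)
    have "\<tau> * \<omega> 0 \<le> \<beta> / (2 * \<omega> 0) * \<omega> 0" using \<omega>(2)[of 0] by (intro mult_right_mono) (auto simp: \<tau>_def)
    then have \<tau>\<beta>: "\<tau> * \<omega> 0 < \<beta>" using \<beta> \<omega>(2)[of 0] by simp
    define d where "d = \<tau> * \<omega>0 / (4 * l\<^sup>2)"
    define e where "e = \<tau> * \<omega>0 / (4 * l)"
    have d: "d > 0" and e: "e > 0" using \<tau> \<omega>0 l by (simp_all add: d_def e_def)
    \<comment> \<open>The inner radius can be arbitrarily small: on such spheres \<open>h\<close> is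
      nonnegative and the remaining terms tend to \<tau> times \<open>\<omega> 0\<close>.\<close>
    have claim: "\<tau> * \<omega> 0 \<le> (1 - \<tau>) * h z + \<tau> * \<omega> z - d * (z \<bullet> z) - b \<bullet> z"
      if z: "z \<noteq> 0" "norm z \<le> l" and b: "norm b \<le> e" for z b
    proof (rule ccontr)
      define H where "H = (1 - \<tau>) * h z + \<tau> * \<omega> z - d * (z \<bullet> z) - b \<bullet> z"
      assume "\<not> \<tau> * \<omega> 0 \<le> (1 - \<tau>) * h z + \<tau> * \<omega> z - d * (z \<bullet> z) - b \<bullet> z"
      then have not: "\<not> \<tau> * \<omega> 0 \<le> H" by (simp add: H_def)
      define \<sigma> where "\<sigma> = (\<tau> * \<omega> 0 - H) / 2"
      have \<sigma>: "\<sigma> > 0" using not by (simp add: \<sigma>_def)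
      let ?q = "\<lambda>x. \<tau> * \<omega> x - d * (x \<bullet> x) - b \<bullet> x"
      have "continuous_on UNIV ?q" by (intro continuous_intros \<omega>(1))
      then have "isCont ?q 0" by (simp add: continuous_on_eq_continuous_at)
      then have "(?q \<longlongrightarrow> ?q 0) (nhds 0)"
        using tendsto_at_iff_tendsto_nhds[of ?q 0] unfolding isCont_def by blast
      from tendstoD[OF this \<sigma>] obtain s where s: "s > 0" "\<And>x. norm x < s \<Longrightarrow> \<bar>?q x - \<tau> * \<omega> 0\<bar> < \<sigma>"
        by (auto simp: eventually_nhds_metric dist_real_def)
      define \<rho> where "\<rho> = min (s / 2) (norm z)"
      have \<rho>: "\<rho> > 0" "\<rho> < s" "\<rho> \<le> norm z" using s z by (auto simp: \<rho>_def)
      have "min (\<tau> * \<omega> 0 - \<sigma>) \<beta> \<le> H"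
        unfolding H_def
      proof (rule min_principle[OF \<tau> d_def b[unfolded e_def] \<rho>(1,3) z(2)])
        fix x :: "real^'n" assume x: "norm x = \<rho>"
        then have "x \<noteq> 0" "norm x \<le> l" using \<rho> z by auto
        then have "(1 - \<tau>) * h x \<ge> 0" using h[of x] \<tau> by simp
        moreover have "?q x > \<tau> * \<omega> 0 - \<sigma>" using s(2)[of x] x \<rho> unfolding abs_less_iff by linarith
        ultimately show "min (\<tau> * \<omega> 0 - \<sigma>) \<beta> \<le> (1 - \<tau>) * h x + \<tau> * \<omega> x - d * (x \<bullet> x) - b \<bullet> x" by linarith
      qed simp
      moreover have "H = \<tau> * \<omega> 0 - 2 * \<sigma>" unfolding \<sigma>_def by (simp add: diff_divide_distrib)
      ultimately show False using \<sigma> \<tau>\<beta> by linarith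
    qed
    have "(1 - \<tau>) * a * kelvin l \<omega> z \<le> \<omega> z - \<tau> * \<omega> 0 - e * norm z" if z: "z \<noteq> 0" "norm z \<le> l" for z
    proof -
      \<comment> \<open>For each \<open>z\<close> the linear term is aligned with \<open>z\<close>,
        so that b . z = e |z|; this yields the conical gap.\<close>
      let ?b = "(e / norm z) *\<^sub>R z"
      have "norm ?b \<le> e" using z e by simp
      from claim[OF z this] have "\<tau> * \<omega> 0 \<le> (1 - \<tau>) * h z + \<tau> * \<omega> z - d * (z \<bullet> z) - ?b \<bullet> z" .
      moreover have "?b \<bullet> z = e * norm z" using z(1)
        by (simp add: power2_norm_eq_inner[symmetric] power2_eq_square)
      moreover have "d * (z \<bullet> z) \<ge> 0" using d by simp
      ultimately show ?thesis by (simp add: h_def algebra_simps)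
    qed
    moreover have "\<tau> < 1" using \<tau>(2) by simp
    ultimately obtain \<kappa> r where
      "\<kappa> > 0" "r > 0" "r \<le> l" "\<And>z. z \<noteq> 0 \<Longrightarrow> norm z \<le> r \<Longrightarrow> \<kappa> \<le> \<omega> z - a * kelvin l \<omega> z"
      using kelvin_strict_gap_near_0[OF dim super \<omega> diff l a0 \<tau>(1) _ e] by blast
    then show ?thesis using that by (simp add: h_def)
  qed
  \<comment> \<open>Second use of the minimum principle, with b = 0 and the inner sphere fixed at
    radius \<open>r\<close>, where the gap is at least \<open>\<kappa>\<close>; the factor 1 -
    \<tau> \<ge> 1 / 2 halves it.\<close>
  define B where "B = min (\<kappa> / 2) \<beta>"
  have B: "B > 0" "B \<le> \<beta>" "B \<le> \<kappa> / 2" using gap \<beta> by (auto simp: B_def)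
  have hB: "B / 2 \<le> h z" if z: "z \<noteq> 0" "norm z \<le> l" for z
  proof (cases "norm z \<le> r")
    case True
    then show ?thesis using gap(1) gap(4)[OF z(1)] B by simp
  next
    case False
    \<comment> \<open>Ensures that \<tau> \<omega> is at most B / 2, so half of \<open>B\<close>
      survives when the perturbation is removed.\<close>
    define \<tau> where "\<tau> = min (1 / 2) (B / (2 * \<omega>1))"
    have \<tau>: "0 < \<tau>" "\<tau> \<le> 1 / 2" using B \<omega>1 by (auto simp: \<tau>_def)
    have "\<tau> * \<omega> z \<le> B / (2 * \<omega>1) * \<omega>1" using \<omega>1 z B \<omega>(2)[of z] by (intro mult_mono) (auto simp: \<tau>_def less_imp_le)
    then have \<tau>B: "\<tau> * \<omega> z \<le> B / 2" using \<omega>1 by simp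
    define d where "d = \<tau> * \<omega>0 / (4 * l\<^sup>2)"
    have d: "d > 0" using \<tau> \<omega>0 l by (simp add: d_def)
    have b: "norm (0::real^'n) \<le> \<tau> * \<omega>0 / (4 * l)" using \<tau> \<omega>0 l by simp
    have "B \<le> (1 - \<tau>) * h z + \<tau> * \<omega> z - d * (z \<bullet> z) - 0 \<bullet> z"
    proof (rule min_principle[OF \<tau> d_def b gap(2) _ z(2) B(2)])
      fix x :: "real^'n" assume x: "norm x = r"
      then have "x \<noteq> 0" using gap by auto
      then have "1 / 2 * \<kappa> \<le> (1 - \<tau>) * h x" using gap(1,4) x \<tau> by (intro mult_mono) auto
      moreover have "d * (x \<bullet> x) \<le> \<tau> * \<omega> x"
      proof -
        have "x \<bullet> x \<le> l\<^sup>2" using power_mono[of r l 2] x gap by (simp add: power2_norm_eq_inner[symmetric])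
        then have "d * (x \<bullet> x) \<le> d * l\<^sup>2" using d by (intro mult_left_mono) auto
        also have "\<dots> = \<tau> * (\<omega>0 / 4)" using l by (simp add: d_def)
        also have "\<dots> \<le> \<tau> * \<omega> x" using \<tau> \<omega>0(1) \<omega>0(2)[of x] x gap by (intro mult_left_mono) auto
        finally show ?thesis .
      qed
      ultimately show "B \<le> (1 - \<tau>) * h x + \<tau> * \<omega> x - d * (x \<bullet> x) - 0 \<bullet> x" using B(3) by simp
    qed (use False in simp)
    moreover have "(1 - \<tau>) * h z \<le> h z" using h[OF z] \<tau> by (simp add: mult_left_le_one_le)
    moreover have "d * (z \<bullet> z) \<ge> 0" using d by simp
    ultimately show ?thesis using \<tau>B by simp
  qed
  \<comment> \<open>The inverted copy is at most \<Omega>, so raising \<open>a\<close> by B / (2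
    \<Omega>) costs at most the gap B / 2.\<close>
  have "a + B / (2 * \<Omega>) \<in> S"
  proof -
    have "(a + B / (2 * \<Omega>)) * kelvin l \<omega> z \<le> \<omega> z" if z: "z \<noteq> 0" "norm z \<le> l" for z
    proof -
      have "B / (2 * \<Omega>) * kelvin l \<omega> z \<le> B / (2 * \<Omega>) * \<Omega>" using \<Omega> z B by (intro mult_left_mono) auto
      also have "\<dots> = B / 2" using \<Omega> by simp
      finally show ?thesis using hB[OF z] by (simp add: h_def distrib_right)
    qed
    then show ?thesis by (simp add: S_def)
  qed
  from cSup_upper[OF this bdd] have "B / (2 * \<Omega>) \<le> 0" by (simp add: a_def)
  moreover have "B / (2 * \<Omega>) > 0" using B \<Omega> by simp
  ultimately show False by simp
qed

section \<open>Translations and the receding centre of inversion\<close>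

lemma eventually_nhds_translate:
  fixes x y :: "'a::real_normed_vector"
  shows "(\<forall>\<^sub>F z in nhds (x + y). P z) \<longleftrightarrow> (\<forall>\<^sub>F z in nhds y. P (x + z))"
proof
  assume "\<forall>\<^sub>F z in nhds (x + y). P z"
  moreover have "((\<lambda>z. x + z) \<longlongrightarrow> x + y) (nhds y)" by (intro tendsto_intros) (simp add: tendsto_def eventually_nhds filterlim_ident)
  ultimately show "\<forall>\<^sub>F z in nhds y. P (x + z)" by (rule eventually_compose_filterlim)
next
  assume *: "\<forall>\<^sub>F z in nhds y. P (x + z)"
  obtain d where "d > 0" "\<And>z. dist z y < d \<Longrightarrow> P (x + z)" using * by (auto simp: eventually_nhds_metric)
  then show "\<forall>\<^sub>F z in nhds (x + y). P z"
    unfolding eventually_nhds_metric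
    by (intro exI[of _ d]) (metis add.commute add_diff_cancel_left' diff_diff_eq diff_add_cancel dist_norm)
qed

lemma subjet_translate: "subjet (\<lambda>y. f (x + y)) y p P \<Longrightarrow> subjet f (x + y) p P"
  unfolding subjet_def eventually_nhds_translate by simp

lemma twice_diff_translate:
  assumes "twice_diff f G H (x + y)"
  shows "twice_diff (\<lambda>y. f (x + y)) (\<lambda>y. G (x + y)) H y"
proof -
  have tr: "((\<lambda>z. x + z) has_derivative (\<lambda>h. h)) (at z)" for z
    by (auto intro!: derivative_eq_intros)
  show ?thesis
    unfolding twice_diff_def
  proof
    have "\<forall>\<^sub>F z in nhds y. (f has_derivative (\<lambda>h. G (x + z) \<bullet> h)) (at (x + z))"
      using assms by (simp add: twice_diff_def eventually_nhds_translate)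
    then show "\<forall>\<^sub>F z in nhds y. ((\<lambda>y. f (x + y)) has_derivative (\<lambda>h. G (x + z) \<bullet> h)) (at z)"
      by eventually_elim (rule has_derivative_compose[OF tr])
    show "((\<lambda>y. G (x + y)) has_derivative (*v) H) (at y)"
      using assms by (intro has_derivative_compose[OF tr]) (simp add: twice_diff_def)
  qed
qed

lemma visc_sub_translate: "visc_sub U \<omega> \<Longrightarrow> visc_sub U (\<lambda>y. \<omega> (x + y))"
  unfolding visc_sub_def using subjet_translate by blast

lemma visc_superharmonic_translate: "visc_superharmonic u \<Longrightarrow> visc_superharmonic (\<lambda>y. u (x + y))"
  unfolding visc_superharmonic_def using subjet_translate by blast

lemma uniform_limit_translate:
  assumes "uniform_limit ((+) x ` K) f g F"
  shows "uniform_limit K (\<lambda>k y. f k (x + y)) (\<lambda>y. g (x + y)) F"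
  using assms unfolding uniform_limit_iff by simp

lemma approx_super_translate:
  assumes "approx_super U \<omega>" shows "approx_super U (\<lambda>y. \<omega> (x + y))"
proof -
  obtain w G H \<beta> where A: "\<forall>(k::nat) x. w k x > 0 \<and> twice_diff (w k) (G k) (H k x) x \<and> transpose (H k x) = H k x \<and>
        transpose (\<beta> k x) = \<beta> k x \<and> schouten (w k x) (G k x) (H k x) + \<beta> k x \<in> U"
    and L: "\<forall>K. compact K \<longrightarrow> uniform_limit K w \<omega> sequentially \<and> uniform_limit K \<beta> (\<lambda>_. 0) sequentially"
    using assms unfolding approx_super_def by (elim exE conjE) (rule that)
  have "uniform_limit K (\<lambda>k y. w k (x + y)) (\<lambda>y. \<omega> (x + y)) sequentially"
    "uniform_limit K (\<lambda>k y. \<beta> k (x + y)) (\<lambda>_. 0) sequentially" if "compact K" for K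
  proof -
    have "compact ((+) x ` K)" using that by (rule compact_translation)
    with L show "uniform_limit K (\<lambda>k y. w k (x + y)) (\<lambda>y. \<omega> (x + y)) sequentially"
      "uniform_limit K (\<lambda>k y. \<beta> k (x + y)) (\<lambda>_. 0) sequentially"
      using uniform_limit_translate[where x = x and K = K and f = w and g = \<omega>]
        uniform_limit_translate[where x = x and K = K and f = \<beta> and g = "\<lambda>_. 0"] by simp_all
  qed
  then show ?thesis unfolding approx_super_def
    by (intro exI[of _ "\<lambda>k y. w k (x + y)"] exI[of _ "\<lambda>k y. G k (x + y)"] exI[of _ "\<lambda>k y. H k (x + y)"]
        exI[of _ "\<lambda>k y. \<beta> k (x + y)"] conjI allI impI)
      (use A twice_diff_translate in \<open>simp_all add: twice_diff_translate\<close>)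
qed

text \<open>Letting the centre of the inversion recede along the line through two points, the inverted copy at one point
  tends to the value at the other.\<close>

lemma kelvin_le_imp_constant:
  fixes \<omega> :: "real^'n \<Rightarrow> real"
  assumes pos: "\<And>x. \<omega> x > 0"
    and le: "\<And>x l y. l > 0 \<Longrightarrow> y \<noteq> 0 \<Longrightarrow> norm y \<le> l \<Longrightarrow> kelvin l (\<lambda>y. \<omega> (x + y)) y \<le> \<omega> (x + y)"
  shows "\<omega> z \<le> \<omega> y"
proof (cases "z = y")
  case False
  define e where "e = z - y"
  have e: "e \<bullet> e > 0" using False by (simp add: e_def)
  have step: "\<omega> z \<le> \<omega> y + \<omega> y / m" if m: "m > 0" for m :: real
  proof -
    \<comment> \<open>The centre lies on the line through \<open>y\<close> and \<open>z\<close>,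
      beyond \<open>y\<close>, at distances m |e| and (m + 1) |e| from them. The square of
      \<open>l\<close> is the product of these distances, so the inversion maps \<open>y\<close> to
      \<open>z\<close>.\<close>
    define x where "x = y - m *\<^sub>R e"
    have xy: "x + m *\<^sub>R e = y" by (simp add: x_def)
    define l where "l = sqrt (m * (m + 1) * (e \<bullet> e))"
    have l: "l > 0" "l\<^sup>2 = m * (m + 1) * (e \<bullet> e)" using m e by (simp_all add: l_def)
    have "l\<^sup>2 / (m *\<^sub>R e \<bullet> m *\<^sub>R e) * m = m + 1" using m e unfolding l(2) by (simp add: divide_simps)
    then have "inversion l (m *\<^sub>R e) = (m + 1) *\<^sub>R e" by (simp add: inversion_def)
    moreover have "x + (m + 1) *\<^sub>R e = z" by (simp add: x_def e_def algebra_simps)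
    moreover have "(m *\<^sub>R e \<bullet> m *\<^sub>R e) / l\<^sup>2 = m / (m + 1)" using m e unfolding l(2) by (simp add: divide_simps)
    ultimately have k: "kelvin l (\<lambda>y. \<omega> (x + y)) (m *\<^sub>R e) = m / (m + 1) * \<omega> z"
      unfolding kelvin_def by (simp only:)
    have "(norm (m *\<^sub>R e))\<^sup>2 \<le> l\<^sup>2"
      unfolding l(2) power2_norm_eq_inner using m e by (simp add: algebra_simps)
    then have "norm (m *\<^sub>R e) \<le> l" by (rule power2_le_imp_le) (use l(1) in simp)
    moreover have "m *\<^sub>R e \<noteq> 0" using m e by auto
    ultimately have "m / (m + 1) * \<omega> z \<le> \<omega> (x + m *\<^sub>R e)" using le[OF l(1), of "m *\<^sub>R e" x] unfolding k by blast
    then have "m / (m + 1) * \<omega> z \<le> \<omega> y" unfolding xy .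
    then show ?thesis using m by (simp add: field_simps)
  qed
  show ?thesis
  proof (rule field_le_epsilon)
    fix \<epsilon> :: real assume "\<epsilon> > 0"
    then show "\<omega> z \<le> \<omega> y + \<epsilon>" using step[of "\<omega> y / \<epsilon>"] pos[of y] by simp
  qed
qed simp

theorem theorem1p2:
  fixes U :: "(real^'n::finite^'n) set"
    and F :: "real^'n^'n \<Rightarrow> real"
    and u :: "real^'n \<Rightarrow> real"
  assumes dim: "CARD('n) \<ge> 3"
    and U_open: "openin (top_of_set sym_matrices) U"
    and F_C1: "C1_on_sym U F"
    and F_C0: "continuous_on (closure U) F"
    and U_orth: "\<And>Q. orthogonal_matrix Q \<Longrightarrow> (\<lambda>M. matrix_inv Q ** M ** Q) ` U = U"
    and U_pos: "\<And>M N. M \<in> U \<Longrightarrow> N \<in> pos_def_matrices \<Longrightarrow> M + N \<in> U"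
    and U_cone: "\<And>M a. M \<in> U \<Longrightarrow> a > 0 \<Longrightarrow> a *\<^sub>R M \<in> U"
    and U_diag: "{a *\<^sub>R mat 1 | a. a > 0} \<inter> (top_of_set sym_matrices frontier_of U) = {}"
    and F_orth: "\<And>M Q. M \<in> U \<Longrightarrow> orthogonal_matrix Q \<Longrightarrow> F (matrix_inv Q ** M ** Q) = F M"
    and F_ell: "\<And>M. M \<in> U \<Longrightarrow> matrix_gradient F M \<in> pos_def_matrices"
    and F_pos: "\<And>M. M \<in> U \<Longrightarrow> F M > 0"
    and F_zero: "\<And>M. M \<in> top_of_set sym_matrices frontier_of U \<Longrightarrow> F M = 0"
    and u_C1: "Ck_on 1 UNIV u"
    and u_pos: "\<And>x. u x > 0"
    and u_weak: "weak_solution U F UNIV u"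
    and u_super: "distr_laplacian_nonpos u"
  shows "\<forall>x. u x = u 0"
proof -
  define s where "s = - (2 / (real CARD('n) - 2))"
  define k where "k = (real CARD('n) - 2) / 2"
  define \<omega> where "\<omega> = (\<lambda>x. u x powr s)"
  have sk: "s * k = - 1" using dim by (simp add: s_def k_def)
  have u_eq: "\<omega> x powr (- k) = u x" for x using u_pos[of x] by (simp add: \<omega>_def powr_powr sk)
  have \<omega>_pos: "\<omega> x > 0" for x using u_pos[of x] by (simp add: \<omega>_def)
  have u_diff: "u differentiable (at x)" for x using u_C1 by (simp add: differentiable_on_def)
  then have u_cont: "continuous_on UNIV u"
    by (simp add: differentiable_imp_continuous_on differentiable_on_def)
  have "u x \<noteq> 0" for x using u_pos[of x] by simp
  then have \<omega>_cont: "continuous_on UNIV \<omega>" unfolding \<omega>_def by (intro continuous_intros u_cont) simp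
  have \<omega>_diff: "\<omega> differentiable (at x)" for x
    using has_derivative_compose[OF has_derivative_gradient[OF u_diff] has_real_derivative_powr[OF u_pos, unfolded has_field_derivative_def]]
    unfolding \<omega>_def differentiable_def by blast
  have F_diff: "F differentiable_on U" using F_C1 by (simp add: C1_on_sym_def)
  note approx = weak_solution_approx[OF dim U_open U_pos F_diff F_ell F_pos u_weak, folded s_def \<omega>_def]
  have "visc_superharmonic u"
    unfolding visc_superharmonic_def trace_def using trace_subjet_nonpos[OF u_cont u_super] by blast
  then have super: "visc_superharmonic (\<lambda>x. \<omega> x powr (- k))" by (simp add: u_eq)
  have le: "kelvin l (\<lambda>y. \<omega> (x + y)) y \<le> \<omega> (x + y)" if "l > 0" "y \<noteq> 0" "norm y \<le> l" for x l y
  proof (rule kelvin_le[OF dim U_pos U_cone U_orth visc_sub_translate[OF approx(1)] approx_super_translate[OF approx(2)]])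
    show "visc_superharmonic (\<lambda>y. \<omega> (x + y) powr (- ((real CARD('n) - 2) / 2)))"
      using visc_superharmonic_translate[OF super] by (simp add: k_def)
    show "continuous_on UNIV (\<lambda>y. \<omega> (x + y))"
      by (rule continuous_on_compose2[OF \<omega>_cont]) (auto intro!: continuous_intros)
    show "(\<lambda>y. \<omega> (x + y)) differentiable (at 0)"
      by (rule differentiable_compose[of \<omega>]) (simp_all add: \<omega>_diff)
  qed (use that \<omega>_pos in auto)
  have "\<omega> x = \<omega> 0" for x
    using kelvin_le_imp_constant[of \<omega>, OF \<omega>_pos le] by (simp add: order_antisym)
  then show ?thesis using u_eq by metis
qed

end
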